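(* Let $\mathbf X=(X_1,\dots,X_d)$ be continuous explanatory variables and $Y$ a discrete target variable with values in a finite set $\mathcal Y$, $p(y_i)=P(Y=y_i)$, and let $P$ be the joint distribution of $(\mathbf X,Y)$ (given by the training data). Assign weights to the edges $(l,m)$ of the complete graph on $D=\{1,\dots,d\}$ according to the assumption made on the explanatory variables: (1) if the explanatory variables have a joint Gaussian distribution: $\omega(l,m)=\sum_{y_i\in\mathcal Y}p(y_i)\log(1-\rho^2_{lm\mid y_i})$, where $\rho_{lm\mid y_i}$ is the correlation between $X_l$ and $X_m$ having the class value $Y=y_i$; (2) if the dependence structure is described by a Gauss copula: $w_G(l,m)=\sum_{y_i\in\mathcal Y}p(y_i)\log(1-\rho_{G,lm\mid y_i}^2)$, where $\rho_{G,lm\mid y_i}$ is the parameter of the pair-Gauss copula which describes the dependence between $X_l$ and $X_m$ having the class value $Y=y_i$; (3) if there is no restriction on the marginal distributions or on the joint copula: $w(l,m)=\sum_{y_i\in\mathcal Y}p(y_i)\,I_{c_{X_l,X_m\mid y_i}}(U_l,U_m)$. Then applying Prim's or Kruskal's algorithm to find the maximum spanning tree of the complete graph on $D$ with edges weighted in this way is guaranteed to find the GNB structure (with a cluster $(l,m,0)$ for each edge $(l,m)$ of the tree) that best fits the training data under the given assumption, in the sense of minimizing $\mathrm{KL}(P,P_{GNB})$ over GNB structures.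
   Context: $\log$ is the natural logarithm. GNB structure: on $\{0\}\cup D$ (vertex $0$ stands for $Y$), a GNB graph is built as follows. Start with a triangle $\{0,i_1,i_2\}$, $i_1,i_2\in D$ distinct. Then repeatedly add a new vertex $i_{k+1}\in D$, connecting it to $0$ and to one already present vertex of $\{i_1,\dots,i_k\}$, until all of $D$ is used. The subgraph induced on $D$ is a spanning tree of $D$, and it characterizes the GNB structure uniquely. The set of clusters $\mathcal C$ consists of the 3-element maximal cliques $(l,m,0)$; the set of separators $\mathcal S$ consists of the pairs $S=(s,0)$ that are intersections of connected clusters (two clusters are connected only if they share 2 elements, and the clusters containing a common pair are connected tree-like); the multiplicity $\nu_S$ of $S\in\mathcal S$ is the number of clusters containing it. GNB distribution: with $p$ the density/mass function of $P$, $P_{GNB}$ has density/mass function $$p_{GNB}(\mathbf x,y)=\frac{\prod_{(l,m,0)\in\mathcal C}p(x_l,x_m,y)}{\prod_{S=(s,0)\in\mathcal S}p(x_s,y)^{\nu_S-1}},$$ where the factors are the marginals of $p$, and $\mathrm{KL}(P,P_{GNB})=\sum_{y}\int p(\mathbf x,y)\log\frac{p(\mathbf x,y)}{p_{GNB}(\mathbf x,y)}\,d\mathbf x$. Copula notions: $c_{X_l,X_m\mid y}$ is the copula density of $(X_l,X_m)$ given $Y=y$, i.e. the density of $(U_l,U_m)$ given $Y=y$, where $U_l,U_m$ are obtained by applying to $X_l,X_m$ their c.d.f.s given $Y=y$; $I_{c}(U_l,U_m)=H(U_l)+H(U_m)-H(U_l,U_m)$, with $H$ differential entropy, is the information content of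 a vector $(U_l,U_m)\in(0,1)^2$ with density $c$.
   Formalization: In (1) and (2) the weights are taken with the opposite sign (−Σ p(y) log(1−ρ²)), since the printed sign selects the worst tree; in (3) every pair copula density (classes of positive probability) is assumed to have finite entropy, so that the weights are real numbers. *)

theory Defs
  imports "HOL-Probability.Probability"
begin

section \<open>Undirected graphs, maximum spanning trees, Prim and Kruskal\<close>

text \<open>A graph is given by its set of edges, an edge being a two-element set of vertices. The notion
  of tree in the Graph\_Theory entry of the AFP only excludes directed cycles, hence it is not
  used here.\<close>

definition complete_edges :: "nat set \<Rightarrow> nat set set" where
  "complete_edges D = {{u, v} | u v. u \<in> D \<and> v \<in> D \<and> u \<noteq> v}"

definition connected_graph :: "nat set \<Rightarrow> nat set set \<Rightarrow> bool" where
  "connected_graph D E \<longleftrightarrow> (\<forall>u\<in>D. \<forall>v\<in>D. (u, v) \<in> {(a, b). {a, b} \<in> E}\<^sup>*)"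

definition acyclic_graph :: "nat set set \<Rightarrow> bool" where
  "acyclic_graph E \<longleftrightarrow>
     (\<nexists>vs. 3 \<le> length vs \<and> distinct vs \<and>
           (\<forall>i<length vs. {vs ! i, vs ! (Suc i mod length vs)} \<in> E))"

definition spanning_tree :: "nat set \<Rightarrow> nat set set \<Rightarrow> bool" where
  "spanning_tree D T \<longleftrightarrow> T \<subseteq> complete_edges D \<and> connected_graph D T \<and> acyclic_graph T"

text \<open>The weight functions used below are symmetric, so reading the weight of the edge
  \<open>{l, m}\<close> with the endpoints in increasing order is only a choice of representative.\<close>

definition edge_weight :: "(nat \<Rightarrow> nat \<Rightarrow> real) \<Rightarrow> nat set \<Rightarrow> real" where
  "edge_weight w e = w (Min e) (Max e)"

definition maximum_spanning_tree :: "nat set \<Rightarrow> (nat \<Rightarrow> nat \<Rightarrow> real) \<Rightarrow> nat set set \<Rightarrow> bool" where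
  "maximum_spanning_tree D w T \<longleftrightarrow>
     spanning_tree D T \<and>
     (\<forall>T'. spanning_tree D T' \<longrightarrow> (\<Sum>e\<in>T'. edge_weight w e) \<le> (\<Sum>e\<in>T. edge_weight w e))"

text \<open>Both algorithms are nondeterministic: the initial vertex in Prim's algorithm and the choice
  among edges of equal weight are arbitrary. The outputs are the reachable states in which
  no further step is possible.\<close>

definition prim_step ::
  "nat set \<Rightarrow> (nat \<Rightarrow> nat \<Rightarrow> real) \<Rightarrow> nat set \<times> nat set set \<Rightarrow> nat set \<times> nat set set \<Rightarrow> bool" where
  "prim_step D w s s' \<longleftrightarrow>
     (\<exists>V T u v. s = (V, T) \<and> s' = (insert v V, insert {u, v} T) \<and> u \<in> V \<and> v \<in> D - V \<and>
        (\<forall>u'\<in>V. \<forall>v'\<in>D - V. edge_weight w {u', v'} \<le> edge_weight w {u, v}))"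

definition prim_output :: "nat set \<Rightarrow> (nat \<Rightarrow> nat \<Rightarrow> real) \<Rightarrow> nat set set \<Rightarrow> bool" where
  "prim_output D w T \<longleftrightarrow>
     (\<exists>r\<in>D. \<exists>V. (prim_step D w)\<^sup>*\<^sup>* ({r}, {}) (V, T) \<and> (\<nexists>s. prim_step D w (V, T) s))"

definition kruskal_step ::
  "nat set \<Rightarrow> (nat \<Rightarrow> nat \<Rightarrow> real) \<Rightarrow> nat set set \<Rightarrow> nat set set \<Rightarrow> bool" where
  "kruskal_step D w F F' \<longleftrightarrow>
     (\<exists>e. F' = insert e F \<and> e \<in> complete_edges D - F \<and> acyclic_graph (insert e F) \<and>
        (\<forall>e'\<in>complete_edges D - F. acyclic_graph (insert e' F) \<longrightarrow>
           edge_weight w e' \<le> edge_weight w e))"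

definition kruskal_output :: "nat set \<Rightarrow> (nat \<Rightarrow> nat \<Rightarrow> real) \<Rightarrow> nat set set \<Rightarrow> bool" where
  "kruskal_output D w T \<longleftrightarrow>
     (kruskal_step D w)\<^sup>*\<^sup>* {} T \<and> (\<nexists>F. kruskal_step D w T F)"


section \<open>GNB structures\<close>

text \<open>The vertex \<open>0\<close> stands for the class variable \<open>Y\<close>; the vertices in \<open>D\<close> (with \<open>0 \<notin> D\<close>) stand
  for the explanatory variables. In \<open>gnb_partial D I E\<close>, the set \<open>I\<close> consists of the vertices
  of \<open>D\<close> used so far.\<close>

inductive gnb_partial :: "nat set \<Rightarrow> nat set \<Rightarrow> nat set set \<Rightarrow> bool" for D where
  triangle: "\<lbrakk>i \<in> D; j \<in> D; i \<noteq> j\<rbrakk> \<Longrightarrow> gnb_partial D {i, j} {{0, i}, {0, j}, {i, j}}"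
| add_vertex: "\<lbrakk>gnb_partial D I E; v \<in> D - I; u \<in> I\<rbrakk>
    \<Longrightarrow> gnb_partial D (insert v I) (E \<union> {{0, v}, {u, v}})"

definition gnb_structure :: "nat set \<Rightarrow> nat set set \<Rightarrow> bool" where
  "gnb_structure D E \<longleftrightarrow> gnb_partial D D E"

definition gnb_of_tree :: "nat set \<Rightarrow> nat set set \<Rightarrow> nat set set" where
  "gnb_of_tree D T = T \<union> {{0, i} | i. i \<in> D}"

definition is_clique :: "nat set set \<Rightarrow> nat set \<Rightarrow> bool" where
  "is_clique E C \<longleftrightarrow> C \<subseteq> \<Union>E \<and> (\<forall>u\<in>C. \<forall>v\<in>C. u \<noteq> v \<longrightarrow> {u, v} \<in> E)"

definition clusters :: "nat set set \<Rightarrow> nat set set" where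
  "clusters E = {C. card C = 3 \<and> is_clique E C \<and> (\<forall>C'. is_clique E C' \<and> C \<subseteq> C' \<longrightarrow> C' = C)}"

definition separators :: "nat set set \<Rightarrow> nat set set" where
  "separators E =
     {C \<inter> C' | C C'. C \<in> clusters E \<and> C' \<in> clusters E \<and> C \<noteq> C' \<and> card (C \<inter> C') = 2}"

definition multiplicity_sep :: "nat set set \<Rightarrow> nat set \<Rightarrow> nat" where
  "multiplicity_sep E S = card {C \<in> clusters E. S \<subseteq> C}"


section \<open>GNB density and Kullback--Leibler divergence\<close>

text \<open>In the following \<open>p x y\<close> is a density with respect to Lebesgue measure on \<open>\<real>\<^sup>D\<close>
  (functions on \<open>D\<close>) times counting measure. The marginal \<open>p(x\<^sub>A, y)\<close> integrates out the
  coordinates in \<open>D - A\<close>; of the argument \<open>x\<close> only the coordinates in \<open>A\<close> matter.\<close>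

definition marginal_density ::
  "nat set \<Rightarrow> ((nat \<Rightarrow> real) \<Rightarrow> 'y \<Rightarrow> real) \<Rightarrow> nat set \<Rightarrow> (nat \<Rightarrow> real) \<Rightarrow> 'y \<Rightarrow> real" where
  "marginal_density D p A x y =
     (\<integral>z. p (merge A (D - A) (x, z)) y \<partial>(\<Pi>\<^sub>M i\<in>D - A. lborel))"

definition gnb_density ::
  "nat set \<Rightarrow> ((nat \<Rightarrow> real) \<Rightarrow> 'y \<Rightarrow> real) \<Rightarrow> nat set set \<Rightarrow> (nat \<Rightarrow> real) \<Rightarrow> 'y \<Rightarrow> real" where
  "gnb_density D p E x y =
     (\<Prod>C\<in>clusters E. marginal_density D p (C - {0}) x y) /
     (\<Prod>S\<in>separators E. marginal_density D p (S - {0}) x y ^ (multiplicity_sep E S - 1))"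

text \<open>An extended-real Lebesgue integral is used because the divergence may be infinite (the
  Bochner integral would then be \<open>0\<close>). The conventions \<open>ln 0 = 0\<close> and \<open>a / 0 = 0\<close> only matter
  on a null set: almost everywhere, all marginals are positive where \<open>p\<close> is.\<close>

definition extended_integral :: "'b measure \<Rightarrow> ('b \<Rightarrow> real) \<Rightarrow> ereal" where
  "extended_integral N f =
     enn2ereal (\<integral>\<^sup>+x. ennreal (f x) \<partial>N) - enn2ereal (\<integral>\<^sup>+x. ennreal (- f x) \<partial>N)"

definition KL_gnb ::
  "nat set \<Rightarrow> 'y set \<Rightarrow> ((nat \<Rightarrow> real) \<Rightarrow> 'y \<Rightarrow> real) \<Rightarrow> nat set set \<Rightarrow> ereal" where
  "KL_gnb D \<Y> p E =
     (\<Sum>y\<in>\<Y>. extended_integral (\<Pi>\<^sub>M i\<in>D. lborel)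
                 (\<lambda>x. p x y * ln (p x y / gnb_density D p E x y)))"


section \<open>Conditioning on the class\<close>

definition class_prob :: "'a measure \<Rightarrow> ('a \<Rightarrow> 'y) \<Rightarrow> 'y \<Rightarrow> real" where
  "class_prob M Y y = measure M (Y -` {y} \<inter> space M)"

definition given_class :: "'a measure \<Rightarrow> ('a \<Rightarrow> 'y) \<Rightarrow> 'y \<Rightarrow> 'a measure" where
  "given_class M Y y = uniform_measure M (Y -` {y} \<inter> space M)"


section \<open>Gaussian vectors and correlation\<close>

definition has_normal_law :: "'a measure \<Rightarrow> ('a \<Rightarrow> real) \<Rightarrow> real \<Rightarrow> real \<Rightarrow> bool" where
  "has_normal_law M Z m v \<longleftrightarrow>
     0 \<le> v \<and> Z \<in> borel_measurable M \<and>
     distr M borel Z = (if v = 0 then return borel m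
                        else density lborel (\<lambda>x. ennreal (normal_density m (sqrt v) x)))"

text \<open>\<open>(Z\<^sub>i)\<close>, \<open>i \<in> I\<close>, is jointly Gaussian with mean vector \<open>\<mu>\<close> and covariance matrix \<open>\<Sigma>\<close>
  if every linear combination is (possibly degenerate) normal with the corresponding mean and
  variance. If the vector has a Lebesgue density, then \<open>\<Sigma>\<close> is automatically nonsingular.\<close>

definition gaussian_vector ::
  "'a measure \<Rightarrow> nat set \<Rightarrow> (nat \<Rightarrow> 'a \<Rightarrow> real) \<Rightarrow> (nat \<Rightarrow> real) \<Rightarrow> (nat \<Rightarrow> nat \<Rightarrow> real) \<Rightarrow> bool" where
  "gaussian_vector M I Z \<mu> \<Sigma> \<longleftrightarrow>
     (\<forall>i\<in>I. \<forall>j\<in>I. \<Sigma> i j = \<Sigma> j i) \<and>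
     (\<forall>a. has_normal_law M (\<lambda>\<omega>. \<Sum>i\<in>I. a i * Z i \<omega>)
            (\<Sum>i\<in>I. a i * \<mu> i) (\<Sum>i\<in>I. \<Sum>j\<in>I. a i * a j * \<Sigma> i j))"

definition correlation :: "'a measure \<Rightarrow> ('a \<Rightarrow> real) \<Rightarrow> ('a \<Rightarrow> real) \<Rightarrow> real" where
  "correlation M A B =
     (\<integral>\<omega>. (A \<omega> - integral\<^sup>L M A) * (B \<omega> - integral\<^sup>L M B) \<partial>M) /
     (sqrt (\<integral>\<omega>. (A \<omega> - integral\<^sup>L M A)\<^sup>2 \<partial>M) * sqrt (\<integral>\<omega>. (B \<omega> - integral\<^sup>L M B)\<^sup>2 \<partial>M))"


section \<open>Copulas\<close>

definition prob_transform :: "'a measure \<Rightarrow> ('a \<Rightarrow> real) \<Rightarrow> 'a \<Rightarrow> real" where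
  "prob_transform M Z \<omega> = cdf (distr M borel Z) (Z \<omega>)"

text \<open>The copula of \<open>(Z\<^sub>i)\<close>, \<open>i \<in> I\<close>, i.e. the joint c.d.f. of the transforms, equals the Gauss
  copula \<open>C\<^sub>R(u) = \<Phi>\<^sub>R(\<Phi>\<^sup>-\<^sup>1(u\<^sub>1), \<Phi>\<^sup>-\<^sup>1(u\<^sub>2), \<dots>)\<close> with correlation matrix \<open>R\<close>, where \<open>\<Phi>\<^sub>R\<close> is the
  c.d.f. of the centred Gaussian law \<open>N\<close> on \<open>\<real>\<^sup>I\<close> with covariance matrix \<open>R\<close>.\<close>

definition has_gauss_copula ::
  "'a measure \<Rightarrow> nat set \<Rightarrow> (nat \<Rightarrow> 'a \<Rightarrow> real) \<Rightarrow> (nat \<Rightarrow> nat \<Rightarrow> real) \<Rightarrow> bool" where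
  "has_gauss_copula M I Z R \<longleftrightarrow>
     (\<forall>i\<in>I. R i i = 1) \<and>
     (\<exists>N. prob_space N \<and> sets N = sets (\<Pi>\<^sub>M i\<in>I. borel) \<and>
          gaussian_vector N I (\<lambda>i z. z i) (\<lambda>_. 0) R \<and>
          (\<forall>u. (\<forall>i\<in>I. 0 < u i \<and> u i < 1) \<longrightarrow>
             measure M {\<omega> \<in> space M. \<forall>i\<in>I. prob_transform M (Z i) \<omega> \<le> u i} =
             measure N {z \<in> space N. \<forall>i\<in>I. z i \<le> inv (cdf std_normal_distribution) (u i)}))"

definition has_pair_gauss_copula ::
  "'a measure \<Rightarrow> (nat \<Rightarrow> 'a \<Rightarrow> real) \<Rightarrow> nat \<Rightarrow> nat \<Rightarrow> real \<Rightarrow> bool" where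
  "has_pair_gauss_copula M Z l m \<rho> \<longleftrightarrow>
     has_gauss_copula M {l, m} Z (\<lambda>i j. if i = j then 1 else \<rho>)"

definition copula_information :: "'a measure \<Rightarrow> ('a \<Rightarrow> real) \<Rightarrow> ('a \<Rightarrow> real) \<Rightarrow> real" where
  "copula_information M A B =
     (let U = prob_transform M A; V = prob_transform M B in
        prob_space.entropy M (exp 1) lborel U + prob_space.entropy M (exp 1) lborel V
        - prob_space.entropy M (exp 1) (lborel \<Otimes>\<^sub>M lborel) (\<lambda>\<omega>. (U \<omega>, V \<omega>)))"

text \<open>\<open>c\<close> is the copula density of \<open>(A, B)\<close>, and its differential entropy is finite. Without
  finiteness, \<open>copula_information\<close> would not be a real number.\<close>

definition copula_density_finite_entropy ::
  "'a measure \<Rightarrow> ('a \<Rightarrow> real) \<Rightarrow> ('a \<Rightarrow> real) \<Rightarrow> (real \<times> real \<Rightarrow> real) \<Rightarrow> bool" where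
  "copula_density_finite_entropy M A B c \<longleftrightarrow>
     information_space.finite_entropy M (exp 1) (lborel \<Otimes>\<^sub>M lborel)
       (\<lambda>\<omega>. (prob_transform M A \<omega>, prob_transform M B \<omega>)) c"


section \<open>Edge weights\<close>

text \<open>For a Gaussian pair (and for a Gauss copula) the mutual information is
  \<open>- (1/2) ln (1 - \<rho>\<^sup>2)\<close>. The two sums below are therefore nonpositive and decrease as the
  dependence grows, so that it is their negatives that have to be maximised.\<close>

definition gaussian_log_sum ::
  "'a measure \<Rightarrow> (nat \<Rightarrow> 'a \<Rightarrow> real) \<Rightarrow> ('a \<Rightarrow> 'y) \<Rightarrow> 'y set \<Rightarrow> nat \<Rightarrow> nat \<Rightarrow> real" where
  "gaussian_log_sum M X Y \<Y> l m =
     (\<Sum>y\<in>\<Y>. class_prob M Y y * ln (1 - (correlation (given_class M Y y) (X l) (X m))\<^sup>2))"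

definition gauss_copula_log_sum ::
  "'a measure \<Rightarrow> ('a \<Rightarrow> 'y) \<Rightarrow> 'y set \<Rightarrow> ('y \<Rightarrow> nat \<Rightarrow> nat \<Rightarrow> real) \<Rightarrow> nat \<Rightarrow> nat \<Rightarrow> real" where
  "gauss_copula_log_sum M Y \<Y> \<rho>G l m =
     (\<Sum>y\<in>\<Y>. class_prob M Y y * ln (1 - (\<rho>G y l m)\<^sup>2))"

definition copula_weight ::
  "'a measure \<Rightarrow> (nat \<Rightarrow> 'a \<Rightarrow> real) \<Rightarrow> ('a \<Rightarrow> 'y) \<Rightarrow> 'y set \<Rightarrow> nat \<Rightarrow> nat \<Rightarrow> real" where
  "copula_weight M X Y \<Y> l m =
     (\<Sum>y\<in>\<Y>. class_prob M Y y * copula_information (given_class M Y y) (X l) (X m))"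

end

theory Submission
  imports Defs
begin

text \<open>The trees on \<open>D\<close> are exactly the GNB structures, and for the tree \<open>T\<close> the GNB density is
  \<open>\<Prod>\<^sub>s p\<^sub>s\<close> times the product over the edges \<open>lm\<close> of \<open>p\<^sub>l\<^sub>m / (p\<^sub>l p\<^sub>m)\<close>. Hence the divergence of
  \<open>T\<close> is a (possibly infinite) constant independent of \<open>T\<close> minus the sum over the edges of the
  class-averaged mutual information of the two endpoints, which is finite under each assumption.
  Mutual information is invariant under almost surely injective maps of each coordinate: applied to the
  distribution functions, this equates it with the information content of the copula, and for a Gauss
  copula with that of a standard Gaussian pair, which is \<open>- (1/2) ln (1 - \<rho>\<^sup>2)\<close>. So all three weights
  are positive multiples of the mutual information. Prim and Kruskal are handled by the cut
  exchange argument: every state of a run extends to a maximum spanning tree.\<close>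

text \<open>Everything probabilistic passes through the predicate
  \<open>has_mutual_info \<mu> r\<close>: the law \<mu> on the plane has a density h with respect to
  the product of its own marginals, and ln h has the finite \<mu>-expectation r. No reference
  measure occurs in it, so it moves freely between the data, the unit square of the copula and a
  Gaussian model living on another probability space. Finiteness of r is what permits splitting it
  off: the rest of the divergence, a combination of joint and marginal logarithms, need not be
  integrable, so it is kept as one extended integral common to all trees and is never computed. For
  a fixed class the function p(., y) has mass Z = P(Y = y) rather than 1; each edge then leaves a
  term ln Z, and these add up to the same constant for all trees because every spanning tree has
  card D - 1 edges. Finally, correlation 1 or -1 would put ln 0 into the Gaussian formula; it is
  excluded because X has a Lebesgue density, so that no coordinate is a function of another.\<close>

lemma finite_has_maximizer:
  fixes f :: "'b \<Rightarrow> 'c::linorder"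
  assumes "finite S" "S \<noteq> {}"
  obtains x where "x \<in> S" "\<And>y. y \<in> S \<Longrightarrow> f y \<le> f x"
proof -
  have "Max (f ` S) \<in> f ` S" using assms by simp
  then obtain x where x: "x \<in> S" "Max (f ` S) = f x" by blast
  then have "f y \<le> f x" if "y \<in> S" for y
    using that assms Max_ge[of "f ` S" "f y"] by simp
  with x(1) show thesis using that by blast
qed


section \<open>Graphs\<close>

definition reach :: "nat set set \<Rightarrow> nat \<Rightarrow> nat \<Rightarrow> bool" where
  "reach E u v \<longleftrightarrow> (u, v) \<in> {(a, b). {a, b} \<in> E}\<^sup>*"

lemma reach_refl [simp]: "reach E u u"
  by (simp add: reach_def)

lemma reach_edge: "{u, v} \<in> E \<Longrightarrow> reach E u v"
  by (auto simp: reach_def)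

lemma reach_trans: "reach E u v \<Longrightarrow> reach E v w \<Longrightarrow> reach E u w"
  unfolding reach_def by (rule rtrancl_trans)

lemma reach_sym: "reach E u v \<Longrightarrow> reach E v u"
proof -
  have "sym ({(a, b). {a, b} \<in> E}\<^sup>*)"
    by (intro sym_rtrancl) (auto simp: sym_def insert_commute)
  then show "reach E u v \<Longrightarrow> reach E v u"
    by (auto simp: reach_def sym_def)
qed

lemma reach_mono: "reach E u v \<Longrightarrow> E \<subseteq> F \<Longrightarrow> reach F u v"
  unfolding reach_def by (erule rtrancl_mono[THEN subsetD, rotated]) auto

lemma reach_induct [consumes 1, case_names refl step]:
  assumes "reach E u v" "P u" "\<And>y z. reach E u y \<Longrightarrow> {y, z} \<in> E \<Longrightarrow> P y \<Longrightarrow> P z"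
  shows "P v"
  using assms(1) unfolding reach_def
  by (induction rule: rtrancl_induct) (use assms(2,3) in \<open>auto simp: reach_def\<close>)

lemma connected_graph_reach: "connected_graph D E \<longleftrightarrow> (\<forall>u\<in>D. \<forall>v\<in>D. reach E u v)"
  by (simp add: connected_graph_def reach_def)

lemma connected_graphI:
  assumes "\<And>a. a \<in> D \<Longrightarrow> reach E u a"
  shows "connected_graph D E"
  unfolding connected_graph_reach using reach_trans[OF reach_sym] assms by blast

text \<open>A walk needs the new edge at most once. The disjunction is the invariant along the walk:
  crossing the new edge a second time leads back to a vertex already reachable from u inside
  \<open>F\<close>.\<close>

lemma reach_insertD:
  assumes "reach (insert {a, b} F) u v"
  shows "reach F u v \<or> (reach F u a \<and> reach F b v) \<or> (reach F u b \<and> reach F a v)"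
  using assms
proof (induction rule: reach_induct)
  case (step y z)
  then consider "{y, z} \<in> F" | "y = a" "z = b" | "y = b" "z = a"
    by (auto simp: doubleton_eq_iff)
  then show ?case
  proof cases
    case 1
    then show ?thesis using step.IH reach_trans[OF _ reach_edge] by blast
  next
    case 2
    then show ?thesis using step.IH reach_refl by blast
  next
    case 3
    then show ?thesis using step.IH reach_refl by blast
  qed
qed auto

lemma reach_closed:
  assumes "reach F u v" "u \<in> V" "\<And>a b. {a, b} \<in> F \<Longrightarrow> a \<in> V \<Longrightarrow> b \<in> V"
  shows "v \<in> V"
  using assms(1) by (induction rule: reach_induct) (use assms in auto)

lemma reach_distinct_path:
  assumes "reach E u v"
  shows "\<exists>vs. vs \<noteq> [] \<and> hd vs = u \<and> last vs = v \<and> distinct vs \<and>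
    (\<forall>i. Suc i < length vs \<longrightarrow> {vs ! i, vs ! Suc i} \<in> E)"
  using assms
proof (induction rule: reach_induct)
  case refl
  show ?case by (intro exI[of _ "[u]"]) auto
next
  case (step y z)
  then obtain vs where vs: "vs \<noteq> []" "hd vs = u" "last vs = y" "distinct vs"
    "\<forall>i. Suc i < length vs \<longrightarrow> {vs ! i, vs ! Suc i} \<in> E" by blast
  show ?case
  proof (cases "z \<in> set vs")
    \<comment> \<open>If z already lies on the path, the part of the path up to z is the required
      one; this keeps the vertices distinct.\<close>
    case True
    then obtain k where k: "k < length vs" "vs ! k = z" by (auto simp: in_set_conv_nth)
    have "take (Suc k) vs = take k vs @ [z]" using k by (simp add: take_Suc_conv_app_nth)
    then have "last (take (Suc k) vs) = z" by simp
    then show ?thesis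
      using vs by (intro exI[of _ "take (Suc k) vs"]) (auto simp: hd_take)
  next
    case False
    have "{(vs @ [z]) ! i, (vs @ [z]) ! Suc i} \<in> E" if "Suc i < length (vs @ [z])" for i
    proof (cases "Suc i < length vs")
      case True
      then show ?thesis using vs(5) by (auto simp: nth_append)
    next
      case False
      then have i: "i = length vs - 1" "Suc i = length vs" using that by auto
      then have "(vs @ [z]) ! i = y" "(vs @ [z]) ! Suc i = z"
        using vs(1,3) by (auto simp: nth_append last_conv_nth)
      then show ?thesis using step.hyps by simp
    qed
    then show ?thesis
      using vs False by (intro exI[of _ "vs @ [z]"]) (auto simp: hd_append)
  qed
qed

lemma acyclic_graph_subset: "acyclic_graph E \<Longrightarrow> F \<subseteq> E \<Longrightarrow> acyclic_graph F"
  unfolding acyclic_graph_def by blast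

text \<open>A detour around the edge would contain a simple path which the edge closes to a cycle.
  The path has at least three vertices: one vertex would mean \<open>u = v\<close>, and two would
  mean that the path is the deleted edge itself.\<close>

lemma acyclic_edge_is_bridge:
  assumes E: "acyclic_graph E" and uv: "{u, v} \<in> E" "u \<noteq> v"
  shows "\<not> reach (E - {{u, v}}) u v"
proof
  assume "reach (E - {{u, v}}) u v"
  from reach_distinct_path[OF this] obtain vs where vs: "vs \<noteq> []" "hd vs = u" "last vs = v"
    "distinct vs" "\<forall>i. Suc i < length vs \<longrightarrow> {vs ! i, vs ! Suc i} \<in> E - {{u, v}}" by blast
  have ends: "vs ! 0 = u" "vs ! (length vs - 1) = v"
    using vs by (auto simp: hd_conv_nth last_conv_nth)
  have "length vs \<noteq> 1" using ends uv(2) by auto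
  moreover have "length vs \<noteq> 2"
  proof
    assume "length vs = 2"
    then show False using vs(5)[rule_format, of 0] ends by simp
  qed
  moreover have "length vs \<noteq> 0" using vs(1) by simp
  ultimately have len: "3 \<le> length vs" by linarith
  have "{vs ! i, vs ! (Suc i mod length vs)} \<in> E" if "i < length vs" for i
  proof (cases "Suc i < length vs")
    case True
    then show ?thesis using vs(5) by auto
  next
    case False
    then have "i = length vs - 1" "Suc i = length vs" using that by auto
    then show ?thesis using ends uv(1) by (simp add: insert_commute)
  qed
  with vs(4) len show False using E unfolding acyclic_graph_def by blast
qed

text \<open>The converse of \<open>acyclic_edge_is_bridge\<close>: on a cycle, the edge joining the
  last vertex to the first is bypassed by the remaining edges. Together they say that acyclic means
  that every edge is a bridge, so that acyclicity can be handled through reachability alone.\<close>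

lemma acyclicI_bridges:
  assumes "\<And>u v. {u, v} \<in> E \<Longrightarrow> u \<noteq> v \<Longrightarrow> \<not> reach (E - {{u, v}}) u v"
  shows "acyclic_graph E"
  unfolding acyclic_graph_def
proof
  assume "\<exists>vs. 3 \<le> length vs \<and> distinct vs \<and> (\<forall>i<length vs. {vs ! i, vs ! (Suc i mod length vs)} \<in> E)"
  then obtain vs where vs: "3 \<le> length vs" "distinct vs"
    "\<forall>i<length vs. {vs ! i, vs ! (Suc i mod length vs)} \<in> E" by blast
  define n where "n = length vs"
  let ?u = "vs ! 0" and ?v = "vs ! (n - 1)"
  have n: "3 \<le> n" using vs n_def by simp
  have "Suc (n - 1) mod n = 0" using n by simp
  then have e: "{?v, ?u} \<in> E" using vs(3)[rule_format, of "n - 1"] n by (simp add: n_def)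
  have inj: "vs ! i = vs ! j \<longleftrightarrow> i = j" if "i < n" "j < n" for i j
    using nth_eq_iff_index_eq[OF vs(2)] that by (simp add: n_def)
  have ne: "?u \<noteq> ?v" using inj[of 0 "n - 1"] n by linarith
  have "reach (E - {{?u, ?v}}) ?u (vs ! i)" if "i < n" for i
    using that
  proof (induction i)
    case (Suc i)
    have "{vs ! i, vs ! Suc i} \<in> E"
      using vs(3)[rule_format, of i] Suc.prems by (simp add: n_def)
    moreover have "{vs ! i, vs ! Suc i} \<noteq> {?u, ?v}"
    proof
      assume "{vs ! i, vs ! Suc i} = {?u, ?v}"
      then consider "vs ! i = ?u" "vs ! Suc i = ?v" | "vs ! Suc i = ?u"
        unfolding doubleton_eq_iff by blast
      then show False
      proof cases
        \<comment> \<open>The two neighbours would also be the two ends of the cycle, which forces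
          \<open>n = 2\<close>.\<close>
        case 1
        have "i = 0" using 1(1) inj[of i 0] Suc.prems by simp
        moreover have "Suc i = n - 1" using 1(2) inj[of "Suc i" "n - 1"] Suc.prems n by simp
        ultimately show False using n by simp
      next
        case 2
        then show False using inj[of "Suc i" 0] Suc.prems by simp
      qed
    qed
    ultimately have "reach (E - {{?u, ?v}}) (vs ! i) (vs ! Suc i)" by (intro reach_edge) auto
    then show ?case using Suc.IH Suc.prems reach_trans Suc_lessD by blast
  qed simp
  from this[of "n - 1"] have "reach (E - {{?u, ?v}}) ?u ?v" using n by simp
  with assms[of ?u ?v] e ne show False by (simp add: insert_commute)
qed

text \<open>Every edge remains a bridge. A detour around an old edge {a, b} would have to run
  through the new edge; its two halves together with {a, b} would then join u and v inside
  \<open>F\<close>.\<close>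

lemma acyclic_insert:
  assumes F: "acyclic_graph F" and uv: "\<not> reach F u v"
  shows "acyclic_graph (insert {u, v} F)"
proof (rule acyclicI_bridges)
  fix a b assume ab: "{a, b} \<in> insert {u, v} F" "a \<noteq> b"
  show "\<not> reach (insert {u, v} F - {{a, b}}) a b"
  proof (cases "{a, b} = {u, v}")
    case True
    then have "insert {u, v} F - {{a, b}} \<subseteq> F" by auto
    then show ?thesis using uv reach_mono reach_sym True by (metis doubleton_eq_iff)
  next
    case False
    then have abF: "{a, b} \<in> F" and eq: "insert {u, v} F - {{a, b}} = insert {u, v} (F - {{a, b}})"
      using ab by auto
    show ?thesis
    proof
      assume "reach (insert {u, v} F - {{a, b}}) a b"
      from reach_insertD[OF this[unfolded eq]] acyclic_edge_is_bridge[OF F abF ab(2)]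
      have "(reach F a u \<and> reach F v b) \<or> (reach F a v \<and> reach F u b)"
        using reach_mono[of "F - {{a, b}}" _ _ F] by blast
      moreover have "reach F a b" using abF by (rule reach_edge)
      ultimately have "reach F u v" using reach_trans reach_sym by meson
      with uv show False ..
    qed
  qed
qed

lemma acyclic_insert_iff:
  assumes "acyclic_graph F" "u \<noteq> v" "{u, v} \<notin> F"
  shows "acyclic_graph (insert {u, v} F) \<longleftrightarrow> \<not> reach F u v"
  using acyclic_insert[OF assms(1), of u v] acyclic_edge_is_bridge[of "insert {u, v} F" u v] assms
  by auto

section \<open>Spanning trees of the complete graph and the exchange argument\<close>

lemma complete_edges_iff: "{u, v} \<in> complete_edges D \<longleftrightarrow> u \<in> D \<and> v \<in> D \<and> u \<noteq> v"
  by (auto simp: complete_edges_def doubleton_eq_iff)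

lemma complete_edgesE:
  assumes "e \<in> complete_edges D"
  obtains u v where "e = {u, v}" "u \<in> D" "v \<in> D" "u \<noteq> v"
  using assms by (auto simp: complete_edges_def)

lemma complete_edges_mono: "I \<subseteq> D \<Longrightarrow> complete_edges I \<subseteq> complete_edges D"
  by (auto simp: complete_edges_def)

lemma finite_complete_edges: "finite D \<Longrightarrow> finite (complete_edges D)"
  by (rule finite_subset[of _ "Pow D"]) (auto simp: complete_edges_def)

text \<open>An edge of \<open>T\<close> outside \<open>F\<close> would be bypassed inside
  \<open>F\<close>, so it could not be a bridge of \<open>T\<close>. This is how a finished run of
  Prim's algorithm, and later a fully grown GNB structure, is identified with the whole
  tree.\<close>

lemma connected_subset_of_acyclic_eq:
  assumes T: "acyclic_graph T" "T \<subseteq> complete_edges D" and F: "F \<subseteq> T" "connected_graph D F"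
  shows "F = T"
proof (rule ccontr)
  assume "F \<noteq> T"
  then obtain e where e: "e \<in> T" "e \<notin> F" using F by auto
  then obtain u v where uv: "e = {u, v}" "u \<in> D" "v \<in> D" "u \<noteq> v"
    using T complete_edgesE by blast
  have "reach F u v" using F(2) uv by (simp add: connected_graph_reach)
  then have "reach (T - {{u, v}}) u v" using F(1) e uv by (auto elim: reach_mono)
  then show False using acyclic_edge_is_bridge[OF T(1), of u v] e uv by blast
qed

text \<open>An acyclic edge set of maximal cardinality is connected: between two unconnected
  vertices another edge could be added by \<open>acyclic_insert\<close>.\<close>

lemma spanning_tree_exists:
  assumes "finite D"
  shows "\<exists>T. spanning_tree D T"
proof -
  let ?S = "{F. F \<subseteq> complete_edges D \<and> acyclic_graph F}"
  have fin: "finite ?S" using finite_complete_edges[OF assms] by simp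
  have "acyclic_graph {}" by (rule acyclicI_bridges) auto
  then have "?S \<noteq> {}" by blast
  then obtain F where F: "F \<in> ?S" and max: "\<And>G. G \<in> ?S \<Longrightarrow> card G \<le> card F"
    using finite_has_maximizer[OF fin, of card] by blast
  have finF: "finite F" using F finite_complete_edges[OF assms] finite_subset by blast
  have "reach F u v" if "u \<in> D" "v \<in> D" for u v
  proof (rule ccontr)
    assume nr: "\<not> reach F u v"
    then have "insert {u, v} F \<in> ?S"
      using F acyclic_insert[of F u v] that by (auto simp: complete_edges_iff)
    moreover have "{u, v} \<notin> F" using nr reach_edge by blast
    ultimately show False using max[of "insert {u, v} F"] finF by simp
  qed
  then show ?thesis using F by (auto simp: spanning_tree_def connected_graph_reach)
qed

lemma maximum_spanning_tree_exists:
  assumes "finite D"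
  shows "\<exists>T. maximum_spanning_tree D w T"
proof -
  let ?S = "{T. spanning_tree D T}"
  have fin: "finite ?S"
    by (rule finite_subset[of _ "Pow (complete_edges D)"])
       (auto simp: spanning_tree_def finite_complete_edges[OF assms])
  have "?S \<noteq> {}" using spanning_tree_exists[OF assms] by blast
  then obtain T where "T \<in> ?S"
    "\<And>T'. T' \<in> ?S \<Longrightarrow> (\<Sum>e\<in>T'. edge_weight w e) \<le> (\<Sum>e\<in>T. edge_weight w e)"
    using finite_has_maximizer[OF fin, of "\<lambda>T. \<Sum>e\<in>T. edge_weight w e"] by blast
  then show ?thesis by (auto simp: maximum_spanning_tree_def)
qed

text \<open>When the edges of \<open>S\<close> are added one by one, at some edge f the vertices u
  and v become connected; \<open>S'\<close> consists of edges added before it. This takes the place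
  of choosing an edge on a path.\<close>

lemma critical_edge:
  assumes "finite S" "\<not> reach F u v" "reach (F \<union> S) u v"
  shows "\<exists>f\<in>S. \<exists>S'\<subseteq>S - {f}. \<not> reach (F \<union> S') u v \<and> reach (insert f (F \<union> S')) u v"
  using assms(1,3)
proof (induction S rule: finite_induct)
  case empty
  then show ?case using assms(2) by simp
next
  case (insert f S)
  show ?case
  proof (cases "reach (F \<union> S) u v")
    case True
    from insert.IH[OF this] obtain g S' where g: "g \<in> S" "S' \<subseteq> S - {g}"
      "\<not> reach (F \<union> S') u v" "reach (insert g (F \<union> S')) u v" by blast
    then have "S' \<subseteq> insert f S - {g}" by auto
    then show ?thesis using g by blast
  next
    case False
    have "reach (insert f (F \<union> S)) u v" using insert.prems by simp
    moreover have "S \<subseteq> insert f S - {f}" using insert.hyps by auto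
    ultimately show ?thesis using False by blast
  qed
qed

text \<open>With all edges leaving \<open>V\<close> removed, v is unreachable from u, so one of them
  is critical in the sense of \<open>critical_edge\<close>. The two alternatives are the two
  directions in which the connection may traverse that edge: out of \<open>V\<close>, or back into
  it after an earlier departure.\<close>

lemma tree_crossing_edge:
  assumes T: "finite T" and r: "reach T u v" and V: "u \<in> V" "v \<notin> V"
  obtains a b where "{a, b} \<in> T" "a \<in> V" "b \<notin> V" "a \<noteq> b"
    "reach (T - {{a, b}}) u a \<and> reach (T - {{a, b}}) b v \<or>
     reach (T - {{a, b}}) u b \<and> reach (T - {{a, b}}) a v"
proof -
  let ?S = "{e \<in> T. \<exists>a b. e = {a, b} \<and> a \<in> V \<and> b \<notin> V}"
  have nr: "\<not> reach (T - ?S) u v"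
  proof
    assume "reach (T - ?S) u v"
    then have "v \<in> V" using V(1) by (rule reach_closed) blast
    with V show False by simp
  qed
  have "reach ((T - ?S) \<union> ?S) u v" using r by (rule reach_mono) auto
  from critical_edge[OF _ nr this] T obtain f S' where f: "f \<in> ?S" "S' \<subseteq> ?S - {f}"
    "\<not> reach ((T - ?S) \<union> S') u v" "reach (insert f ((T - ?S) \<union> S')) u v" by auto
  obtain a b where ab: "f = {a, b}" "a \<in> V" "b \<notin> V" using f by blast
  have sub: "(T - ?S) \<union> S' \<subseteq> T - {{a, b}}" using f ab by auto
  from reach_insertD[OF f(4)[unfolded ab(1)]] f(3)
  have "reach (T - {{a, b}}) u a \<and> reach (T - {{a, b}}) b v \<or>
     reach (T - {{a, b}}) u b \<and> reach (T - {{a, b}}) a v"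
    using reach_mono[OF _ sub] by blast
  then show thesis using that[of a b] ab f by auto
qed

text \<open>The cut property behind both algorithms: \<open>V\<close> separates u from v and is
  crossed by no edge of \<open>F\<close>, so a tree edge {a, b} crossing the cut can be traded for
  {u, v} without losing \<open>F\<close> or weight. Prim takes for \<open>V\<close> the vertices
  reached so far, Kruskal the component of u in \<open>F\<close>.\<close>

lemma maximum_spanning_tree_exchange:
  assumes D: "finite D" and T: "maximum_spanning_tree D w T" and F: "F \<subseteq> T"
    and V: "u \<in> V" "v \<in> D - V" "u \<in> D"
    and no_cross: "\<And>a b. {a, b} \<in> F \<Longrightarrow> a \<in> V \<Longrightarrow> b \<in> V"
    and heaviest: "\<And>a b. {a, b} \<in> T - F \<Longrightarrow> a \<in> V \<Longrightarrow> b \<notin> V \<Longrightarrow>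
      edge_weight w {a, b} \<le> edge_weight w {u, v}"
  shows "\<exists>T'. maximum_spanning_tree D w T' \<and> insert {u, v} F \<subseteq> T'"
proof (cases "{u, v} \<in> T")
  case True
  then show ?thesis using T F by blast
next
  case False
  from T have sT: "T \<subseteq> complete_edges D" "connected_graph D T" "acyclic_graph T"
    and maxT: "\<And>T'. spanning_tree D T' \<Longrightarrow> (\<Sum>e\<in>T'. edge_weight w e) \<le> (\<Sum>e\<in>T. edge_weight w e)"
    by (auto simp: maximum_spanning_tree_def spanning_tree_def)
  have finT: "finite T" using sT(1) finite_complete_edges[OF D] finite_subset by blast
  have "reach T u v" using sT(2) V by (simp add: connected_graph_reach)
  then obtain a b where ab: "{a, b} \<in> T" "a \<in> V" "b \<notin> V" "a \<noteq> b" and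
    paths: "reach (T - {{a, b}}) u a \<and> reach (T - {{a, b}}) b v \<or>
     reach (T - {{a, b}}) u b \<and> reach (T - {{a, b}}) a v"
    using tree_crossing_edge[OF finT, of u v V] V by blast
  define T' where "T' = insert {u, v} (T - {{a, b}})"
  have bridge: "\<not> reach (T - {{a, b}}) a b"
    using acyclic_edge_is_bridge[OF sT(3) ab(1,4)] .
  \<comment> \<open>Otherwise the two pieces in \<open>paths\<close> would link a and b without the
    edge {a, b}, which is a bridge.\<close>
  have "\<not> reach (T - {{a, b}}) u v"
    using paths bridge reach_sym reach_trans by meson
  then have "acyclic_graph T'"
    unfolding T'_def by (intro acyclic_insert acyclic_graph_subset[OF sT(3)]) auto
  moreover have "T' \<subseteq> complete_edges D"
    using sT(1) V by (auto simp: T'_def complete_edges_iff)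
  moreover have "connected_graph D T'"
    unfolding connected_graph_reach
  proof (intro ballI)
    have sub: "T - {{a, b}} \<subseteq> T'" by (auto simp: T'_def)
    \<comment> \<open>Where a walk in \<open>T\<close> uses the deleted edge, it is rerouted along
      \<open>paths\<close> and the new edge.\<close>
    have "reach T' u v" by (intro reach_edge) (simp add: T'_def)
    then have r: "reach T' a b"
      using paths reach_mono[OF _ sub] reach_sym reach_trans by meson
    fix x y assume "x \<in> D" "y \<in> D"
    then have "reach T x y" using sT(2) by (simp add: connected_graph_reach)
    then show "reach T' x y"
    proof (induction rule: reach_induct)
      case (step y z)
      have "reach T' y z"
      proof (cases "{y, z} = {a, b}")
        case True
        then show ?thesis using r reach_sym by (auto simp: doubleton_eq_iff)
      next
        case False
        then show ?thesis using step.hyps by (intro reach_edge) (auto simp: T'_def)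
      qed
      then show ?case using step.IH reach_trans by blast
    qed simp
  qed
  ultimately have st: "spanning_tree D T'" by (simp add: spanning_tree_def)
  have abF: "{a, b} \<notin> F" using no_cross ab by blast
  have "edge_weight w {a, b} \<le> edge_weight w {u, v}" using heaviest ab abF by blast
  then have "(\<Sum>e\<in>T. edge_weight w e) \<le> (\<Sum>e\<in>T'. edge_weight w e)"
    using finT False ab(1) by (simp add: T'_def sum.remove)
  then have "maximum_spanning_tree D w T'"
    using st maxT unfolding maximum_spanning_tree_def by (meson order_trans)
  moreover have "insert {u, v} F \<subseteq> T'" using F abF by (auto simp: T'_def)
  ultimately show ?thesis by blast
qed

subsection \<open>Prim's and Kruskal's algorithms\<close>

lemma kruskal_invariant:
  assumes D: "finite D" and run: "(kruskal_step D w)\<^sup>*\<^sup>* {} F"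
  shows "\<exists>T. maximum_spanning_tree D w T \<and> F \<subseteq> T"
  using run
proof (induction rule: rtranclp_induct)
  case base
  then show ?case using maximum_spanning_tree_exists[OF D] by blast
next
  case (step F F')
  then obtain T where T: "maximum_spanning_tree D w T" "F \<subseteq> T" by blast
  then have acT: "acyclic_graph T" "T \<subseteq> complete_edges D"
    by (auto simp: maximum_spanning_tree_def spanning_tree_def)
  have acF: "acyclic_graph F" using acT(1) T(2) by (rule acyclic_graph_subset)
  from step.hyps(2) obtain e where e: "F' = insert e F" "e \<in> complete_edges D - F"
    "acyclic_graph (insert e F)"
    "\<And>e'. e' \<in> complete_edges D - F \<Longrightarrow> acyclic_graph (insert e' F) \<Longrightarrow>
      edge_weight w e' \<le> edge_weight w e"
    by (auto simp: kruskal_step_def)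
  then obtain u v where uv: "e = {u, v}" "u \<in> D" "v \<in> D" "u \<noteq> v"
    by (auto elim: complete_edgesE)
  then have nr: "\<not> reach F u v" using acyclic_insert_iff[OF acF, of u v] e by auto
  show ?case
    unfolding e(1) uv(1)
  proof (rule maximum_spanning_tree_exchange[OF D T, where V = "{x. reach F u x}"])
    show "b \<in> {x. reach F u x}" if "{a, b} \<in> F" "a \<in> {x. reach F u x}" for a b
      using that reach_edge reach_trans by blast
    \<comment> \<open>An edge of \<open>T - F\<close> keeps \<open>F\<close> acyclic, since the
      result is still contained in \<open>T\<close>; it was therefore a candidate of the greedy
      choice.\<close>
    show "edge_weight w {a, b} \<le> edge_weight w {u, v}" if "{a, b} \<in> T - F" for a b
      using e(4)[of "{a, b}"] that acT acyclic_graph_subset[OF acT(1), of "insert {a, b} F"] T(2) uv(1)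
      by auto
  qed (use nr uv in auto)
qed

text \<open>The set \<open>?S\<close> of admissible edges is finite, so if it were nonempty, its
  heaviest element would give a further step. The edges of the optimal tree outside \<open>T\<close>
  are admissible; hence there are none.\<close>

lemma kruskal_output_maximum:
  assumes D: "finite D" and out: "kruskal_output D w T"
  shows "maximum_spanning_tree D w T"
proof -
  from out have run: "(kruskal_step D w)\<^sup>*\<^sup>* {} T" and final: "\<nexists>F. kruskal_step D w T F"
    by (auto simp: kruskal_output_def)
  obtain T' where T': "maximum_spanning_tree D w T'" "T \<subseteq> T'"
    using kruskal_invariant[OF D run] by blast
  then have ac: "acyclic_graph T'" "T' \<subseteq> complete_edges D"
    by (auto simp: maximum_spanning_tree_def spanning_tree_def)
  let ?S = "{e \<in> complete_edges D - T. acyclic_graph (insert e T)}"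
  have "?S = {}"
  proof (rule ccontr)
    assume ne: "?S \<noteq> {}"
    have fin: "finite ?S" using finite_complete_edges[OF D] by simp
    then obtain e where "e \<in> ?S" "\<And>e'. e' \<in> ?S \<Longrightarrow> edge_weight w e' \<le> edge_weight w e"
      using finite_has_maximizer[OF fin ne, of "edge_weight w"] by blast
    then have "kruskal_step D w T (insert e T)" by (auto simp: kruskal_step_def)
    with final show False by blast
  qed
  moreover have "T' - T \<subseteq> ?S" using ac T'(2) acyclic_graph_subset[OF ac(1)] by auto
  ultimately have "T = T'" using T'(2) by auto
  with T' show ?thesis by simp
qed

text \<open>Beyond containment in an optimal tree, the invariant records that \<open>F\<close> lives
  on \<open>V\<close>, so that no edge of \<open>F\<close> crosses the cut, and that
  \<open>F\<close> connects \<open>V\<close>; the latter identifies the final state with the optimal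
  tree.\<close>

lemma prim_invariant:
  assumes D: "finite D" "r \<in> D" and run: "(prim_step D w)\<^sup>*\<^sup>* ({r}, {}) (V, F)"
  shows "V \<subseteq> D \<and> r \<in> V \<and> F \<subseteq> complete_edges V \<and> (\<forall>v\<in>V. reach F r v) \<and>
    (\<exists>T. maximum_spanning_tree D w T \<and> F \<subseteq> T)"
  using run
proof (induction rule: rtranclp_induct2)
  case refl
  then show ?case using maximum_spanning_tree_exists[OF D(1)] D(2) by auto
next
  case (step V F V' F')
  then obtain T where T: "maximum_spanning_tree D w T" "F \<subseteq> T"
    and V: "V \<subseteq> D" "r \<in> V" "F \<subseteq> complete_edges V" "\<forall>v\<in>V. reach F r v" by blast
  have TD: "T \<subseteq> complete_edges D"
    using T(1) by (auto simp: maximum_spanning_tree_def spanning_tree_def)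
  from step.hyps(2) obtain u v where uv: "V' = insert v V" "F' = insert {u, v} F" "u \<in> V" "v \<in> D - V"
    "\<And>u' v'. u' \<in> V \<Longrightarrow> v' \<in> D - V \<Longrightarrow> edge_weight w {u', v'} \<le> edge_weight w {u, v}"
    by (auto simp: prim_step_def)
  have "\<exists>T'. maximum_spanning_tree D w T' \<and> insert {u, v} F \<subseteq> T'"
  proof (rule maximum_spanning_tree_exchange[OF D(1) T, where V = V])
    show "b \<in> V" if "{a, b} \<in> F" for a b
      using that V(3) complete_edges_iff by blast
    show "edge_weight w {a, b} \<le> edge_weight w {u, v}" if "{a, b} \<in> T - F" "a \<in> V" "b \<notin> V" for a b
      using that TD by (intro uv(5)) (auto simp: complete_edges_iff)
  qed (use uv V in auto)
  moreover have "reach F' r x" if "x \<in> V'" for x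
  proof -
    have *: "reach F' r x" if "x \<in> V" for x
      using V(4) that uv(2) by (auto elim: reach_mono)
    moreover have "reach F' u v" using uv(2) by (intro reach_edge) simp
    ultimately show ?thesis using that uv(1,3) reach_trans by blast
  qed
  moreover have "F' \<subseteq> complete_edges V'"
    using V(3) uv complete_edges_mono[of V V'] by (auto simp: complete_edges_iff)
  ultimately show ?case using V uv(1,2,4) by auto
qed

lemma prim_output_maximum:
  assumes D: "finite D" and out: "prim_output D w T"
  shows "maximum_spanning_tree D w T"
proof -
  from out obtain r V where r: "r \<in> D" and run: "(prim_step D w)\<^sup>*\<^sup>* ({r}, {}) (V, T)"
    and final: "\<nexists>s. prim_step D w (V, T) s"
    by (auto simp: prim_output_def)
  from prim_invariant[OF D r run] obtain T' where T': "maximum_spanning_tree D w T'" "T \<subseteq> T'"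
    and V: "V \<subseteq> D" "r \<in> V" "\<forall>v\<in>V. reach T r v" by blast
  have "V = D"
  proof (rule ccontr)
    assume "V \<noteq> D"
    let ?S = "V \<times> (D - V)" and ?f = "\<lambda>(u, v). edge_weight w {u, v}"
    have ne: "?S \<noteq> {}" using V \<open>V \<noteq> D\<close> by auto
    have fin: "finite ?S" using V D finite_subset by blast
    obtain s where s: "s \<in> ?S" "\<And>s'. s' \<in> ?S \<Longrightarrow> ?f s' \<le> ?f s"
      using finite_has_maximizer[OF fin ne, of ?f] by blast
    obtain u v where uv: "s = (u, v)" by fastforce
    have "prim_step D w (V, T) (insert v V, insert {u, v} T)"
      unfolding prim_step_def
      using s uv by (intro exI[of _ V] exI[of _ T] exI[of _ u] exI[of _ v]) fastforce
    with final show False by blast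
  qed
  then have "connected_graph D T"
    using V(3) by (intro connected_graphI[of _ _ r]) simp
  then have "T = T'"
    using T' by (intro connected_subset_of_acyclic_eq)
      (auto simp: maximum_spanning_tree_def spanning_tree_def)
  with T' show ?thesis by simp
qed

lemma normal_form_exists:
  fixes f :: "'b \<Rightarrow> nat"
  assumes "\<And>s s'. R\<^sup>*\<^sup>* s0 s \<Longrightarrow> R s s' \<Longrightarrow> f s' < f s"
  shows "\<exists>s. R\<^sup>*\<^sup>* s0 s \<and> (\<nexists>s'. R s s')"
proof -
  have "\<exists>s'. R\<^sup>*\<^sup>* s0 s' \<and> (\<nexists>s''. R s' s'')" if "R\<^sup>*\<^sup>* s0 s" for s
    using that
  proof (induction "f s" arbitrary: s rule: less_induct)
    case less
    show ?case
    proof (cases "\<exists>s'. R s s'")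
      case True
      then obtain s' where s': "R s s'" by blast
      then show ?thesis
        using less.hyps[OF assms[OF less.prems s']] less.prems rtranclp.rtrancl_into_rtrancl by metis
    qed (use less.prems in blast)
  qed
  then show ?thesis by blast
qed

lemma kruskal_output_exists:
  assumes D: "finite D"
  shows "\<exists>T. kruskal_output D w T"
  unfolding kruskal_output_def
proof (rule normal_form_exists)
  fix F F' assume "kruskal_step D w F F'"
  then obtain e where "F' = insert e F" "e \<in> complete_edges D - F"
    by (auto simp: kruskal_step_def)
  then have "complete_edges D - F' \<subset> complete_edges D - F" by auto
  then show "card (complete_edges D - F') < card (complete_edges D - F)"
    using finite_complete_edges[OF D] by (intro psubset_card_mono) auto
qed

lemma prim_output_exists:
  assumes D: "finite D" "D \<noteq> {}"
  shows "\<exists>T. prim_output D w T"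
proof -
  obtain r where r: "r \<in> D" using D by blast
  have "\<exists>s. (prim_step D w)\<^sup>*\<^sup>* ({r}, {}) s \<and> (\<nexists>s'. prim_step D w s s')"
  proof (rule normal_form_exists[where f = "\<lambda>s. card (D - fst s)"])
    fix s s' assume "prim_step D w s s'"
    then have "D - fst s' \<subset> D - fst s" by (auto simp: prim_step_def)
    then show "card (D - fst s') < card (D - fst s)"
      using D by (intro psubset_card_mono) auto
  qed
  then show ?thesis using r by (auto simp: prim_output_def)
qed

section \<open>GNB structures and spanning trees\<close>

text \<open>The new vertex v lies on no earlier tree edge, so the edge {u, v} cannot close a cycle:
  from u only vertices of \<open>I\<close> can be reached.\<close>

lemma gnb_partial_tree:
  assumes "gnb_partial D I E"
  shows "I \<subseteq> D \<and> (\<exists>T. E = T \<union> {{0, i} | i. i \<in> I} \<and> T \<subseteq> complete_edges I \<and>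
    connected_graph I T \<and> acyclic_graph T)"
  using assms
proof (induction rule: gnb_partial.induct)
  case (triangle i j)
  have "acyclic_graph {}" by (rule acyclicI_bridges) auto
  moreover have "\<not> reach {} i j"
  proof
    assume "reach {} i j"
    then have "j \<in> {i}" by (rule reach_closed) auto
    with triangle show False by simp
  qed
  ultimately have "acyclic_graph {{i, j}}" by (rule acyclic_insert)
  moreover have "connected_graph {i, j} {{i, j}}"
    unfolding connected_graph_reach using reach_edge[of i j "{{i, j}}"] reach_sym by auto
  moreover have "{{0, i}, {0, j}, {i, j}} = {{i, j}} \<union> {{0, k} | k. k \<in> {i, j}}" by auto
  moreover have "{{i, j}} \<subseteq> complete_edges {i, j}" using triangle by (simp add: complete_edges_iff)
  ultimately show ?case using triangle
    by (intro conjI exI[of _ "{{i, j}}"]) auto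
next
  case (add_vertex I E v u)
  then obtain T where T: "E = T \<union> {{0, i} | i. i \<in> I}" "T \<subseteq> complete_edges I"
    "connected_graph I T" "acyclic_graph T" by blast
  let ?T = "insert {u, v} T"
  have "\<not> reach T u v"
  proof
    assume r: "reach T u v"
    have "b \<in> I" if "{a, b} \<in> T" for a b
      using that T(2) complete_edges_iff by blast
    with reach_closed[OF r add_vertex.hyps(3)] have "v \<in> I" by blast
    with add_vertex.hyps(2) show False by simp
  qed
  then have "acyclic_graph ?T" using T(4) by (intro acyclic_insert)
  moreover have "?T \<subseteq> complete_edges (insert v I)"
    using T(2) complete_edges_mono[of I "insert v I"] add_vertex.hyps by (auto simp: complete_edges_iff)
  moreover have "connected_graph (insert v I) ?T"
  proof -
    have "reach ?T u a" if "a \<in> insert v I" for a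
    proof (cases "a = v")
      case True
      then show ?thesis using reach_edge[of u v ?T] by simp
    next
      case False
      then have "reach T u a" using T(3) add_vertex.hyps that by (simp add: connected_graph_reach)
      then show ?thesis by (rule reach_mono) auto
    qed
    then show ?thesis by (rule connected_graphI)
  qed
  moreover have "E \<union> {{0, v}, {u, v}} = ?T \<union> {{0, i} | i. i \<in> insert v I}"
    unfolding T(1) by auto
  ultimately show ?case using add_vertex.IH add_vertex.hyps(2)
    by (intro conjI exI[of _ ?T]) auto
qed

lemma gnb_structure_tree:
  assumes "gnb_structure D E"
  obtains T where "spanning_tree D T" "E = gnb_of_tree D T"
  using gnb_partial_tree[OF assms[unfolded gnb_structure_def]]
  unfolding spanning_tree_def gnb_of_tree_def by blast

text \<open>A spanning tree is consumed in an order that the inductive rules allow: as long as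
  \<open>I\<close> is not all of \<open>D\<close>, connectedness of \<open>T\<close> provides an
  edge leaving \<open>I\<close>. The induction starts at 2 because the smallest GNB structure is the
  triangle over one edge. The count \<open>Suc (card F) = k\<close> is carried along for the number
  of edges of a tree.\<close>

lemma tree_grows_gnb:
  assumes D: "finite D" and T: "spanning_tree D T" and k: "2 \<le> k" "k \<le> card D"
  shows "\<exists>I F. I \<subseteq> D \<and> card I = k \<and> F \<subseteq> T \<and> connected_graph I F \<and> Suc (card F) = k \<and>
    F \<subseteq> complete_edges I \<and> gnb_partial D I (F \<union> {{0, i} | i. i \<in> I})"
  using k
proof (induction k rule: dec_induct)
  case base
  from T have sT: "T \<subseteq> complete_edges D" "connected_graph D T" by (auto simp: spanning_tree_def)
  obtain a b where ab: "a \<in> D" "b \<in> D" "a \<noteq> b"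
    using base D by (metis card_le_Suc0_iff_eq not_less_eq_eq numeral_2_eq_2)
  then have "reach T a b" using sT by (simp add: connected_graph_reach)
  then have "T \<noteq> {}" using reach_closed[of "{}" a b "{a}"] ab by auto
  then obtain i j where ij: "{i, j} \<in> T" "i \<in> D" "j \<in> D" "i \<noteq> j"
    using sT complete_edgesE by (metis all_not_in_conv subsetD)
  have "{{0, i}, {0, j}, {i, j}} = {{i, j}} \<union> {{0, k} | k. k \<in> {i, j}}" by auto
  then have "gnb_partial D {i, j} ({{i, j}} \<union> {{0, k} | k. k \<in> {i, j}})"
    using gnb_partial.triangle[of i D j] ij by simp
  moreover have "connected_graph {i, j} {{i, j}}"
    unfolding connected_graph_reach using reach_edge[of i j "{{i, j}}"] reach_sym by auto
  moreover have "{{i, j}} \<subseteq> complete_edges {i, j}" using ij by (simp add: complete_edges_iff)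
  ultimately show ?case
    using ij by (intro exI[of _ "{i, j}"] exI[of _ "{{i, j}}"]) auto
next
  case (step k)
  then obtain I F where IF: "I \<subseteq> D" "card I = k" "F \<subseteq> T" "connected_graph I F" "Suc (card F) = k"
    "F \<subseteq> complete_edges I" "gnb_partial D I (F \<union> {{0, i} | i. i \<in> I})"
    using Suc_leD by blast
  from T have sT: "T \<subseteq> complete_edges D" "connected_graph D T" by (auto simp: spanning_tree_def)
  have finI: "finite I" using IF(1) D finite_subset by blast
  obtain r where r: "r \<in> I" using IF(2) step.hyps by fastforce
  have "I \<noteq> D" using IF(2) step.prems by auto
  then obtain t where t: "t \<in> D" "t \<notin> I" using IF(1) by auto
  have "reach T r t" using sT(2) r t IF(1) by (auto simp: connected_graph_reach)
  then obtain u v where uv: "{u, v} \<in> T" "u \<in> I" "v \<notin> I"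
    using reach_closed[of T r t I] r t(2) by blast
  then have vD: "v \<in> D" using sT(1) by (auto simp: complete_edges_iff)
  let ?F = "insert {u, v} F" and ?I = "insert v I"
  have uvF: "{u, v} \<notin> F" using uv(3) IF(6) complete_edges_iff by blast
  have finF: "finite F" using IF(6) finI finite_complete_edges finite_subset by blast
  have "reach ?F u a" if "a \<in> ?I" for a
  proof (cases "a = v")
    case True
    then show ?thesis using reach_edge[of u v ?F] by simp
  next
    case False
    then have "reach F u a" using IF(4) uv(2) that by (simp add: connected_graph_reach)
    then show ?thesis by (rule reach_mono) auto
  qed
  then have "connected_graph ?I ?F" by (rule connected_graphI)
  moreover have "gnb_partial D ?I (?F \<union> {{0, i} | i. i \<in> ?I})"
  proof -
    have "?F \<union> {{0, i} | i. i \<in> ?I} = (F \<union> {{0, i} | i. i \<in> I}) \<union> {{0, v}, {u, v}}" by auto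
    then show ?thesis using gnb_partial.add_vertex[OF IF(7), of v u] vD uv by simp
  qed
  moreover have "?F \<subseteq> complete_edges ?I"
    using IF(6) complete_edges_mono[of I ?I] uv by (auto simp: complete_edges_iff)
  moreover have "card ?I = Suc k" "Suc (card ?F) = Suc k"
    using IF uv(3) uvF finI finF by simp_all
  ultimately show ?case
    using IF(1,3) uv(1) vD by (intro exI[of _ ?I] exI[of _ ?F]) auto
qed

lemma spanning_tree_gnb:
  assumes D: "finite D" "2 \<le> card D" and T: "spanning_tree D T"
  shows "gnb_structure D (gnb_of_tree D T)" "Suc (card T) = card D"
proof -
  from tree_grows_gnb[OF D(1) T D(2) order_refl] obtain I F where IF: "I \<subseteq> D" "card I = card D"
    "F \<subseteq> T" "connected_graph I F" "Suc (card F) = card D"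
    "gnb_partial D I (F \<union> {{0, i} | i. i \<in> I})" by blast
  have "I = D" using IF(1,2) D(1) by (simp add: card_subset_eq)
  moreover from this have "F = T"
    using connected_subset_of_acyclic_eq[of T D F] T IF by (auto simp: spanning_tree_def)
  ultimately show "gnb_structure D (gnb_of_tree D T)" "Suc (card T) = card D"
    using IF by (simp_all add: gnb_structure_def gnb_of_tree_def)
qed

section \<open>Clusters, separators and the factorisation along a tree\<close>

lemma acyclic_triangle_free:
  assumes "acyclic_graph T" "{a, b} \<in> T" "{b, c} \<in> T" "{a, c} \<in> T" "a \<noteq> b" "b \<noteq> c" "a \<noteq> c"
  shows False
proof -
  have "reach (T - {{a, b}}) a c" "reach (T - {{a, b}}) c b"
    using assms by (auto intro!: reach_edge simp: doubleton_eq_iff insert_commute)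
  then show False using acyclic_edge_is_bridge[OF assms(1,2,5)] reach_trans by blast
qed

lemma gnb_of_tree_edge:
  assumes "a \<noteq> b" "0 \<notin> D" "T \<subseteq> complete_edges D"
  shows "{a, b} \<in> gnb_of_tree D T \<longleftrightarrow> {a, b} \<in> T \<or> a = 0 \<and> b \<in> D \<or> b = 0 \<and> a \<in> D"
  using assms by (auto simp: gnb_of_tree_def doubleton_eq_iff complete_edges_iff)

text \<open>A triangle of the GNB graph without 0 would be a triangle of \<open>T\<close>, so each
  three-element clique consists of 0 and a tree edge {l, m}. It is maximal for the same reason: a
  further vertex would form a triangle of \<open>T\<close> with l and m.\<close>

lemma clusters_gnb_of_tree:
  assumes T: "spanning_tree D T" and D0: "0 \<notin> D"
  shows "clusters (gnb_of_tree D T) = insert 0 ` T"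
proof (intro set_eqI iffI)
  let ?E = "gnb_of_tree D T"
  from T have sT: "T \<subseteq> complete_edges D" "acyclic_graph T" by (auto simp: spanning_tree_def)
  note edge = gnb_of_tree_edge[OF _ D0 sT(1)]
  fix C
  {
    assume "C \<in> clusters ?E"
    then have "card C = 3" and cl: "is_clique ?E C" by (auto simp: clusters_def)
    then obtain a b c where C: "C = {a, b, c}" "a \<noteq> b" "b \<noteq> c" "a \<noteq> c" by (auto simp: card_3_iff)
    have E: "{a, b} \<in> ?E" "{b, c} \<in> ?E" "{a, c} \<in> ?E" using cl C by (auto simp: is_clique_def)
    have "a = 0 \<or> b = 0 \<or> c = 0"
      using acyclic_triangle_free[OF sT(2), of a b c] E C(2-4) edge by blast
    then obtain l m where "C = {0, l, m}" "l \<noteq> m" "l \<noteq> 0" "m \<noteq> 0" "{l, m} \<in> ?E"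
      using C E by (metis insert_commute)
    then show "C \<in> insert 0 ` T" using edge[of l m] by blast
  }
  {
    assume "C \<in> insert 0 ` T"
    then obtain e where e: "e \<in> T" "C = insert 0 e" by blast
    then obtain l m where lm: "e = {l, m}" "l \<in> D" "m \<in> D" "l \<noteq> m"
      using sT complete_edgesE by blast
    have nz: "l \<noteq> 0" "m \<noteq> 0" using lm D0 by auto
    have "is_clique ?E C"
    proof -
      have "{0, l} \<in> ?E" "{0, m} \<in> ?E" "{l, m} \<in> ?E"
        using e lm by (auto simp: gnb_of_tree_def)
      then show ?thesis
        unfolding is_clique_def e(2) lm(1) by (auto simp: insert_commute)
    qed
    moreover have "C' = C" if C': "is_clique ?E C'" "C \<subseteq> C'" for C'
    proof (rule ccontr)
      assume "C' \<noteq> C"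
      then obtain x where x: "x \<in> C'" "x \<notin> C" using C' by auto
      then have "x \<noteq> 0" "x \<noteq> l" "x \<noteq> m" using e lm by auto
      moreover have "{x, l} \<in> ?E" "{x, m} \<in> ?E"
        using that x calculation e lm by (auto simp: is_clique_def)
      ultimately have "{x, l} \<in> T" "{x, m} \<in> T" using edge nz by blast+
      then show False
        using acyclic_triangle_free[OF sT(2), of l x m] e lm \<open>x \<noteq> l\<close> \<open>x \<noteq> m\<close>
        by (simp add: insert_commute)
    qed
    moreover have "card C = 3" using e lm nz by simp
    ultimately show "C \<in> clusters ?E" unfolding clusters_def by blast
  }
qed

definition degree_in :: "nat set set \<Rightarrow> nat \<Rightarrow> nat" where
  "degree_in T s = card {e \<in> T. s \<in> e}"

lemma degree_in_ge_2_iff: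
  assumes "finite T"
  shows "2 \<le> degree_in T s \<longleftrightarrow> (\<exists>e\<in>T. \<exists>e'\<in>T. e \<noteq> e' \<and> s \<in> e \<and> s \<in> e')"
  using card_le_Suc0_iff_eq[of "{e \<in> T. s \<in> e}"] assms
  unfolding degree_in_def not_less_eq_eq[symmetric] numeral_2_eq_2 by auto

lemma degree_in_pos:
  assumes D: "finite D" "2 \<le> card D" and T: "spanning_tree D T" and s: "s \<in> D"
  shows "1 \<le> degree_in T s"
proof -
  from T have sT: "T \<subseteq> complete_edges D" "connected_graph D T" by (auto simp: spanning_tree_def)
  have finT: "finite T" using sT D finite_complete_edges finite_subset by blast
  obtain t where t: "t \<in> D" "t \<noteq> s"
    using D s by (metis card_le_Suc0_iff_eq not_less_eq_eq numeral_2_eq_2)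
  then have "reach T s t" using sT(2) s by (simp add: connected_graph_reach)
  then obtain b where "{s, b} \<in> T" using reach_closed[of T s t "{s}"] t by blast
  then have "{e \<in> T. s \<in> e} \<noteq> {}" by blast
  then show ?thesis using finT by (simp add: degree_in_def Suc_le_eq card_gt_0_iff)
qed

text \<open>Two different clusters share two elements precisely if their tree edges have a common
  endpoint s, and such edges exist precisely if s has degree at least two.\<close>

lemma separators_gnb_of_tree:
  assumes D: "finite D" "0 \<notin> D" and T: "spanning_tree D T"
  shows "separators (gnb_of_tree D T) = (\<lambda>s. {0, s}) ` {s \<in> D. 2 \<le> degree_in T s}"
proof (intro set_eqI iffI)
  from T have sT: "T \<subseteq> complete_edges D" by (auto simp: spanning_tree_def)
  then have finT: "finite T" using D finite_complete_edges finite_subset by blast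
  have e0: "0 \<notin> e" "e \<subseteq> D" "finite e" "card e = 2" if "e \<in> T" for e
    using that sT D(2) by (auto simp: complete_edges_def)
  fix S
  {
    assume "S \<in> separators (gnb_of_tree D T)"
    then obtain C C' where "S = C \<inter> C'" "C \<in> insert 0 ` T" "C' \<in> insert 0 ` T" "C \<noteq> C'"
      "card (C \<inter> C') = 2"
      unfolding separators_def clusters_gnb_of_tree[OF T D(2)] by blast
    then obtain e e' where e: "e \<in> T" "e' \<in> T" "e \<noteq> e'" "S = insert 0 e \<inter> insert 0 e'" "card S = 2"
      by blast
    then have S: "S = insert 0 (e \<inter> e')" by auto
    then have "card (e \<inter> e') = 1" using e e0 by simp
    then obtain s where "e \<inter> e' = {s}" by (auto simp: card_1_singleton_iff)
    then have se: "s \<in> e" "s \<in> e'" and "S = {0, s}" using S by auto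
    moreover have "s \<in> D" using se(1) e(1) e0(2) by blast
    moreover have "2 \<le> degree_in T s" using se e(1-3) degree_in_ge_2_iff[OF finT] by blast
    ultimately have "S = {0, s}" "s \<in> D" "2 \<le> degree_in T s" by simp_all
    then show "S \<in> (\<lambda>s. {0, s}) ` {s \<in> D. 2 \<le> degree_in T s}" by blast
  }
  {
    assume "S \<in> (\<lambda>s. {0, s}) ` {s \<in> D. 2 \<le> degree_in T s}"
    then obtain s where s: "S = {0, s}" "s \<in> D" "2 \<le> degree_in T s" by blast
    then obtain e e' where e: "e \<in> T" "e' \<in> T" "e \<noteq> e'" "s \<in> e" "s \<in> e'"
      using degree_in_ge_2_iff[OF finT] by blast
    have other: "\<exists>a. f = {s, a}" if "f \<in> T" "s \<in> f" for f
    proof -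
      from that sT obtain u v where "f = {u, v}" by (auto simp: complete_edges_def)
      with that(2) have "f = {s, v} \<or> f = {s, u}" by auto
      then show ?thesis by blast
    qed
    obtain a b where "e = {s, a}" "e' = {s, b}"
      using other[OF e(1,4)] other[OF e(2,5)] by blast
    then have "e \<inter> e' = {s}" using e(3) by auto
    then have S: "S = insert 0 e \<inter> insert 0 e'" using s by auto
    have "insert 0 e \<noteq> insert 0 e'"
      using insert_ident[OF e0(1)[OF e(1)] e0(1)[OF e(2)]] e(3) by simp
    moreover have "card S = 2" using s D(2) by (cases "s = 0") auto
    ultimately show "S \<in> separators (gnb_of_tree D T)"
      unfolding separators_def clusters_gnb_of_tree[OF T D(2)] S
      by (intro CollectI exI[of _ "insert 0 e"] exI[of _ "insert 0 e'"] conjI refl imageI e(1,2))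
  }
qed

lemma multiplicity_gnb_of_tree:
  assumes D: "0 \<notin> D" and T: "spanning_tree D T" and s: "s \<in> D"
  shows "multiplicity_sep (gnb_of_tree D T) {0, s} = degree_in T s"
proof -
  have e0: "0 \<notin> e" if "e \<in> T" for e
    using that T D by (auto simp: spanning_tree_def complete_edges_def)
  have "{C \<in> insert 0 ` T. {0, s} \<subseteq> C} = insert 0 ` {e \<in> T. s \<in> e}"
    using s D by auto
  moreover have "inj_on (insert 0) {e \<in> T. s \<in> e}"
    using e0 by (auto simp: inj_on_def insert_ident)
  ultimately show ?thesis
    unfolding multiplicity_sep_def clusters_gnb_of_tree[OF T D] degree_in_def
    by (simp add: card_image)
qed

lemma gnb_density_tree:
  assumes D: "finite D" "0 \<notin> D" and T: "spanning_tree D T"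
  shows "gnb_density D p (gnb_of_tree D T) x y =
    (\<Prod>e\<in>T. marginal_density D p e x y) /
    (\<Prod>s\<in>D. marginal_density D p {s} x y ^ (degree_in T s - 1))"
proof -
  have e0: "0 \<notin> e" if "e \<in> T" for e
    using that T D by (auto simp: spanning_tree_def complete_edges_def)
  have num: "(\<Prod>C\<in>clusters (gnb_of_tree D T). marginal_density D p (C - {0}) x y) =
      (\<Prod>e\<in>T. marginal_density D p e x y)"
    unfolding clusters_gnb_of_tree[OF T D(2)]
  proof (subst prod.reindex)
    show "inj_on (insert 0) T" using e0 by (auto simp: inj_on_def insert_ident)
  qed (use e0 in \<open>auto intro!: prod.cong\<close>)
  have "(\<Prod>S\<in>separators (gnb_of_tree D T). marginal_density D p (S - {0}) x y ^
        (multiplicity_sep (gnb_of_tree D T) S - 1)) =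
      (\<Prod>s\<in>{s \<in> D. 2 \<le> degree_in T s}. marginal_density D p {s} x y ^ (degree_in T s - 1))"
    unfolding separators_gnb_of_tree[OF D T]
  proof (subst prod.reindex)
    show "inj_on (\<lambda>s. {0, s}) {s \<in> D. 2 \<le> degree_in T s}"
      by (auto simp: inj_on_def doubleton_eq_iff)
    have "{0, s} - {0} = {s}" if "s \<in> D" for s using that D(2) by auto
    then show "prod ((\<lambda>S. marginal_density D p (S - {0}) x y ^
        (multiplicity_sep (gnb_of_tree D T) S - 1)) \<circ> (\<lambda>s. {0, s})) {s \<in> D. 2 \<le> degree_in T s} =
      (\<Prod>s\<in>{s \<in> D. 2 \<le> degree_in T s}. marginal_density D p {s} x y ^ (degree_in T s - 1))"
      using multiplicity_gnb_of_tree[OF D(2) T] by (intro prod.cong) auto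
  qed
  \<comment> \<open>Vertices of degree below two contribute the exponent 0, so the product can run
    over all of \<open>D\<close>.\<close>
  also have "\<dots> = (\<Prod>s\<in>D. marginal_density D p {s} x y ^ (degree_in T s - 1))"
  proof (intro prod.mono_neutral_left ballI)
    fix s assume "s \<in> D - {s \<in> D. 2 \<le> degree_in T s}"
    then have "degree_in T s - 1 = 0" by auto
    then show "marginal_density D p {s} x y ^ (degree_in T s - 1) = 1" by simp
  qed (use D(1) in auto)
  finally show ?thesis unfolding gnb_density_def num by simp
qed

text \<open>Double counting of the incidences between vertices and edges.\<close>

lemma sum_degree_in:
  fixes f :: "nat \<Rightarrow> real"
  assumes D: "finite D" and T: "T \<subseteq> complete_edges D"
  shows "(\<Sum>s\<in>D. degree_in T s * f s) = (\<Sum>e\<in>T. \<Sum>s\<in>e. f s)"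
proof -
  have finT: "finite T" using T D finite_complete_edges finite_subset by blast
  have sub: "e \<subseteq> D" if "e \<in> T" for e using that T by (auto simp: complete_edges_def)
  have "(\<Sum>s\<in>D. degree_in T s * f s) = (\<Sum>s\<in>D. \<Sum>e\<in>{e \<in> T. s \<in> e}. f s)"
    by (simp add: degree_in_def)
  also have "\<dots> = (\<Sum>e\<in>T. \<Sum>s\<in>{s \<in> D. s \<in> e}. f s)"
    using D finT by (intro sum.swap_restrict)
  also have "\<dots> = (\<Sum>e\<in>T. \<Sum>s\<in>e. f s)"
    using sub by (intro sum.cong) (auto intro!: arg_cong[where f = "sum f"])
  finally show ?thesis .
qed

text \<open>Each q s has the exponent 1 - deg s in the quotient. The 1 yields the sum over the
  vertices, and the degrees yield, by double counting, the sum over the endpoints of the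
  edges.\<close>

lemma ln_tree_product:
  fixes P :: "nat set \<Rightarrow> real" and q :: "nat \<Rightarrow> real"
  assumes D: "finite D" "2 \<le> card D" and T: "spanning_tree D T"
    and pos: "\<And>e. e \<in> T \<Longrightarrow> 0 < P e" "\<And>s. s \<in> D \<Longrightarrow> 0 < q s"
  shows "ln ((\<Prod>e\<in>T. P e) / (\<Prod>s\<in>D. q s ^ (degree_in T s - 1))) =
    (\<Sum>s\<in>D. ln (q s)) + (\<Sum>e\<in>T. ln (P e) - (\<Sum>s\<in>e. ln (q s)))"
proof -
  from T have sT: "T \<subseteq> complete_edges D" by (auto simp: spanning_tree_def)
  then have finT: "finite T" using D finite_complete_edges finite_subset by blast
  have "ln ((\<Prod>e\<in>T. P e) / (\<Prod>s\<in>D. q s ^ (degree_in T s - 1))) =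
      (\<Sum>e\<in>T. ln (P e)) - (\<Sum>s\<in>D. ln (q s ^ (degree_in T s - 1)))"
  proof -
    have "0 < (\<Prod>e\<in>T. P e)" "0 < (\<Prod>s\<in>D. q s ^ (degree_in T s - 1))"
      using pos by (auto intro!: prod_pos)
    moreover have "ln (\<Prod>e\<in>T. P e) = (\<Sum>e\<in>T. ln (P e))"
      using pos(1) less_imp_neq by (intro ln_prod finT) fastforce
    moreover have "ln (\<Prod>s\<in>D. q s ^ (degree_in T s - 1)) = (\<Sum>s\<in>D. ln (q s ^ (degree_in T s - 1)))"
      using pos(2) less_imp_neq by (intro ln_prod D) fastforce
    ultimately show ?thesis by (simp add: ln_div)
  qed
  also have "(\<Sum>s\<in>D. ln (q s ^ (degree_in T s - 1))) =
      (\<Sum>s\<in>D. degree_in T s * ln (q s) - ln (q s))"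
    \<comment> \<open>All degrees are positive, so the natural-number subtraction
      \<open>degree_in T s - 1\<close> is exact.\<close>
    using degree_in_pos[OF D T] pos
    by (intro sum.cong) (auto simp: ln_realpow of_nat_diff algebra_simps)
  also have "\<dots> = (\<Sum>e\<in>T. \<Sum>s\<in>e. ln (q s)) - (\<Sum>s\<in>D. ln (q s))"
    using sum_degree_in[OF D(1) sT, of "\<lambda>s. ln (q s)"] by (simp add: sum_subtractf)
  finally show ?thesis by (simp add: sum_subtractf)
qed

section \<open>Mutual information of a law on the plane\<close>

text \<open>As a relation it makes absolute continuity and finiteness of the mutual information part
  of the claim. The set where \<open>h\<close> is not positive is \<mu>-null, so
  \<open>ln (h z)\<close> is the true log-density \<mu>-almost surely.\<close>

definition has_mutual_info :: "(real \<times> real) measure \<Rightarrow> real \<Rightarrow> bool" where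
  "has_mutual_info \<mu> r \<longleftrightarrow>
     (\<exists>h\<in>borel_measurable (borel \<Otimes>\<^sub>M borel).
        \<mu> = density (distr \<mu> borel fst \<Otimes>\<^sub>M distr \<mu> borel snd) (\<lambda>z. ennreal (h z)) \<and>
        has_bochner_integral \<mu> (\<lambda>z. ln (h z)) r)"

text \<open>The transported density is \<open>h\<close> composed with the inverse maps. Inverses
  that work almost surely in each coordinate suffice: they work almost everywhere for the product of
  the marginals, and \<mu> has a density with respect to that product.\<close>

lemma has_mutual_info_distr:
  fixes \<mu> :: "(real \<times> real) measure"
  assumes P: "prob_space \<mu>" and S: "sets \<mu> = sets (borel \<Otimes>\<^sub>M borel)"
    and [measurable]: "F \<in> borel_measurable borel" "G \<in> borel_measurable borel"
      "F' \<in> borel_measurable borel" "G' \<in> borel_measurable borel"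
    and inv: "AE x in distr \<mu> borel fst. F' (F x) = x" "AE y in distr \<mu> borel snd. G' (G y) = (y::real)"
    and I: "has_mutual_info \<mu> r"
  shows "has_mutual_info (distr \<mu> (borel \<Otimes>\<^sub>M borel) (\<lambda>(x, y). (F x :: real, G y :: real))) r"
proof -
  interpret P: prob_space \<mu> by fact
  note S[measurable_cong]
  let ?B = "borel \<Otimes>\<^sub>M borel :: (real \<times> real) measure"
  let ?T = "\<lambda>(x, y). (F x, G y)"
  let ?\<mu>1 = "distr \<mu> borel fst" and ?\<mu>2 = "distr \<mu> borel snd"
  let ?\<nu> = "distr \<mu> ?B ?T"
  interpret P1: prob_space ?\<mu>1 by (rule P.prob_space_distr) simp
  interpret P2: prob_space ?\<mu>2 by (rule P.prob_space_distr) simp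
  interpret P12: pair_sigma_finite ?\<mu>1 ?\<mu>2 ..
  from I obtain h where h[measurable]: "h \<in> borel_measurable ?B"
    and dens: "\<mu> = density (?\<mu>1 \<Otimes>\<^sub>M ?\<mu>2) (\<lambda>z. ennreal (h z))"
    and int: "has_bochner_integral \<mu> (\<lambda>z. ln (h z)) r"
    by (auto simp: has_mutual_info_def)
  define h' where "h' = (\<lambda>(u, v). h (F' u, G' v))"
  have h'[measurable]: "h' \<in> borel_measurable ?B" unfolding h'_def by measurable
  have m1: "distr ?\<nu> borel fst = distr ?\<mu>1 borel F"
    by (subst (1 2) distr_distr) (auto simp: comp_def split_beta intro!: distr_cong)
  have m2: "distr ?\<nu> borel snd = distr ?\<mu>2 borel G"
    by (subst (1 2) distr_distr) (auto simp: comp_def split_beta intro!: distr_cong)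
  interpret P2': prob_space "distr ?\<mu>2 borel G" by (rule P2.prob_space_distr) simp
  have prod: "distr ?\<mu>1 borel F \<Otimes>\<^sub>M distr ?\<mu>2 borel G = distr (?\<mu>1 \<Otimes>\<^sub>M ?\<mu>2) ?B ?T"
    by (rule pair_measure_distr) (auto intro: P2'.sigma_finite_measure_axioms)
  have AEp: "AE z in ?\<mu>1 \<Otimes>\<^sub>M ?\<mu>2. h' (?T z) = h z"
  proof (rule P12.AE_pair_measure)
    show "{z \<in> space (?\<mu>1 \<Otimes>\<^sub>M ?\<mu>2). h' (?T z) = h z} \<in> sets (?\<mu>1 \<Otimes>\<^sub>M ?\<mu>2)" by measurable
    show "AE x in ?\<mu>1. AE y in ?\<mu>2. h' (?T (x, y)) = h (x, y)"
      using inv(1)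
    proof eventually_elim
      case (elim x)
      show ?case using inv(2) by eventually_elim (simp add: h'_def elim)
    qed
  qed
  have "?\<nu> = density (distr ?\<nu> borel fst \<Otimes>\<^sub>M distr ?\<nu> borel snd) (\<lambda>z. ennreal (h' z))"
  proof -
    have "density (distr ?\<nu> borel fst \<Otimes>\<^sub>M distr ?\<nu> borel snd) (\<lambda>z. ennreal (h' z)) =
        distr (density (?\<mu>1 \<Otimes>\<^sub>M ?\<mu>2) (\<lambda>z. ennreal (h' (?T z)))) ?B ?T"
      unfolding m1 m2 prod by (rule density_distr) measurable
    also have "density (?\<mu>1 \<Otimes>\<^sub>M ?\<mu>2) (\<lambda>z. ennreal (h' (?T z))) = \<mu>"
      by (subst dens, rule density_cong) (use AEp in auto)
    finally show ?thesis by simp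
  qed
  moreover have "has_bochner_integral ?\<nu> (\<lambda>z. ln (h' z)) r"
  proof (rule has_bochner_integral_distr)
    have "AE z in \<mu>. h' (?T z) = h z"
      by (subst dens, subst AE_density) (use AEp in auto)
    then show "has_bochner_integral \<mu> (\<lambda>z. ln (h' (?T z))) r"
      using int by (subst has_bochner_integral_cong_AE[where g = "\<lambda>z. ln (h z)"]) auto
  qed measurable
  ultimately show ?thesis unfolding has_mutual_info_def using h' by blast
qed

text \<open>The inverse maps transport the information back: on the image law they are themselves
  inverted by \<open>F\<close> and \<open>G\<close>, because F (F' (F x)) = F x almost
  surely.\<close>

lemma has_mutual_info_distrD:
  fixes \<mu> :: "(real \<times> real) measure"
  assumes P: "prob_space \<mu>" and S: "sets \<mu> = sets (borel \<Otimes>\<^sub>M borel)"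
    and [measurable]: "F \<in> borel_measurable borel" "G \<in> borel_measurable borel"
      "F' \<in> borel_measurable borel" "G' \<in> borel_measurable borel"
    and inv: "AE x in distr \<mu> borel fst. F' (F x) = x" "AE y in distr \<mu> borel snd. G' (G y) = (y::real)"
    and I: "has_mutual_info (distr \<mu> (borel \<Otimes>\<^sub>M borel) (\<lambda>(x, y). (F x :: real, G y :: real))) r"
  shows "has_mutual_info \<mu> r"
proof -
  interpret P: prob_space \<mu> by fact
  note S[measurable_cong]
  let ?B = "borel \<Otimes>\<^sub>M borel :: (real \<times> real) measure"
  let ?T = "\<lambda>(x, y). (F x, G y)" and ?T' = "\<lambda>(x, y). (F' x, G' y)"
  let ?\<nu> = "distr \<mu> ?B ?T"
  have inv1: "AE z in \<mu>. F' (F (fst z)) = fst z"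
    by (rule AE_distrD[OF _ inv(1)]) measurable
  have inv2: "AE z in \<mu>. G' (G (snd z)) = snd z"
    by (rule AE_distrD[OF _ inv(2)]) measurable
  have "has_mutual_info (distr ?\<nu> ?B ?T') r"
  proof (rule has_mutual_info_distr[OF _ _ _ _ _ _ _ _ I])
    show "prob_space ?\<nu>" by (rule P.prob_space_distr) measurable
    have "AE z in \<mu>. F (F' (F (fst z))) = F (fst z)" using inv1 by eventually_elim simp
    then have "AE z in \<mu>. F (F' (fst (?T z))) = fst (?T z)" by (simp add: split_beta)
    then show "AE x in distr ?\<nu> borel fst. F (F' x) = x"
      by (subst AE_distr_iff, measurable, subst AE_distr_iff, measurable)
    have "AE z in \<mu>. G (G' (G (snd z))) = G (snd z)" using inv2 by eventually_elim simp
    then have "AE z in \<mu>. G (G' (snd (?T z))) = snd (?T z)" by (simp add: split_beta)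
    then show "AE x in distr ?\<nu> borel snd. G (G' x) = x"
      by (subst AE_distr_iff, measurable, subst AE_distr_iff, measurable)
  qed auto
  also have "distr ?\<nu> ?B ?T' = distr \<mu> ?B (\<lambda>z. ?T' (?T z))"
    by (subst distr_distr) (auto simp: comp_def)
  also have "\<dots> = distr \<mu> \<mu> (\<lambda>z. z)"
  proof (rule distr_cong_AE)
    show "AE z in \<mu>. ?T' (?T z) = z"
      using inv1 inv2 by eventually_elim (simp add: split_beta)
  qed (auto simp: S)
  finally show ?thesis by simp
qed

text \<open>Uniqueness of Lebesgue densities gives f = f1 f2 h almost everywhere, and where f is
  positive all three factors are, so that h may be solved for inside the logarithm.\<close>

lemma has_mutual_info_lborel:
  fixes \<mu> :: "(real \<times> real) measure"
  assumes P: "prob_space \<mu>"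
    and [measurable]: "f \<in> borel_measurable (borel \<Otimes>\<^sub>M borel)" "f1 \<in> borel_measurable borel"
      "f2 \<in> borel_measurable borel"
    and nn: "\<And>x. 0 \<le> f1 x" "\<And>x. 0 \<le> f2 x"
    and \<mu>: "\<mu> = density (lborel \<Otimes>\<^sub>M lborel) (\<lambda>z. ennreal (f z))"
    and \<mu>1: "distr \<mu> borel fst = density lborel (\<lambda>x. ennreal (f1 x))"
    and \<mu>2: "distr \<mu> borel snd = density lborel (\<lambda>x. ennreal (f2 x))"
    and I: "has_mutual_info \<mu> r"
  shows "has_bochner_integral \<mu> (\<lambda>z. ln (f z / (f1 (fst z) * f2 (snd z)))) r"
proof -
  interpret P: prob_space \<mu> by fact
  let ?B = "borel \<Otimes>\<^sub>M borel :: (real \<times> real) measure"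
  let ?L = "lborel \<Otimes>\<^sub>M lborel :: (real \<times> real) measure"
  have S[measurable_cong]: "sets \<mu> = sets ?B" unfolding \<mu> by (simp cong: sets_pair_measure_cong)
  from I obtain h where h[measurable]: "h \<in> borel_measurable ?B"
    and dens: "\<mu> = density (distr \<mu> borel fst \<Otimes>\<^sub>M distr \<mu> borel snd) (\<lambda>z. ennreal (h z))"
    and int: "has_bochner_integral \<mu> (\<lambda>z. ln (h z)) r"
    by (auto simp: has_mutual_info_def)
  have "prob_space (distr \<mu> borel snd)" by (rule P.prob_space_distr) measurable
  then interpret P2: prob_space "density lborel (\<lambda>x. ennreal (f2 x))" unfolding \<mu>2 .
  have sf: "sigma_finite_measure ?L"
    unfolding lborel_prod by (rule lborel.sigma_finite_measure_axioms)
  have pd: "density lborel (\<lambda>x. ennreal (f1 x)) \<Otimes>\<^sub>M density lborel (\<lambda>x. ennreal (f2 x)) =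
      density ?L (\<lambda>(x, y). ennreal (f1 x) * ennreal (f2 y))"
    by (rule pair_measure_density)
      (auto intro: P2.sigma_finite_measure_axioms lborel.sigma_finite_measure_axioms)
  have eq: "density ?L (\<lambda>z. ennreal (f z)) =
      density ?L (\<lambda>z. (case z of (x, y) \<Rightarrow> ennreal (f1 x) * ennreal (f2 y)) * ennreal (h z))"
    using dens unfolding \<mu>1 \<mu>2 pd by (subst (asm) density_density_eq) (auto simp: \<mu>[symmetric])
  have "AE z in ?L. ennreal (f z) =
      (case z of (x, y) \<Rightarrow> ennreal (f1 x) * ennreal (f2 y)) * ennreal (h z)"
    by (rule sigma_finite_measure.density_unique[OF sf _ _ eq]) measurable
  then have "AE z in ?L. 0 < ennreal (f z) \<longrightarrow> ln (h z) = ln (f z / (f1 (fst z) * f2 (snd z)))"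
  proof eventually_elim
    case (elim z)
    show ?case
    proof
      assume f: "0 < ennreal (f z)"
      have e: "ennreal (f z) = ennreal (f1 (fst z) * f2 (snd z)) * ennreal (h z)"
        using elim nn by (simp add: split_beta ennreal_mult)
      then have pos: "0 < f1 (fst z) * f2 (snd z)" "0 < h z" using f by (auto simp: zero_less_iff_neq_zero not_le ennreal_eq_0_iff)
      have "ennreal (f z) = ennreal (f1 (fst z) * f2 (snd z) * h z)"
        unfolding e using pos by (simp add: ennreal_mult)
      then have "f z = f1 (fst z) * f2 (snd z) * h z" using f pos by (subst (asm) ennreal_inj) (auto simp: less_imp_le)
      moreover have "f1 (fst z) \<noteq> 0" "f2 (snd z) \<noteq> 0" using pos(1) by auto
      ultimately show "ln (h z) = ln (f z / (f1 (fst z) * f2 (snd z)))" by simp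
    qed
  qed
  then have "AE z in \<mu>. ln (h z) = ln (f z / (f1 (fst z) * f2 (snd z)))"
    unfolding \<mu> by (subst AE_density) auto
  then show ?thesis
    using int by (subst has_bochner_integral_cong_AE[where g = "\<lambda>z. ln (h z)"]) auto
qed

text \<open>The graph of a measurable function is a Lebesgue null set of the plane. This is the
  source of the nondegeneracy that excludes vanishing variances and correlation 1 or -1.\<close>

lemma lborel_density_not_graph:
  fixes \<mu> :: "(real \<times> real) measure"
  assumes P: "prob_space \<mu>"
    and \<mu>: "\<mu> = density (lborel \<Otimes>\<^sub>M lborel) f"
    and [measurable]: "f \<in> borel_measurable (borel \<Otimes>\<^sub>M borel)" "g \<in> borel_measurable borel"
  shows "\<not> (AE z in \<mu>. snd z = g (fst z))" "\<not> (AE z in \<mu>. fst z = g (snd z))"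
proof -
  interpret P: prob_space \<mu> by fact
  let ?L = "lborel \<Otimes>\<^sub>M lborel :: (real \<times> real) measure"
  have "AE z in ?L. snd z \<noteq> g (fst z)"
  proof (rule lborel_pair.AE_pair_measure)
    show "{z \<in> space ?L. snd z \<noteq> g (fst z)} \<in> sets ?L" by measurable
  qed (simp add: AE_lborel_singleton)
  then have 1: "AE z in \<mu>. snd z \<noteq> g (fst z)" unfolding \<mu> by (subst AE_density) auto
  have "AE z in ?L. fst z \<noteq> g (snd z)"
  proof (rule lborel_pair.AE_pair_measure)
    show m: "{z \<in> space ?L. fst z \<noteq> g (snd z)} \<in> sets ?L" by measurable
    have "AE y in lborel. AE x in lborel. x \<noteq> g y" by (simp add: AE_lborel_singleton)
    then show "AE x in lborel. AE y in lborel. fst (x, y) \<noteq> g (snd (x, y))"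
      using lborel_pair.AE_commute[where P = "\<lambda>x y. x \<noteq> g y", OF m] by simp
  qed
  then have 2: "AE z in \<mu>. fst z \<noteq> g (snd z)" unfolding \<mu> by (subst AE_density) auto
  have F: "\<not> (AE z in \<mu>. False)" by simp
  show "\<not> (AE z in \<mu>. snd z = g (fst z))"
  proof
    assume "AE z in \<mu>. snd z = g (fst z)"
    with 1 have "AE z in \<mu>. False" by eventually_elim simp
    with F show False ..
  qed
  show "\<not> (AE z in \<mu>. fst z = g (snd z))"
  proof
    assume "AE z in \<mu>. fst z = g (snd z)"
    with 2 have "AE z in \<mu>. False" by eventually_elim simp
    with F show False ..
  qed
qed

section \<open>The probability integral transform\<close>

abbreviation uniform01 :: "real measure" where
  "uniform01 \<equiv> density lborel (\<lambda>u. ennreal (indicator {0<..<1} u))"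

text \<open>The quantile function \<open>?I\<close> carries all three claims: under the uniform law
  on the unit interval it has law \<nu>, and continuity of the distribution function yields
  \<open>cdf \<nu> (?I u) = u\<close>. So \<open>?I\<close> is a right inverse of
  \<open>cdf \<nu>\<close> on the open unit interval, and on values taken by \<open>?I\<close>,
  hence \<nu>-almost surely, also a left inverse.\<close>

lemma
  fixes \<nu> :: "real measure"
  assumes \<nu>: "real_distribution \<nu>" and atomless: "\<And>x. measure \<nu> {x} = 0"
  shows distr_cdf_uniform: "distr \<nu> borel (cdf \<nu>) = uniform01"
    and cdf_surj: "\<And>u. 0 < u \<Longrightarrow> u < 1 \<Longrightarrow> \<exists>x. cdf \<nu> x = u"
    and cdf_AE_invertible: "\<exists>Q\<in>borel_measurable borel. AE x in \<nu>. Q (cdf \<nu> x) = x"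
proof -
  interpret cdf_distribution \<nu> using \<nu> by (simp add: cdf_distribution_def)
  let ?\<Omega> = "restrict_space lborel {0<..<1::real}"
  let ?I = "\<lambda>u. Inf {x. u \<le> cdf \<nu> x}"
  have CI: "cdf \<nu> (?I u) = u" if u: "u \<in> {0<..<1}" for u
  proof (rule antisym)
    show "u \<le> cdf \<nu> (?I u)" using pseudoinverse[of u "?I u"] u by auto
    \<comment> \<open>Left of the infimum the distribution function stays below u; continuity passes
      this bound to the infimum itself.\<close>
    have "isCont (cdf \<nu>) (?I u)" by (simp add: isCont_cdf atomless)
    then have "(cdf \<nu> \<longlongrightarrow> cdf \<nu> (?I u)) (at_left (?I u))"
      by (simp add: isCont_def filterlim_at_split)
    moreover have "\<forall>\<^sub>F x in at_left (?I u). x \<in> {?I u - 1<..<?I u}"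
      by (rule eventually_at_left_real) simp
    then have "\<forall>\<^sub>F x in at_left (?I u). cdf \<nu> x \<le> u"
    proof eventually_elim
      case (elim x)
      then show ?case using pseudoinverse[of u x] u by auto
    qed
    ultimately show "cdf \<nu> (?I u) \<le> u" by (rule tendsto_upperbound) simp
  qed
  show "\<exists>x. cdf \<nu> x = u" if "0 < u" "u < 1" for u
    using CI[of u] that by auto
  have mI[measurable]: "?I \<in> borel_measurable ?\<Omega>"
    using measurable_CI by (simp cong: measurable_cong_sets sets_restrict_space_cong)
  have "distr (distr ?\<Omega> borel ?I) borel (cdf \<nu>) = distr ?\<Omega> borel (\<lambda>u. cdf \<nu> (?I u))"
    by (subst distr_distr) (auto simp: comp_def)
  then have "distr \<nu> borel (cdf \<nu>) = distr ?\<Omega> borel (\<lambda>u. cdf \<nu> (?I u))"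
    by (simp only: distr_I_eq_M)
  also have "\<dots> = distr ?\<Omega> borel (\<lambda>u. u)"
    by (rule distr_cong) (auto simp: CI space_restrict_space)
  also have "\<dots> = uniform01"
  proof (rule measure_eqI)
    fix A assume "A \<in> sets (distr ?\<Omega> borel (\<lambda>u. u))"
    then have A[measurable]: "A \<in> sets borel" by simp
    have "emeasure (distr ?\<Omega> borel (\<lambda>u. u)) A = emeasure ?\<Omega> (A \<inter> {0<..<1})"
      by (subst emeasure_distr) (auto simp: space_restrict_space intro!: measurable_restrict_space1)
    also have "\<dots> = emeasure lborel (A \<inter> {0<..<1})" by (rule emeasure_restrict_space) auto
    also have "\<dots> = emeasure uniform01 A"
      by (subst emeasure_density) (auto simp: ennreal_indicator indicator_inter_arith[symmetric] Int_commute)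
    finally show "emeasure (distr ?\<Omega> borel (\<lambda>u. u)) A = emeasure uniform01 A" .
  qed simp
  finally show "distr \<nu> borel (cdf \<nu>) = uniform01" .
  \<comment> \<open>The value 0 outside the open unit interval is a filler that makes the inverse a
    Borel function on the whole line.\<close>
  define Q where "Q u = (if u \<in> {0<..<1} then ?I u else 0)" for u
  have "{u. u \<in> {0<..<1::real}} = {0<..<1}" by (rule Collect_mem_eq)
  then have "Q \<in> borel_measurable borel"
    unfolding Q_def
    by (subst measurable_If_restrict_space_iff) (use measurable_CI in \<open>simp_all del: greaterThanLessThan_iff\<close>)
  moreover have "AE x in distr ?\<Omega> borel ?I. Q (cdf \<nu> x) = x"
  proof (subst AE_distr_iff)
    show "{x \<in> space borel. Q (cdf \<nu> x) = x} \<in> sets borel" using calculation by measurable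
    show "AE u in ?\<Omega>. Q (cdf \<nu> (?I u)) = ?I u"
      by (rule AE_I2) (simp add: space_restrict_space CI Q_def)
  qed (rule mI)
  then have "AE x in \<nu>. Q (cdf \<nu> x) = x" by (simp only: distr_I_eq_M)
  ultimately show "\<exists>Q\<in>borel_measurable borel. AE x in \<nu>. Q (cdf \<nu> x) = x" by blast
qed

lemma
  assumes [measurable]: "A \<in> borel_measurable N" "B \<in> borel_measurable N"
  shows distr_Pair_fst: "distr (distr N (borel \<Otimes>\<^sub>M borel) (\<lambda>\<omega>. (A \<omega>, B \<omega>))) borel fst = distr N borel A"
    and distr_Pair_snd: "distr (distr N (borel \<Otimes>\<^sub>M borel) (\<lambda>\<omega>. (A \<omega>, B \<omega>))) borel snd = distr N borel B"
  by (subst distr_distr; simp add: comp_def)+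

lemma distr_Pair_map:
  assumes [measurable]: "A \<in> borel_measurable N" "B \<in> borel_measurable N"
    "F \<in> borel_measurable borel" "G \<in> borel_measurable borel"
  shows "distr (distr N (borel \<Otimes>\<^sub>M borel) (\<lambda>\<omega>. (A \<omega>, B \<omega>))) (borel \<Otimes>\<^sub>M borel) (\<lambda>(x, y). (F x, G y)) =
    distr N (borel \<Otimes>\<^sub>M borel) (\<lambda>\<omega>. (F (A \<omega>), G (B \<omega>)))"
  by (subst distr_distr) (auto simp: comp_def)

lemma cdf_measurable: "real_distribution \<nu> \<Longrightarrow> cdf \<nu> \<in> borel_measurable borel"
  by (rule cdf_distribution.measurable_C) (simp add: cdf_distribution_def)

lemma prob_transform_uniform:
  assumes N: "prob_space N" and [measurable]: "A \<in> borel_measurable N"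
    and atomless: "\<And>x. measure (distr N borel A) {x} = 0"
  shows "prob_transform N A \<in> borel_measurable N"
    and "distr N borel (prob_transform N A) = uniform01"
proof -
  interpret N: prob_space N by fact
  have rd: "real_distribution (distr N borel A)" by (rule N.real_distribution_distr) simp
  note [measurable] = cdf_measurable[OF rd]
  have eq: "prob_transform N A = (\<lambda>\<omega>. cdf (distr N borel A) (A \<omega>))"
    by (simp add: fun_eq_iff prob_transform_def)
  show "prob_transform N A \<in> borel_measurable N" unfolding eq by measurable
  have "distr N borel (prob_transform N A) = distr (distr N borel A) borel (cdf (distr N borel A))"
    unfolding eq by (subst distr_distr) (auto simp: comp_def)
  then show "distr N borel (prob_transform N A) = uniform01"
    using distr_cdf_uniform[OF rd atomless] by simp
qed

text \<open>A continuous distribution function may be constant on intervals, so it can be inverted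
  only almost surely; this is why \<open>has_mutual_info_distrD\<close> was stated with almost sure
  inverses.\<close>

lemma has_mutual_info_of_prob_transform:
  assumes N: "prob_space N" and [measurable]: "A \<in> borel_measurable N" "B \<in> borel_measurable N"
    and atomless: "\<And>x. measure (distr N borel A) {x} = 0" "\<And>x. measure (distr N borel B) {x} = 0"
    and I: "has_mutual_info (distr N (borel \<Otimes>\<^sub>M borel)
      (\<lambda>\<omega>. (prob_transform N A \<omega>, prob_transform N B \<omega>))) r"
  shows "has_mutual_info (distr N (borel \<Otimes>\<^sub>M borel) (\<lambda>\<omega>. (A \<omega>, B \<omega>))) r"
proof -
  interpret N: prob_space N by fact
  have rd: "real_distribution (distr N borel A)" "real_distribution (distr N borel B)"
    by (rule N.real_distribution_distr; simp)+
  note [measurable] = cdf_measurable[OF rd(1)] cdf_measurable[OF rd(2)]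
  obtain Q R where [measurable]: "Q \<in> borel_measurable borel" "R \<in> borel_measurable borel"
    and Q: "AE x in distr N borel A. Q (cdf (distr N borel A) x) = x"
    and R: "AE x in distr N borel B. R (cdf (distr N borel B) x) = x"
    using cdf_AE_invertible[OF rd(1) atomless(1)] cdf_AE_invertible[OF rd(2) atomless(2)] by blast
  show ?thesis
  proof (rule has_mutual_info_distrD[where F' = Q and G' = R])
    show "prob_space (distr N (borel \<Otimes>\<^sub>M borel) (\<lambda>\<omega>. (A \<omega>, B \<omega>)))"
      by (rule N.prob_space_distr) measurable
    show "has_mutual_info (distr (distr N (borel \<Otimes>\<^sub>M borel) (\<lambda>\<omega>. (A \<omega>, B \<omega>))) (borel \<Otimes>\<^sub>M borel)
       (\<lambda>(x, y). (cdf (distr N borel A) x, cdf (distr N borel B) y))) r"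
      using I by (subst distr_Pair_map) (auto simp: prob_transform_def)
    show "AE x in distr (distr N (borel \<Otimes>\<^sub>M borel) (\<lambda>\<omega>. (A \<omega>, B \<omega>))) borel fst.
        Q (cdf (distr N borel A) x) = x"
      unfolding distr_Pair_fst[OF assms(2,3)] by (rule Q)
    show "AE x in distr (distr N (borel \<Otimes>\<^sub>M borel) (\<lambda>\<omega>. (A \<omega>, B \<omega>))) borel snd.
        R (cdf (distr N borel B) x) = x"
      unfolding distr_Pair_snd[OF assms(2,3)] by (rule R)
  qed auto
qed

lemma uniform01_pair:
  "uniform01 \<Otimes>\<^sub>M uniform01 =
    density (lborel \<Otimes>\<^sub>M lborel) (\<lambda>z. ennreal (indicator ({0<..<1} \<times> {0<..<1}) z))"
proof -
  have "sigma_finite_measure uniform01"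
    by (rule prob_space_imp_sigma_finite, rule prob_spaceI)
      (simp add: emeasure_density ennreal_indicator)
  then have "uniform01 \<Otimes>\<^sub>M uniform01 = density (lborel \<Otimes>\<^sub>M lborel)
      (\<lambda>(x, y). ennreal (indicator {0<..<1} x) * ennreal (indicator {0<..<1} y))"
    by (intro pair_measure_density) (auto intro: lborel.sigma_finite_measure_axioms)
  then show ?thesis
    by (simp add: split_beta' indicator_times ennreal_mult[symmetric])
qed

lemma AE_uniform01: "AE u in uniform01. u \<in> {0<..<1}"
  by (subst AE_density) (auto simp: indicator_def)

text \<open>The uniform marginals have differential entropy 0, so the information is - H(U, V), the
  integral of c ln c. Since c vanishes almost everywhere outside the unit square, it is also the
  density relative to the product of the two uniform laws, which makes this integral the mutual
  information.\<close>

lemma copula_information_eq_mutual_info: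
  assumes N: "prob_space N" and [measurable]: "A \<in> borel_measurable N" "B \<in> borel_measurable N"
    and atomless: "\<And>x. measure (distr N borel A) {x} = 0" "\<And>x. measure (distr N borel B) {x} = 0"
    and c: "copula_density_finite_entropy N A B c"
  shows "has_mutual_info (distr N (borel \<Otimes>\<^sub>M borel) (\<lambda>\<omega>. (A \<omega>, B \<omega>))) (copula_information N A B)"
proof (rule has_mutual_info_of_prob_transform[OF assms(1-5)])
  interpret information_space N "exp 1"
    using N by (simp add: information_space_def information_space_axioms_def)
  define U V where "U = prob_transform N A" and "V = prob_transform N B"
  let ?L = "lborel \<Otimes>\<^sub>M lborel :: (real \<times> real) measure"
  let ?box = "{0<..<1::real} \<times> {0<..<1::real}"
  note UV = prob_transform_uniform[OF N assms(2) atomless(1), folded U_def]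
    prob_transform_uniform[OF N assms(3) atomless(2), folded V_def]
  note [measurable] = UV(1,3)
  have zero: "entropy (exp 1) lborel W = 0"
    if [measurable]: "W \<in> borel_measurable N" and W: "distr N borel W = uniform01" for W
  proof -
    have "distr N lborel W = uniform01"
      unfolding W[symmetric] by (rule distr_cong) auto
    then have d: "distributed N lborel W (\<lambda>u. ennreal (indicator {0<..<1} u))"
      by (auto simp: distributed_def)
    have "entropy (exp 1) lborel W =
        - (\<integral>u. indicator {0<..<1::real} u * log (exp 1) (indicator {0<..<1} u) \<partial>lborel)"
      by (subst entropy_distr[OF d]) simp_all
    also have "(\<lambda>u::real. indicator {0<..<1} u * log (exp 1) (indicator {0<..<1} u)) = (\<lambda>_. 0)"
      by (auto simp: fun_eq_iff indicator_def)
    finally show ?thesis by simp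
  qed
  from c have fe: "finite_entropy ?L (\<lambda>\<omega>. (U \<omega>, V \<omega>)) c"
    by (simp add: copula_density_finite_entropy_def U_def V_def)
  then have dist: "distributed N ?L (\<lambda>\<omega>. (U \<omega>, V \<omega>)) (\<lambda>z. ennreal (c z))"
    and intc: "integrable ?L (\<lambda>z. c z * ln (c z))" and nn: "\<And>z. 0 \<le> c z"
    by (auto simp: finite_entropy_def log_def space_pair_measure)
  have [measurable]: "c \<in> borel_measurable (borel \<Otimes>\<^sub>M borel)"
    using finite_entropy_measurable[OF fe] by simp
  have info: "copula_information N A B = (\<integral>z. c z * ln (c z) \<partial>?L)"
    using zero[OF UV(1,2)] zero[OF UV(3,4)] entropy_distr[OF dist nn]
    unfolding copula_information_def U_def[symmetric] V_def[symmetric]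
    by (simp add: Let_def log_def)
  let ?\<mu> = "distr N (borel \<Otimes>\<^sub>M borel) (\<lambda>\<omega>. (U \<omega>, V \<omega>))"
  have \<mu>: "?\<mu> = density ?L (\<lambda>z. ennreal (c z))"
    unfolding distributed_distr_eq_density[OF dist, symmetric]
    by (rule distr_cong) (auto cong: sets_pair_measure_cong)
  have "AE \<omega> in N. U \<omega> \<in> {0<..<1}"
    by (rule AE_distrD[OF UV(1)], unfold UV(2), rule AE_uniform01)
  moreover have "AE \<omega> in N. V \<omega> \<in> {0<..<1}"
    by (rule AE_distrD[OF UV(3)], unfold UV(4), rule AE_uniform01)
  ultimately have "AE \<omega> in N. (U \<omega>, V \<omega>) \<in> ?box" by eventually_elim simp
  then have "AE z in ?\<mu>. z \<in> ?box" by (subst AE_distr_iff) auto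
  then have box: "AE z in ?L. 0 < c z \<longrightarrow> z \<in> ?box"
    unfolding \<mu> by (subst (asm) AE_density) auto
  have "?\<mu> = density (uniform01 \<Otimes>\<^sub>M uniform01) (\<lambda>z. ennreal (c z))"
    unfolding \<mu> uniform01_pair
  proof (subst density_density_eq)
    show "density ?L (\<lambda>z. ennreal (c z)) =
        density ?L (\<lambda>z. ennreal (indicator ?box z) * ennreal (c z))"
    proof (rule density_cong)
      show "AE z in ?L. ennreal (c z) = ennreal (indicator ?box z) * ennreal (c z)"
        using box
      proof eventually_elim
        case (elim z)
        then show ?case using nn[of z] by (cases "c z = 0") (auto simp: less_le)
      qed
    qed measurable
  qed measurable
  moreover have "distr ?\<mu> borel fst = uniform01" "distr ?\<mu> borel snd = uniform01"
    by (simp_all add: distr_Pair_fst distr_Pair_snd UV)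
  moreover have "has_bochner_integral ?\<mu> (\<lambda>z. ln (c z)) (copula_information N A B)"
    unfolding \<mu> info
    by (rule has_bochner_integral_density) (use intc nn in \<open>auto intro: has_bochner_integral_integrable\<close>)
  ultimately show "has_mutual_info (distr N (borel \<Otimes>\<^sub>M borel)
      (\<lambda>\<omega>. (prob_transform N A \<omega>, prob_transform N B \<omega>))) (copula_information N A B)"
    unfolding has_mutual_info_def U_def[symmetric] V_def[symmetric]
    by (intro bexI[of _ c] conjI) simp_all
qed

section \<open>Gaussian pairs\<close>

lemma iexp_integrable:
  assumes "prob_space N" and [measurable]: "Z \<in> borel_measurable N"
  shows "integrable N (\<lambda>\<omega>. iexp (Z \<omega>))"
proof -
  interpret prob_space N by fact
  show ?thesis by (rule integrable_const_bound[where B = 1]) auto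
qed

text \<open>The finite measure with density g, divided by \<kappa>, becomes a probability measure,
  and the uniqueness theorem for characteristic functions applies to the law of W under it. The
  weight is the device by which a second variable enters a one-dimensional theorem.\<close>

lemma weighted_Levy_uniqueness:
  assumes N: "prob_space N" and [measurable]: "W \<in> borel_measurable N"
    and g: "integrable N g" "\<And>\<omega>. 0 \<le> g \<omega>" and \<nu>: "real_distribution \<nu>" and \<kappa>: "0 < \<kappa>"
    and char: "\<And>t. (CLINT \<omega>|N. g \<omega> *\<^sub>R iexp (t * W \<omega>)) = \<kappa> *\<^sub>R char \<nu> t"
    and B[measurable]: "B \<in> sets borel"
  shows "(\<integral>\<omega>. g \<omega> * indicator B (W \<omega>) \<partial>N) = \<kappa> * measure \<nu> B"
proof -
  interpret prob_space N by fact
  interpret \<nu>: real_distribution \<nu> by fact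
  have [measurable]: "g \<in> borel_measurable N" using g(1) by simp
  let ?K = "density N (\<lambda>\<omega>. ennreal (g \<omega> / \<kappa>))"
  let ?D = "distr ?K borel W"
  have nn: "0 \<le> g \<omega> / \<kappa>" for \<omega> using g(2) \<kappa> by simp
  \<comment> \<open>At t = 0 the hypothesis on characteristic functions says that g has total mass
    \<kappa>.\<close>
  have "complex_of_real (\<integral>\<omega>. g \<omega> \<partial>N) = complex_of_real \<kappa>"
    using char[of 0] \<nu>.char_zero by (simp add: scaleR_conv_of_real)
  then have "(\<integral>\<omega>. g \<omega> / \<kappa> \<partial>N) = 1" using \<kappa> by (simp only: of_real_eq_iff) simp
  then have "emeasure ?K (space ?K) = 1"
    using nn g(1) by (simp add: emeasure_density nn_integral_eq_integral)
  then have "prob_space ?K" by (rule prob_spaceI)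
  then have rd: "real_distribution ?D"
    by (intro prob_space.real_distribution_distr) auto
  have "char ?D = char \<nu>"
  proof
    fix t
    have "char ?D t = (CLINT \<omega>|N. (g \<omega> / \<kappa>) *\<^sub>R iexp (t * W \<omega>))"
      unfolding char_def by (subst integral_distr, simp, simp, subst integral_density) (auto simp: nn)
    also have "\<dots> = (CLINT \<omega>|N. (1 / \<kappa>) *\<^sub>R (g \<omega> *\<^sub>R iexp (t * W \<omega>)))"
      by (intro Bochner_Integration.integral_cong) auto
    also have "\<dots> = (1 / \<kappa>) *\<^sub>R (\<kappa> *\<^sub>R char \<nu> t)"
      by (simp only: integral_scaleR_right char)
    finally show "char ?D t = char \<nu> t" using \<kappa> by simp
  qed
  then have eq: "?D = \<nu>" using rd \<nu> by (intro Levy_uniqueness)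
  have "measure \<nu> B = (\<integral>x. indicator B x \<partial>?D)" unfolding eq by simp
  also have "\<dots> = (\<integral>\<omega>. (g \<omega> / \<kappa>) * indicator B (W \<omega>) \<partial>N)"
    by (subst integral_distr, simp, simp, subst integral_density) (auto simp: nn)
  also have "\<dots> = (\<integral>\<omega>. g \<omega> * indicator B (W \<omega>) \<partial>N) / \<kappa>" by simp
  finally show ?thesis using \<kappa> by simp
qed

text \<open>One-dimensional uniqueness of characteristic functions is applied first to the finite measures
  with densities \<open>1 + cos (s A)\<close> and \<open>1 + sin (s A)\<close>, which gives the expectation of
  \<open>exp (i s A)\<close> on every event \<open>W \<in> B\<close>, and then to the law of \<open>A\<close> conditioned on
  such an event. This avoids a two-dimensional uniqueness theorem.\<close>

lemma std_normal_pair_independent: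
  fixes A W :: "'a \<Rightarrow> real"
  assumes N: "prob_space N" and [measurable]: "A \<in> borel_measurable N" "W \<in> borel_measurable N"
    and comb: "\<And>a b. a\<^sup>2 + b\<^sup>2 = 1 \<Longrightarrow>
      distr N borel (\<lambda>\<omega>. a * A \<omega> + b * W \<omega>) = std_normal_distribution"
  shows "distr N (borel \<Otimes>\<^sub>M borel) (\<lambda>\<omega>. (A \<omega>, W \<omega>)) =
    std_normal_distribution \<Otimes>\<^sub>M std_normal_distribution"
proof -
  interpret prob_space N by fact
  let ?\<nu> = "std_normal_distribution"
  let ?e = "\<lambda>s::real. exp (- (s\<^sup>2) / 2)"
  interpret \<nu>: real_distribution ?\<nu> by (rule real_dist_normal_dist)
  have joint: "(CLINT \<omega>|N. iexp (s * A \<omega> + t * W \<omega>)) = complex_of_real (?e s * ?e t)" for s t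
  proof (cases "s = 0 \<and> t = 0")
    case True
    then show ?thesis by (simp add: prob_space)
  next
    case False
    \<comment> \<open>For the unit vector (s / v, t / v) the combination is standard normal; its
      characteristic function at v is exp (- v^2 / 2), which factors in s and t.\<close>
    define v where "v = sqrt (s\<^sup>2 + t\<^sup>2)"
    have "0 < s\<^sup>2 + t\<^sup>2" using False by (auto simp: sum_power2_gt_zero_iff)
    then have v: "0 < v" "v\<^sup>2 = s\<^sup>2 + t\<^sup>2" by (auto simp: v_def)
    have "(s / v)\<^sup>2 + (t / v)\<^sup>2 = 1"
      using v(1) by (simp add: power_divide add_divide_distrib[symmetric] v(2)[symmetric])
    from comb[OF this] have "char ?\<nu> v =
        char (distr N borel (\<lambda>\<omega>. s / v * A \<omega> + t / v * W \<omega>)) v" by simp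
    also have "\<dots> = (CLINT \<omega>|N. iexp (v * (s / v * A \<omega> + t / v * W \<omega>)))"
      unfolding char_def by (subst integral_distr) auto
    also have "(\<lambda>\<omega>. v * (s / v * A \<omega> + t / v * W \<omega>)) = (\<lambda>\<omega>. s * A \<omega> + t * W \<omega>)"
      using v(1) by (auto simp: fun_eq_iff field_simps)
    finally have "(CLINT \<omega>|N. iexp (s * A \<omega> + t * W \<omega>)) = complex_of_real (?e v)"
      by (simp add: char_std_normal_distribution)
    also have "?e v = ?e s * ?e t" by (simp add: v(2) mult_exp_exp add_divide_distrib)
    finally show ?thesis .
  qed
  have int: "integrable N (\<lambda>\<omega>. iexp (s * A \<omega> + t * W \<omega>))" for s t
    by (rule iexp_integrable[OF N]) measurable
  have intr: "integrable N (\<lambda>\<omega>. f (s * A \<omega>) * indicator B (W \<omega>))"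
    if "f = (\<lambda>_. 1) \<or> f = sin \<or> f = cos" and [measurable]: "B \<in> sets borel" for s f B
  proof (rule integrable_const_bound[where B = 1])
    show "AE \<omega> in N. norm (f (s * A \<omega>) * indicator B (W \<omega>)) \<le> 1"
      using that(1) by (auto simp: indicator_def)
    have [measurable]: "f \<in> borel_measurable borel" using that(1) by auto
    show "(\<lambda>\<omega>. f (s * A \<omega>) * indicator B (W \<omega>)) \<in> borel_measurable N" by measurable
  qed
  have one: "(\<integral>\<omega>. 1 * indicator B (W \<omega>) \<partial>N) = 1 * measure ?\<nu> B" if "B \<in> sets borel" for B
  proof (rule weighted_Levy_uniqueness[OF N _ _ _ real_dist_normal_dist _ _ that])
    show "(CLINT \<omega>|N. 1 *\<^sub>R iexp (t * W \<omega>)) = 1 *\<^sub>R char ?\<nu> t" for t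
      using joint[of 0 t] by (simp add: char_std_normal_distribution)
  qed auto
  have cosE: "(\<integral>\<omega>. cos (s * A \<omega>) * indicator B (W \<omega>) \<partial>N) = ?e s * measure ?\<nu> B"
    if B: "B \<in> sets borel" for s B
  proof -
    \<comment> \<open>The cosine alone is signed; 1 + cos is a nonnegative weight of mass 1 + exp (-
      s^2 / 2), and \<open>one\<close> removes the added constant afterwards.\<close>
    have "(\<integral>\<omega>. (1 + cos (s * A \<omega>)) * indicator B (W \<omega>) \<partial>N) = (1 + ?e s) * measure ?\<nu> B"
    proof (rule weighted_Levy_uniqueness[OF N _ _ _ real_dist_normal_dist _ _ B])
      show "0 \<le> 1 + cos (s * A \<omega>)" for \<omega> using cos_ge_minus_one[of "s * A \<omega>"] by linarith
      show "0 < 1 + ?e s" by (simp add: add_pos_pos)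
      show "integrable N (\<lambda>\<omega>. 1 + cos (s * A \<omega>))"
        using intr[of cos UNIV s] by (intro Bochner_Integration.integrable_add) auto
      fix t
      \<comment> \<open>Euler's formula splits the weighted exponential into exponentials in t W, s
        A + t W and - s A + t W, whose expectations are known from \<open>joint\<close>.\<close>
      have trig: "(1 + cos x) *\<^sub>R iexp y = iexp y + (1 / 2) * (iexp (x + y) + iexp (- x + y))" for x y
        unfolding cis_conv_exp[symmetric] by (simp add: complex_eq_iff cos_add sin_add cos_diff sin_diff field_simps)
      have "(CLINT \<omega>|N. (1 + cos (s * A \<omega>)) *\<^sub>R iexp (t * W \<omega>)) =
          (CLINT \<omega>|N. iexp (0 * A \<omega> + t * W \<omega>) +
            (1 / 2) * (iexp (s * A \<omega> + t * W \<omega>) + iexp ((- s) * A \<omega> + t * W \<omega>)))"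
        by (intro Bochner_Integration.integral_cong refl)
          (simp only: trig mult_minus_left mult_zero_left add_0)
      also have "\<dots> = (CLINT \<omega>|N. iexp (0 * A \<omega> + t * W \<omega>)) + (1 / 2) *
          ((CLINT \<omega>|N. iexp (s * A \<omega> + t * W \<omega>)) + (CLINT \<omega>|N. iexp ((- s) * A \<omega> + t * W \<omega>)))"
        using int by (simp only: Bochner_Integration.integral_add integral_mult_right_zero
          Bochner_Integration.integrable_add integrable_mult_right)
      also have "\<dots> = (1 + ?e s) *\<^sub>R char ?\<nu> t"
        unfolding joint by (simp add: char_std_normal_distribution scaleR_conv_of_real algebra_simps)
      finally show "(CLINT \<omega>|N. (1 + cos (s * A \<omega>)) *\<^sub>R iexp (t * W \<omega>)) =
        (1 + ?e s) *\<^sub>R char ?\<nu> t" .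
    qed simp
    then show ?thesis
      using intr[of "\<lambda>_. 1" B s] intr[of cos B s] one[OF B] B by (simp add: distrib_right)
  qed
  have sinE: "(\<integral>\<omega>. sin (s * A \<omega>) * indicator B (W \<omega>) \<partial>N) = 0" if B: "B \<in> sets borel" for s B
  proof -
    \<comment> \<open>The contributions of s and - s cancel because exp (- s^2 / 2) is even, so this
      weight has mass 1.\<close>
    have "(\<integral>\<omega>. (1 + sin (s * A \<omega>)) * indicator B (W \<omega>) \<partial>N) = 1 * measure ?\<nu> B"
    proof (rule weighted_Levy_uniqueness[OF N _ _ _ real_dist_normal_dist _ _ B])
      show "0 \<le> 1 + sin (s * A \<omega>)" for \<omega> using sin_ge_minus_one[of "s * A \<omega>"] by linarith
      show "integrable N (\<lambda>\<omega>. 1 + sin (s * A \<omega>))"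
        using intr[of sin UNIV s] by (intro Bochner_Integration.integrable_add) auto
      fix t
      have trig: "(1 + sin x) *\<^sub>R iexp y = iexp y + (- \<i> / 2) * (iexp (x + y) - iexp (- x + y))" for x y
        unfolding cis_conv_exp[symmetric] by (simp add: complex_eq_iff cos_add sin_add cos_diff sin_diff field_simps)
      have "(CLINT \<omega>|N. (1 + sin (s * A \<omega>)) *\<^sub>R iexp (t * W \<omega>)) =
          (CLINT \<omega>|N. iexp (0 * A \<omega> + t * W \<omega>) +
            (- \<i> / 2) * (iexp (s * A \<omega> + t * W \<omega>) - iexp ((- s) * A \<omega> + t * W \<omega>)))"
        by (intro Bochner_Integration.integral_cong refl)
          (simp only: trig mult_minus_left mult_zero_left add_0)
      also have "\<dots> = (CLINT \<omega>|N. iexp (0 * A \<omega> + t * W \<omega>)) + (- \<i> / 2) *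
          ((CLINT \<omega>|N. iexp (s * A \<omega> + t * W \<omega>)) - (CLINT \<omega>|N. iexp ((- s) * A \<omega> + t * W \<omega>)))"
        using int by (simp only: Bochner_Integration.integral_add Bochner_Integration.integral_diff
          integral_mult_right_zero Bochner_Integration.integrable_diff integrable_mult_right)
      also have "\<dots> = 1 *\<^sub>R char ?\<nu> t"
        unfolding joint by (simp add: char_std_normal_distribution)
      finally show "(CLINT \<omega>|N. (1 + sin (s * A \<omega>)) *\<^sub>R iexp (t * W \<omega>)) = 1 *\<^sub>R char ?\<nu> t" .
    qed auto
    then show ?thesis
      using intr[of "\<lambda>_. 1" B s] intr[of sin B s] one[OF B] B by (simp add: distrib_right)
  qed
  have prod: "measure N {\<omega> \<in> space N. A \<omega> \<in> C \<and> W \<omega> \<in> B} = measure ?\<nu> B * measure ?\<nu> C"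
    if [measurable]: "B \<in> sets borel" "C \<in> sets borel" for B C
  proof -
    have ind: "(\<integral>\<omega>. indicator B (W \<omega>) * indicator C (A \<omega>) \<partial>N) =
        measure N {\<omega> \<in> space N. A \<omega> \<in> C \<and> W \<omega> \<in> B}"
    proof -
      have "(\<integral>\<omega>. indicator B (W \<omega>) * indicator C (A \<omega>) \<partial>N) =
          (\<integral>\<omega>. indicator {\<omega> \<in> space N. A \<omega> \<in> C \<and> W \<omega> \<in> B} \<omega> \<partial>N :: real)"
        by (intro Bochner_Integration.integral_cong) (auto simp: indicator_def)
      then show ?thesis by simp
    qed
    have W1: "(\<integral>\<omega>. indicator B (W \<omega>) \<partial>N) = measure ?\<nu> B" using one[OF that(1)] by simp
    show ?thesis
    proof (cases "measure ?\<nu> B = 0")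
      \<comment> \<open>A null event cannot be conditioned on; here the joint probability is
        dominated by that of W in B.\<close>
      case True
      have "(\<integral>\<omega>. indicator B (W \<omega>) * indicator C (A \<omega>) \<partial>N) \<le> (\<integral>\<omega>. indicator B (W \<omega>) \<partial>N :: real)"
        by (intro integral_mono integrable_const_bound[where B = 1]) (auto simp: indicator_def)
      then show ?thesis using True W1 ind measure_nonneg[of N "{\<omega> \<in> space N. A \<omega> \<in> C \<and> W \<omega> \<in> B}"]
        by simp
    next
      case False
      have "(\<integral>\<omega>. indicator B (W \<omega>) * indicator C (A \<omega>) \<partial>N) = measure ?\<nu> B * measure ?\<nu> C"
      \<comment> \<open>The roles are exchanged: the weight is now the indicator of W in B and the
        law to be identified is that of A. \<open>cosE\<close> and \<open>sinE\<close> are the real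
        and imaginary parts of the required characteristic function.\<close>
      proof (rule weighted_Levy_uniqueness[OF N _ _ _ real_dist_normal_dist _ _ that(2)])
        show "0 < measure ?\<nu> B" using False measure_nonneg[of ?\<nu> B] by linarith
        show "integrable N (\<lambda>\<omega>. indicat_real B (W \<omega>))" using intr[of "\<lambda>_. 1" B 0] by simp
        fix s
        have trig: "indicator B y *\<^sub>R iexp x = complex_of_real (cos x * indicator B y) +
            \<i> * complex_of_real (sin x * indicator B y)" for x y
          unfolding cis_conv_exp[symmetric] by (simp add: complex_eq_iff)
        have "(CLINT \<omega>|N. indicator B (W \<omega>) *\<^sub>R iexp (s * A \<omega>)) =
            (CLINT \<omega>|N. complex_of_real (cos (s * A \<omega>) * indicator B (W \<omega>)) +
              \<i> * complex_of_real (sin (s * A \<omega>) * indicator B (W \<omega>)))"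
          by (intro Bochner_Integration.integral_cong refl) (simp only: trig)
        also have "\<dots> = complex_of_real (\<integral>\<omega>. cos (s * A \<omega>) * indicator B (W \<omega>) \<partial>N) +
              \<i> * complex_of_real (\<integral>\<omega>. sin (s * A \<omega>) * indicator B (W \<omega>) \<partial>N)"
          using intr[of cos B s] intr[of sin B s]
          by (simp only: Bochner_Integration.integral_add integral_mult_right_zero integral_complex_of_real
            complex_of_real_integrable_eq integrable_mult_right that simp_thms)
        also have "\<dots> = measure ?\<nu> B *\<^sub>R char ?\<nu> s"
          unfolding cosE[OF that(1)] sinE[OF that(1)]
          by (simp add: char_std_normal_distribution scaleR_conv_of_real)
        finally show "(CLINT \<omega>|N. indicator B (W \<omega>) *\<^sub>R iexp (s * A \<omega>)) = measure ?\<nu> B *\<^sub>R char ?\<nu> s" .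
      qed auto
      then show ?thesis using ind by simp
    qed
  qed
  show ?thesis
  proof (rule pair_measure_eqI[symmetric])
    fix C B assume "C \<in> sets ?\<nu>" "B \<in> sets ?\<nu>"
    then have [measurable]: "C \<in> sets borel" "B \<in> sets borel" by auto
    have "emeasure (distr N (borel \<Otimes>\<^sub>M borel) (\<lambda>\<omega>. (A \<omega>, W \<omega>))) (C \<times> B) =
        emeasure N {\<omega> \<in> space N. A \<omega> \<in> C \<and> W \<omega> \<in> B}"
      by (subst emeasure_distr) (auto intro!: arg_cong2[where f = emeasure])
    then show "emeasure ?\<nu> C * emeasure ?\<nu> B =
        emeasure (distr N (borel \<Otimes>\<^sub>M borel) (\<lambda>\<omega>. (A \<omega>, W \<omega>))) (C \<times> B)"
      using prod[of B C]
      by (simp add: emeasure_eq_measure \<nu>.emeasure_eq_measure ennreal_mult[symmetric] mult.commute)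
  qed (auto intro: \<nu>.sigma_finite_measure_axioms cong: sets_pair_measure_cong)
qed

lemma std_normal_law_moments:
  assumes N: "prob_space N" and [measurable]: "Z \<in> borel_measurable N"
    and law: "distr N borel Z = std_normal_distribution"
  shows "has_bochner_integral N Z 0" "has_bochner_integral N (\<lambda>\<omega>. (Z \<omega>)\<^sup>2) 1"
proof -
  have "has_bochner_integral (distr N borel Z) (\<lambda>x. x ^ 1) 0"
    unfolding law has_bochner_integral_iff
    using integrable_std_normal_distribution_moment[of 1] integral_std_normal_distribution_moment_odd[of 1]
    by simp
  then show "has_bochner_integral N Z 0"
    by (simp add: has_bochner_integral_iff integrable_distr_eq integral_distr)
  have "has_bochner_integral (distr N borel Z) (\<lambda>x. x\<^sup>2) 1"
    unfolding law has_bochner_integral_iff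
    using integrable_std_normal_distribution_moment[of 2] std_normal_distribution_even_moments(1)[of 1]
    by simp
  then show "has_bochner_integral N (\<lambda>\<omega>. (Z \<omega>)\<^sup>2) 1"
    by (simp add: has_bochner_integral_iff integrable_distr_eq integral_distr)
qed

text \<open>Given the first coordinate a, the second is normal with mean r a and standard deviation
  s; dividing by the standard normal density expresses this relative to the standard normal law
  instead of Lebesgue measure.\<close>

lemma std_normal_pair_conditional_density:
  fixes r s :: real
  assumes s: "0 < s"
  shows "distr (std_normal_distribution \<Otimes>\<^sub>M std_normal_distribution) (borel \<Otimes>\<^sub>M borel)
      (\<lambda>(a, w). (a, r * a + s * w)) =
    density (std_normal_distribution \<Otimes>\<^sub>M std_normal_distribution)
      (\<lambda>z. ennreal (normal_density (r * fst z) s (snd z) / std_normal_density (snd z)))"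
    (is "?D = density ?P ?h")
proof (rule measure_eqI)
  let ?\<nu> = "std_normal_distribution"
  interpret \<nu>: real_distribution ?\<nu> by (rule real_dist_normal_dist)
  interpret pair_sigma_finite ?\<nu> ?\<nu> ..
  show "sets ?D = sets (density ?P ?h)" by (auto cong: sets_pair_measure_cong)
  have [measurable]: "?h \<in> borel_measurable (borel \<Otimes>\<^sub>M borel)"
    unfolding normal_density_def by measurable
  fix X assume "X \<in> sets ?D"
  then have X[measurable]: "X \<in> sets (borel \<Otimes>\<^sub>M borel)" by simp
  have "emeasure ?D X = (\<integral>\<^sup>+z. indicator X z \<partial>?D)" by simp
  also have "\<dots> = (\<integral>\<^sup>+z. indicator X (fst z, r * fst z + s * snd z) \<partial>?P)"
    by (subst nn_integral_distr) (auto simp: split_beta')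
  also have "\<dots> = (\<integral>\<^sup>+a. \<integral>\<^sup>+w. indicator X (a, r * a + s * w) \<partial>?\<nu> \<partial>?\<nu>)"
    by (subst \<nu>.nn_integral_fst[symmetric]) auto
  also have "\<dots> = (\<integral>\<^sup>+a. \<integral>\<^sup>+b. ?h (a, b) * indicator X (a, b) \<partial>?\<nu> \<partial>?\<nu>)"
  proof (rule nn_integral_cong)
    fix a :: real
    have "(\<integral>\<^sup>+b. ?h (a, b) * indicator X (a, b) \<partial>?\<nu>) =
        (\<integral>\<^sup>+b. ennreal (std_normal_density b) * (?h (a, b) * indicator X (a, b)) \<partial>lborel)"
      by (rule nn_integral_density) measurable
    also have "\<dots> = (\<integral>\<^sup>+b. ennreal (normal_density (r * a) s b) * indicator X (a, b) \<partial>lborel)"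
    proof (rule nn_integral_cong)
      fix b
      have "0 < std_normal_density b" by (simp add: normal_density_pos)
      then show "ennreal (std_normal_density b) * (?h (a, b) * indicator X (a, b)) =
          ennreal (normal_density (r * a) s b) * indicator X (a, b)"
        by (simp add: mult.assoc[symmetric] ennreal_mult[symmetric])
    qed
    \<comment> \<open>Substitution b = r a + s w; the factor s cancels the 1 / s of the normal
      density.\<close>
    also have "\<dots> = ennreal \<bar>s\<bar> * (\<integral>\<^sup>+w. ennreal (normal_density (r * a) s (r * a + s * w)) *
        indicator X (a, r * a + s * w) \<partial>lborel)"
      using s by (intro nn_integral_real_affine) (auto simp: normal_density_def)
    also have "\<dots> = (\<integral>\<^sup>+w. ennreal (std_normal_density w) * indicator X (a, r * a + s * w) \<partial>lborel)"
    proof (subst nn_integral_cmult[symmetric])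
      have "\<bar>s\<bar> * normal_density (r * a) s (r * a + s * w) = std_normal_density w" for w
        using s by (simp add: normal_density_def real_sqrt_mult power_mult_distrib)
      then have "ennreal \<bar>s\<bar> * ennreal (normal_density (r * a) s (r * a + s * w)) =
          ennreal (std_normal_density w)" for w
        by (simp add: ennreal_mult[symmetric])
      then show "(\<integral>\<^sup>+w. ennreal \<bar>s\<bar> * (ennreal (normal_density (r * a) s (r * a + s * w)) *
          indicator X (a, r * a + s * w)) \<partial>lborel) =
        (\<integral>\<^sup>+w. ennreal (std_normal_density w) * indicator X (a, r * a + s * w) \<partial>lborel)"
        by (simp add: mult.assoc[symmetric])
    qed (auto simp: normal_density_def)
    also have "\<dots> = (\<integral>\<^sup>+w. indicator X (a, r * a + s * w) \<partial>?\<nu>)"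
      by (rule nn_integral_density[symmetric]) measurable
    finally show "(\<integral>\<^sup>+w. indicator X (a, r * a + s * w) \<partial>?\<nu>) =
      (\<integral>\<^sup>+b. ?h (a, b) * indicator X (a, b) \<partial>?\<nu>)" ..
  qed
  also have "\<dots> = (\<integral>\<^sup>+z. ?h z * indicator X z \<partial>?P)"
    by (subst \<nu>.nn_integral_fst) (auto cong: measurable_cong_sets sets_pair_measure_cong)
  also have "\<dots> = emeasure (density ?P ?h) X"
  proof (rule emeasure_density[symmetric])
    show "?h \<in> borel_measurable ?P" unfolding normal_density_def by measurable
  qed (auto cong: sets_pair_measure_cong)
  finally show "emeasure ?D X = emeasure (density ?P ?h) X" .
qed

text \<open>\<open>comb\<close> expresses that A, B are jointly standard normal with correlation r,
  through the combinations of variance 1. The standardised residual W = (B - r A) / s of the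
  regression of B on A is standard normal and independent of A. Then ln h = - ln s - W^2 / 2 + B^2 /
  2, and since both squares have expectation 1, only - ln s remains.\<close>

lemma standardized_gaussian_pair_mutual_info:
  fixes A B :: "'a \<Rightarrow> real"
  assumes N: "prob_space N" and [measurable]: "A \<in> borel_measurable N" "B \<in> borel_measurable N"
    and r: "r\<^sup>2 < 1"
    and comb: "\<And>a b. a\<^sup>2 + 2 * a * b * r + b\<^sup>2 = 1 \<Longrightarrow>
      distr N borel (\<lambda>\<omega>. a * A \<omega> + b * B \<omega>) = std_normal_distribution"
  shows "has_mutual_info (distr N (borel \<Otimes>\<^sub>M borel) (\<lambda>\<omega>. (A \<omega>, B \<omega>))) (- (1 / 2) * ln (1 - r\<^sup>2))"
proof -
  let ?\<nu> = "std_normal_distribution"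
  define s where "s = sqrt (1 - r\<^sup>2)"
  have s: "0 < s" "s\<^sup>2 = 1 - r\<^sup>2" using r by (auto simp: s_def)
  define W where "W \<omega> = (B \<omega> - r * A \<omega>) / s" for \<omega>
  have [measurable]: "W \<in> borel_measurable N" unfolding W_def by measurable
  have B_eq: "B \<omega> = r * A \<omega> + s * W \<omega>" for \<omega> using s(1) by (simp add: W_def)
  have combW: "distr N borel (\<lambda>\<omega>. a * A \<omega> + b * W \<omega>) = ?\<nu>" if ab: "a\<^sup>2 + b\<^sup>2 = 1" for a b
  proof -
    \<comment> \<open>The coefficients rewrite a A + b W in terms of A and B; the identity checks
      that the variance is still 1.\<close>
    have "(a - b * r / s)\<^sup>2 + 2 * (a - b * r / s) * (b / s) * r + (b / s)\<^sup>2 =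
        a\<^sup>2 + b\<^sup>2 * (1 - r\<^sup>2) / s\<^sup>2"
      using s(1) by (simp add: field_simps power2_eq_square)
    also have "\<dots> = 1" using ab s by (simp add: s(2)[symmetric])
    finally have "distr N borel (\<lambda>\<omega>. (a - b * r / s) * A \<omega> + (b / s) * B \<omega>) = ?\<nu>" by (rule comb)
    also have "(\<lambda>\<omega>. (a - b * r / s) * A \<omega> + (b / s) * B \<omega>) = (\<lambda>\<omega>. a * A \<omega> + b * W \<omega>)"
      using s(1) by (auto simp: fun_eq_iff W_def field_simps)
    finally show ?thesis .
  qed
  have lawA: "distr N borel A = ?\<nu>" and lawB: "distr N borel B = ?\<nu>"
    using comb[of 1 0] comb[of 0 1] by simp_all
  have lawW: "distr N borel W = ?\<nu>" using combW[of 0 1] by simp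
  let ?\<mu> = "distr N (borel \<Otimes>\<^sub>M borel) (\<lambda>\<omega>. (A \<omega>, B \<omega>))"
  define h where "h z = normal_density (r * fst z) s (snd z) / std_normal_density (snd z)" for z
  have h[measurable]: "h \<in> borel_measurable (borel \<Otimes>\<^sub>M borel)"
    unfolding h_def normal_density_def by measurable
  have "?\<mu> = distr (distr N (borel \<Otimes>\<^sub>M borel) (\<lambda>\<omega>. (A \<omega>, W \<omega>))) (borel \<Otimes>\<^sub>M borel)
      (\<lambda>(a, w). (a, r * a + s * w))"
    by (subst distr_distr) (auto simp: comp_def B_eq)
  also have "\<dots> = density (?\<nu> \<Otimes>\<^sub>M ?\<nu>) (\<lambda>z. ennreal (h z))"
    unfolding h_def
    by (subst std_normal_pair_independent[OF N]) (auto simp: combW std_normal_pair_conditional_density[OF s(1)])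
  finally have \<mu>: "?\<mu> = density (?\<nu> \<Otimes>\<^sub>M ?\<nu>) (\<lambda>z. ennreal (h z))" .
  have ln_h: "ln (h (A \<omega>, B \<omega>)) = - ln s - (1 / 2) * (W \<omega>)\<^sup>2 + (1 / 2) * (B \<omega>)\<^sup>2" for \<omega>
  proof -
    have "(B \<omega> - r * A \<omega>)\<^sup>2 = s\<^sup>2 * (W \<omega>)\<^sup>2" by (simp add: B_eq power_mult_distrib)
    then have "h (A \<omega>, B \<omega>) = exp (- (W \<omega>)\<^sup>2 / 2) / (s * exp (- (B \<omega>)\<^sup>2 / 2))"
      using s(1) by (simp add: h_def normal_density_def real_sqrt_mult)
    also have "ln \<dots> = - ln s - (1 / 2) * (W \<omega>)\<^sup>2 + (1 / 2) * (B \<omega>)\<^sup>2"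
      using s(1) by (simp add: ln_div ln_mult)
    finally show ?thesis .
  qed
  have int: "has_bochner_integral N
      (\<lambda>\<omega>. - ln s - (1 / 2) * (W \<omega>)\<^sup>2 + (1 / 2) * (B \<omega>)\<^sup>2) (- ln s - (1 / 2) * 1 + (1 / 2) * 1)"
  proof (intro has_bochner_integral_add has_bochner_integral_diff has_bochner_integral_mult_right
      std_normal_law_moments(2)[OF N _ lawW] std_normal_law_moments(2)[OF N _ lawB])
    interpret prob_space N by fact
    show "has_bochner_integral N (\<lambda>\<omega>. - ln s) (- ln s)"
      by (simp add: has_bochner_integral_iff prob_space)
  qed simp_all
  have val: "- ln s - (1 / 2) * 1 + (1 / 2) * 1 = - (1 / 2) * ln (1 - r\<^sup>2)"
    using r by (simp add: s_def ln_sqrt)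
  have "has_bochner_integral N (\<lambda>\<omega>. ln (h (A \<omega>, B \<omega>))) (- (1 / 2) * ln (1 - r\<^sup>2))"
    using int unfolding val ln_h .
  then have "has_bochner_integral ?\<mu> (\<lambda>z. ln (h z)) (- (1 / 2) * ln (1 - r\<^sup>2))"
    by (intro has_bochner_integral_distr) measurable
  moreover have "distr ?\<mu> borel fst = ?\<nu>" "distr ?\<mu> borel snd = ?\<nu>"
    unfolding distr_Pair_fst[OF assms(2,3)] distr_Pair_snd[OF assms(2,3)] by (fact lawA lawB)+
  ultimately show ?thesis
    unfolding has_mutual_info_def using \<mu> h by (intro bexI[of _ h]) auto
qed

section \<open>Gaussian pairs with arbitrary mean and covariance\<close>

lemma has_normal_law_standardize:
  assumes N: "prob_space N" and law: "has_normal_law N Z m v" and v: "0 < v"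
  shows "distr N borel (\<lambda>\<omega>. (Z \<omega> - m) / sqrt v) = std_normal_distribution"
proof -
  interpret prob_space N by fact
  from law v have [measurable]: "Z \<in> borel_measurable N"
    and d: "distr N borel Z = density lborel (\<lambda>x. ennreal (normal_density m (sqrt v) x))"
    by (auto simp: has_normal_law_def)
  have "distr N lborel Z = distr N borel Z" by (rule distr_cong) auto
  then have "distributed N lborel Z (normal_density m (sqrt v))"
    using d by (simp add: distributed_def)
  then have "distributed N lborel (\<lambda>\<omega>. (Z \<omega> - m) / sqrt v) std_normal_density"
    using v by (subst (asm) normal_standard_normal_convert) auto
  then have "distr N lborel (\<lambda>\<omega>. (Z \<omega> - m) / sqrt v) = std_normal_distribution"
    by (simp add: distributed_def)
  then show ?thesis by (subst distr_cong[where L = lborel and K = N]) auto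
qed

lemma has_normal_law_degenerate:
  assumes law: "has_normal_law N Z m 0"
  shows "AE \<omega> in N. Z \<omega> = m"
proof -
  from law have [measurable]: "Z \<in> borel_measurable N" and d: "distr N borel Z = return borel m"
    by (auto simp: has_normal_law_def)
  have "AE x in distr N borel Z. x = m" unfolding d by (simp add: AE_return)
  then show ?thesis by (rule AE_distrD[rotated]) simp
qed

lemma sum_two_points:
  fixes f :: "'i \<Rightarrow> real"
  assumes "finite I" "l \<in> I" "m \<in> I" "l \<noteq> m"
  shows "(\<Sum>i\<in>I. (if i = l then a else if i = m then b else 0) * f i) = a * f l + b * f m"
proof -
  have "(\<Sum>i\<in>I. (if i = l then a else if i = m then b else 0) * f i) =
      (\<Sum>i\<in>I. (if i = l then a * f l else 0) + (if i = m then b * f m else 0))"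
    using assms(4) by (intro sum.cong) auto
  then show ?thesis using assms by (simp add: sum.distrib)
qed

lemma gaussian_vector_pair:
  assumes G: "gaussian_vector N I Z \<mu> \<Sigma>" and I: "finite I" "l \<in> I" "m \<in> I" "l \<noteq> m"
  shows "has_normal_law N (\<lambda>\<omega>. a * Z l \<omega> + b * Z m \<omega>) (a * \<mu> l + b * \<mu> m)
    (a\<^sup>2 * \<Sigma> l l + 2 * a * b * \<Sigma> l m + b\<^sup>2 * \<Sigma> m m)"
proof -
  define c where "c i = (if i = l then a else if i = m then b else 0)" for i
  note two = sum_two_points[OF I, of a b, folded c_def]
  have "(\<Sum>i\<in>I. \<Sum>j\<in>I. c i * c j * \<Sigma> i j) = (\<Sum>i\<in>I. c i * (\<Sum>j\<in>I. c j * \<Sigma> i j))"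
    by (simp add: sum_distrib_left mult.assoc)
  also have "\<dots> = a\<^sup>2 * \<Sigma> l l + 2 * a * b * \<Sigma> l m + b\<^sup>2 * \<Sigma> m m"
    using G I unfolding two gaussian_vector_def by (simp add: power2_eq_square algebra_simps)
  finally have q: "(\<Sum>i\<in>I. \<Sum>j\<in>I. c i * c j * \<Sigma> i j) =
    a\<^sup>2 * \<Sigma> l l + 2 * a * b * \<Sigma> l m + b\<^sup>2 * \<Sigma> m m" .
  have "has_normal_law N (\<lambda>\<omega>. \<Sum>i\<in>I. c i * Z i \<omega>) (\<Sum>i\<in>I. c i * \<mu> i)
      (\<Sum>i\<in>I. \<Sum>j\<in>I. c i * c j * \<Sigma> i j)"
    using G unfolding gaussian_vector_def by blast
  then show ?thesis unfolding q two .
qed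

text \<open>Nondegeneracy enters with constant g for positive variances and with affine g for
  \<rho>^2 < 1; then the pair can be standardised. The correlation needs its own argument because
  the definition of a Gaussian vector fixes the laws of linear combinations and says nothing
  directly about expectations of products.\<close>

lemma
  fixes Z :: "nat \<Rightarrow> 'a \<Rightarrow> real"
  assumes N: "prob_space N" and G: "gaussian_vector N I Z \<mu> \<Sigma>"
    and I: "finite I" "l \<in> I" "m \<in> I" "l \<noteq> m"
    and nondegenerate:
      "\<And>g. g \<in> borel_measurable borel \<Longrightarrow> \<not> (AE \<omega> in N. Z m \<omega> = g (Z l \<omega>))"
      "\<And>g. g \<in> borel_measurable borel \<Longrightarrow> \<not> (AE \<omega> in N. Z l \<omega> = g (Z m \<omega>))"
  defines "\<rho> \<equiv> \<Sigma> l m / (sqrt (\<Sigma> l l) * sqrt (\<Sigma> m m))"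
  shows gaussian_vector_mutual_info: "has_mutual_info
      (distr N (borel \<Otimes>\<^sub>M borel) (\<lambda>\<omega>. (Z l \<omega>, Z m \<omega>))) (- (1 / 2) * ln (1 - \<rho>\<^sup>2))"
    and gaussian_vector_correlation: "correlation N (Z l) (Z m) = \<rho>"
proof -
  interpret prob_space N by fact
  note pair = gaussian_vector_pair[OF G I]
  have Zl: "has_normal_law N (Z l) (\<mu> l) (\<Sigma> l l)" using pair[of 1 0] by simp
  have Zm: "has_normal_law N (Z m) (\<mu> m) (\<Sigma> m m)" using pair[of 0 1] by simp
  have [measurable]: "Z l \<in> borel_measurable N" "Z m \<in> borel_measurable N"
    using Zl Zm by (auto simp: has_normal_law_def)
  have "0 \<le> \<Sigma> l l" "0 \<le> \<Sigma> m m" using Zl Zm by (auto simp: has_normal_law_def)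
  moreover have "\<Sigma> l l \<noteq> 0"
    using has_normal_law_degenerate[of N "Z l" "\<mu> l"] Zl nondegenerate(2)[of "\<lambda>_. \<mu> l"] by auto
  moreover have "\<Sigma> m m \<noteq> 0"
    using has_normal_law_degenerate[of N "Z m" "\<mu> m"] Zm nondegenerate(1)[of "\<lambda>_. \<mu> m"] by auto
  ultimately have pos: "0 < \<Sigma> l l" "0 < \<Sigma> m m" by auto
  define p q where "p = sqrt (\<Sigma> l l)" and "q = sqrt (\<Sigma> m m)"
  have pq: "0 < p" "0 < q" "\<Sigma> l l = p\<^sup>2" "\<Sigma> m m = q\<^sup>2" "\<Sigma> l m = \<rho> * p * q"
    using pos by (auto simp: p_def q_def \<rho>_def)
  have r: "\<rho>\<^sup>2 < 1"
  proof -
    \<comment> \<open>This is the variance of Z m minus its regression on Z l. Being a variance it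
      is nonnegative, and if it were 0, Z m would be an affine function of Z l.\<close>
    have "(- (\<rho> * q / p))\<^sup>2 * \<Sigma> l l + 2 * (- (\<rho> * q / p)) * 1 * \<Sigma> l m + 1\<^sup>2 * \<Sigma> m m =
        q\<^sup>2 * (1 - \<rho>\<^sup>2)"
      unfolding pq(3-5) using pq(1,2) by (simp add: field_simps power2_eq_square)
    then have law: "has_normal_law N (\<lambda>\<omega>. - (\<rho> * q / p) * Z l \<omega> + 1 * Z m \<omega>)
        (- (\<rho> * q / p) * \<mu> l + 1 * \<mu> m) (q\<^sup>2 * (1 - \<rho>\<^sup>2))"
      using pair[of "- (\<rho> * q / p)" 1] by simp
    then have "0 \<le> q\<^sup>2 * (1 - \<rho>\<^sup>2)" by (simp add: has_normal_law_def)
    moreover have "q\<^sup>2 * (1 - \<rho>\<^sup>2) \<noteq> 0"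
    proof
      assume q0: "q\<^sup>2 * (1 - \<rho>\<^sup>2) = 0"
      have "AE \<omega> in N. - (\<rho> * q / p) * Z l \<omega> + 1 * Z m \<omega> = - (\<rho> * q / p) * \<mu> l + 1 * \<mu> m"
        using law unfolding q0 by (rule has_normal_law_degenerate)
      then have "AE \<omega> in N. Z m \<omega> = (\<lambda>x. \<rho> * q / p * (x - \<mu> l) + \<mu> m) (Z l \<omega>)"
        by eventually_elim (simp add: algebra_simps)
      moreover have "(\<lambda>x. \<rho> * q / p * (x - \<mu> l) + \<mu> m) \<in> borel_measurable borel" by measurable
      ultimately show False using nondegenerate(1) by blast
    qed
    ultimately have "0 < q\<^sup>2 * (1 - \<rho>\<^sup>2)" by linarith
    then show ?thesis using pq(2) by (simp add: zero_less_mult_iff)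
  qed
  define A where "A \<omega> = (Z l \<omega> - \<mu> l) / p" for \<omega>
  define B where "B \<omega> = (Z m \<omega> - \<mu> m) / q" for \<omega>
  have [measurable]: "A \<in> borel_measurable N" "B \<in> borel_measurable N"
    unfolding A_def B_def by measurable
  have comb: "distr N borel (\<lambda>\<omega>. (a * A \<omega> + b * B \<omega>) / sqrt v) = std_normal_distribution"
    if v: "v = a\<^sup>2 + 2 * a * b * \<rho> + b\<^sup>2" "0 < v" for a b v
  proof -
    have "(a / p)\<^sup>2 * \<Sigma> l l + 2 * (a / p) * (b / q) * \<Sigma> l m + (b / q)\<^sup>2 * \<Sigma> m m = v"
      unfolding pq(3-5) v(1) using pq(1,2) by (simp add: field_simps power2_eq_square)
    then have law: "has_normal_law N (\<lambda>\<omega>. a / p * Z l \<omega> + b / q * Z m \<omega>)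
        (a / p * \<mu> l + b / q * \<mu> m) v"
      using pair[of "a / p" "b / q"] by simp
    have "(\<lambda>\<omega>. (a * A \<omega> + b * B \<omega>) / sqrt v) =
        (\<lambda>\<omega>. ((a / p * Z l \<omega> + b / q * Z m \<omega>) - (a / p * \<mu> l + b / q * \<mu> m)) / sqrt v)"
      by (simp add: A_def B_def fun_eq_iff diff_divide_distrib add_divide_distrib right_diff_distrib)
    then show ?thesis using has_normal_law_standardize[OF N law v(2)] by simp
  qed
  have "has_mutual_info (distr N (borel \<Otimes>\<^sub>M borel) (\<lambda>\<omega>. (A \<omega>, B \<omega>))) (- (1 / 2) * ln (1 - \<rho>\<^sup>2))"
  proof (rule standardized_gaussian_pair_mutual_info[OF N _ _ r])
    show "distr N borel (\<lambda>\<omega>. a * A \<omega> + b * B \<omega>) = std_normal_distribution"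
      if "a\<^sup>2 + 2 * a * b * \<rho> + b\<^sup>2 = 1" for a b
      using comb[of 1 a b] that by simp
  qed measurable
  then have "has_mutual_info (distr (distr N (borel \<Otimes>\<^sub>M borel) (\<lambda>\<omega>. (Z l \<omega>, Z m \<omega>))) (borel \<Otimes>\<^sub>M borel)
      (\<lambda>(x, y). ((x - \<mu> l) / p, (y - \<mu> m) / q))) (- (1 / 2) * ln (1 - \<rho>\<^sup>2))"
    by (subst distr_Pair_map) (auto simp: A_def[abs_def] B_def[abs_def])
  then show "has_mutual_info
      (distr N (borel \<Otimes>\<^sub>M borel) (\<lambda>\<omega>. (Z l \<omega>, Z m \<omega>))) (- (1 / 2) * ln (1 - \<rho>\<^sup>2))"
    by (rule has_mutual_info_distrD[where F' = "\<lambda>u. p * u + \<mu> l" and G' = "\<lambda>u. q * u + \<mu> m", rotated -1])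
       (use pq in \<open>auto intro!: prob_space_distr\<close>)
  have lawA: "distr N borel A = std_normal_distribution" and lawB: "distr N borel B = std_normal_distribution"
    using comb[of 1 1 0] comb[of 1 0 1] by simp_all
  note A = std_normal_law_moments[OF N _ lawA] and B = std_normal_law_moments[OF N _ lawB]
  \<comment> \<open>Polarisation: 2 + 2 \<rho> is the variance of A + B, so the expectation of A B
    follows from the second moments of A, B and the normalised sum.\<close>
  define v where "v = 2 + 2 * \<rho>"
  have v: "0 < v" using r abs_square_less_1[of \<rho>] by (simp add: v_def)
  have "distr N borel (\<lambda>\<omega>. (1 * A \<omega> + 1 * B \<omega>) / sqrt v) = std_normal_distribution"
    using v by (intro comb) (auto simp: v_def)
  then have "has_bochner_integral N (\<lambda>\<omega>. ((1 * A \<omega> + 1 * B \<omega>) / sqrt v)\<^sup>2) 1"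
    by (intro std_normal_law_moments[OF N]) auto
  then have "has_bochner_integral N (\<lambda>\<omega>. (1 / 2) *
      (v * ((1 * A \<omega> + 1 * B \<omega>) / sqrt v)\<^sup>2 - (A \<omega>)\<^sup>2 - (B \<omega>)\<^sup>2)) ((1 / 2) * (v * 1 - 1 - 1))"
    using A B by (intro has_bochner_integral_mult_right has_bochner_integral_diff) auto
  moreover have "(1 / 2) * (v * ((1 * a + 1 * b) / sqrt v)\<^sup>2 - a\<^sup>2 - b\<^sup>2) = a * b" for a b
    using v by (simp add: power_divide power2_sum)
  ultimately have AB: "has_bochner_integral N (\<lambda>\<omega>. A \<omega> * B \<omega>) \<rho>"
    by (simp add: v_def)
  have Z_eq: "Z l = (\<lambda>\<omega>. p * A \<omega> + \<mu> l)" "Z m = (\<lambda>\<omega>. q * B \<omega> + \<mu> m)"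
    using pq by (auto simp: fun_eq_iff A_def B_def)
  have EZ: "(\<integral>\<omega>. p * A \<omega> + \<mu> l \<partial>N) = \<mu> l" "(\<integral>\<omega>. q * B \<omega> + \<mu> m \<partial>N) = \<mu> m"
    using A(1) B(1) by (simp_all add: has_bochner_integral_iff prob_space)
  have "correlation N (Z l) (Z m) = (\<integral>\<omega>. (p * q) * (A \<omega> * B \<omega>) \<partial>N) /
      (sqrt (\<integral>\<omega>. p\<^sup>2 * (A \<omega>)\<^sup>2 \<partial>N) * sqrt (\<integral>\<omega>. q\<^sup>2 * (B \<omega>)\<^sup>2 \<partial>N))"
    unfolding correlation_def Z_eq EZ by (simp add: power_mult_distrib mult_ac)
  also have "\<dots> = \<rho>"
    using AB A(2) B(2) pq(1,2) by (simp add: has_bochner_integral_iff)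
  finally show "correlation N (Z l) (Z m) = \<rho>" .
qed

section \<open>Pairs with a Gauss copula\<close>

text \<open>The lower left quadrants are stable under intersection and generate the Borel sets of
  the plane.\<close>

lemma plane_law_eqI:
  fixes \<mu> \<nu> :: "(real \<times> real) measure"
  assumes \<mu>: "prob_space \<mu>" "sets \<mu> = sets (borel \<Otimes>\<^sub>M borel)" and \<nu>: "sets \<nu> = sets (borel \<Otimes>\<^sub>M borel)"
    and eq: "\<And>a b. emeasure \<mu> ({..a} \<times> {..b}) = emeasure \<nu> ({..a} \<times> {..b})"
  shows "\<mu> = \<nu>"
proof -
  interpret prob_space \<mu> by fact
  let ?E = "range (\<lambda>z::real \<times> real. {..z})"
  have rect: "{..z} = {..fst z} \<times> {..snd z}" for z :: "real \<times> real"
    by (auto simp: less_eq_prod_def)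
  have gen: "sets (borel \<Otimes>\<^sub>M borel :: (real \<times> real) measure) = sigma_sets UNIV ?E"
    unfolding borel_prod by (subst borel_eq_atMost) (rule sets_measure_of, simp)
  show ?thesis
  proof (rule measure_eqI_generator_eq[where E = ?E and \<Omega> = UNIV and A = "\<lambda>n. {..(real n, real n)}"])
    show "Int_stable ?E"
    proof (rule Int_stableI)
      fix a b assume "a \<in> ?E" "b \<in> ?E"
      then obtain x y where "a = {..x}" "b = {..y}" by blast
      then have "a \<inter> b = {..inf x y}" by auto
      then show "a \<inter> b \<in> ?E" by blast
    qed
    show "(\<Union>n. {..(real n, real n)}) = UNIV"
    proof (intro set_eqI iffI UNIV_I)
      fix z :: "real \<times> real"
      obtain n where "max (fst z) (snd z) \<le> real n" using real_arch_simple by blast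
      then show "z \<in> (\<Union>n. {..(real n, real n)})" by (auto simp: less_eq_prod_def)
    qed
    show "range (\<lambda>n. {..(real n, real n)}) \<subseteq> ?E" by blast
    show "emeasure \<mu> X = emeasure \<nu> X" if "X \<in> ?E" for X using that eq rect by fastforce
    show "sets \<mu> = sigma_sets UNIV ?E" "sets \<nu> = sigma_sets UNIV ?E" using \<mu> \<nu> gen by simp_all
  qed simp_all
qed

text \<open>The Gauss copula condition concerns only thresholds in the open unit square. Elsewhere
  the uniform marginals alone force the joint distribution function.\<close>

lemma uniform_pair_boundary:
  assumes N: "prob_space N" and [measurable]: "U \<in> borel_measurable N" "V \<in> borel_measurable N"
    and law: "distr N borel U = uniform01" "distr N borel V = uniform01"
    and ab: "\<not> (0 < a \<and> a < 1 \<and> 0 < b \<and> b < 1)"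
  shows "emeasure (distr N (borel \<Otimes>\<^sub>M borel) (\<lambda>\<omega>. (U \<omega>, V \<omega>))) ({..a} \<times> {..b}) =
    (if a \<le> 0 \<or> b \<le> 0 then 0 else if 1 \<le> a then emeasure uniform01 {..b} else emeasure uniform01 {..a})"
proof -
  have "emeasure (distr N (borel \<Otimes>\<^sub>M borel) (\<lambda>\<omega>. (U \<omega>, V \<omega>))) ({..a} \<times> {..b}) =
      emeasure N {\<omega> \<in> space N. U \<omega> \<le> a \<and> V \<omega> \<le> b}"
    by (subst emeasure_distr) (auto intro!: arg_cong2[where f = emeasure])
  moreover have "AE \<omega> in N. U \<omega> \<in> {0<..<1}"
    by (rule AE_distrD[of U N borel], simp, unfold law, rule AE_uniform01)
  moreover have "AE \<omega> in N. V \<omega> \<in> {0<..<1}"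
    by (rule AE_distrD[of V N borel], simp, unfold law, rule AE_uniform01)
  ultimately have UV: "AE \<omega> in N. U \<omega> \<in> {0<..<1} \<and> V \<omega> \<in> {0<..<1}"
    and em: "emeasure (distr N (borel \<Otimes>\<^sub>M borel) (\<lambda>\<omega>. (U \<omega>, V \<omega>))) ({..a} \<times> {..b}) =
      emeasure N {\<omega> \<in> space N. U \<omega> \<le> a \<and> V \<omega> \<le> b}" by auto
  have margin: "emeasure uniform01 {..c} = emeasure N {\<omega> \<in> space N. W \<omega> \<le> c}"
    if [measurable]: "W \<in> borel_measurable N" and "distr N borel W = uniform01" for W c
    unfolding that(2)[symmetric] by (subst emeasure_distr) (auto intro!: arg_cong2[where f = emeasure])
  consider "a \<le> 0 \<or> b \<le> 0" | "\<not> (a \<le> 0 \<or> b \<le> 0)" "1 \<le> a" | "\<not> (a \<le> 0 \<or> b \<le> 0)" "\<not> 1 \<le> a" "1 \<le> b"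
    using ab by linarith
  then show ?thesis
  proof cases
    case 1
    have "emeasure N {\<omega> \<in> space N. U \<omega> \<le> a \<and> V \<omega> \<le> b} = emeasure N {}"
    proof (rule emeasure_eq_AE)
      show "AE \<omega> in N. (\<omega> \<in> {\<omega> \<in> space N. U \<omega> \<le> a \<and> V \<omega> \<le> b}) = (\<omega> \<in> {})"
        using UV by eventually_elim (use 1 in auto)
    qed measurable
    then show ?thesis using 1 em by simp
  next
    case 2
    have "emeasure N {\<omega> \<in> space N. U \<omega> \<le> a \<and> V \<omega> \<le> b} = emeasure N {\<omega> \<in> space N. V \<omega> \<le> b}"
    proof (rule emeasure_eq_AE)
      show "AE \<omega> in N. (\<omega> \<in> {\<omega> \<in> space N. U \<omega> \<le> a \<and> V \<omega> \<le> b}) = (\<omega> \<in> {\<omega> \<in> space N. V \<omega> \<le> b})"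
        using UV by eventually_elim (use 2 in auto)
    qed measurable
    then show ?thesis using 2 em margin[of V b] law by simp
  next
    case 3
    have "emeasure N {\<omega> \<in> space N. U \<omega> \<le> a \<and> V \<omega> \<le> b} = emeasure N {\<omega> \<in> space N. U \<omega> \<le> a}"
    proof (rule emeasure_eq_AE)
      show "AE \<omega> in N. (\<omega> \<in> {\<omega> \<in> space N. U \<omega> \<le> a \<and> V \<omega> \<le> b}) = (\<omega> \<in> {\<omega> \<in> space N. U \<omega> \<le> a})"
        using UV by eventually_elim (use 3 in auto)
    qed measurable
    then show ?thesis using 3 em margin[of U a] law by simp
  qed
qed

section \<open>The standard normal distribution function\<close>

lemma std_normal_atomless: "measure std_normal_distribution {x} = 0"
proof -
  have "AE y in std_normal_distribution. y \<noteq> x"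
    by (subst AE_density) (auto intro: AE_mp[OF AE_lborel_singleton])
  then have "emeasure std_normal_distribution {x} = 0"
    by (subst (asm) AE_iff_measurable[where N = "{x}"]) auto
  then show ?thesis by (simp add: measure_def)
qed

text \<open>The density is positive everywhere, so every interval of positive length carries
  mass.\<close>

lemma cdf_std_normal_strict_mono: "strict_mono (cdf std_normal_distribution)"
proof (rule strict_monoI)
  interpret real_distribution std_normal_distribution by (rule real_dist_normal_dist)
  fix x y :: real assume xy: "x < y"
  have "emeasure std_normal_distribution {x<..y} \<noteq> 0"
  proof
    assume "emeasure std_normal_distribution {x<..y} = 0"
    then have "AE z in std_normal_distribution. z \<notin> {x<..y}"
      by (intro AE_not_in) (simp add: null_sets_def)
    then have "AE z in lborel. z \<notin> {x<..y}"
      by (subst (asm) AE_density) (auto simp: normal_density_pos)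
    then have "emeasure lborel {x<..y} = 0"
      by (subst (asm) AE_iff_measurable[where N = "{x<..y}"]) auto
    with xy show False by simp
  qed
  then have "0 < measure std_normal_distribution {x<..y}"
    by (simp add: emeasure_eq_measure zero_less_measure_iff)
  then show "cdf std_normal_distribution x < cdf std_normal_distribution y"
    using cdf_diff_eq[OF xy] by simp
qed

text \<open>On the open unit interval \<open>inv\<close> is a genuine inverse, since the
  distribution function is injective and attains u. The quantile thresholds in the definition of the
  Gauss copula thus become thresholds for the transformed coordinates.\<close>

lemma cdf_std_normal_le_iff:
  assumes "0 < u" "u < 1"
  shows "z \<le> inv (cdf std_normal_distribution) u \<longleftrightarrow> cdf std_normal_distribution z \<le> u"
proof -
  have "cdf std_normal_distribution (inv (cdf std_normal_distribution) u) = u"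
    using cdf_surj[OF real_dist_normal_dist std_normal_atomless assms]
    by (intro f_inv_into_f) auto
  then show ?thesis
    using strict_mono_less_eq[OF cdf_std_normal_strict_mono] by metis
qed

text \<open>The Gaussian model \<open>K\<close> and the data have the same copula. The information
  is computed for the pair in \<open>K\<close>, pushed through the normal distribution function to
  the unit square, read there as a property of the copula of the data, and pulled back. The Gaussian
  formula asks for nondegeneracy in \<open>K\<close>, whereas it is given for the data, so it has to
  travel in the opposite direction.\<close>

lemma pair_gauss_copula_mutual_info:
  fixes Z :: "nat \<Rightarrow> 'a \<Rightarrow> real"
  assumes N: "prob_space N" and [measurable]: "Z l \<in> borel_measurable N" "Z m \<in> borel_measurable N"
    and atomless: "\<And>x. measure (distr N borel (Z l)) {x} = 0" "\<And>x. measure (distr N borel (Z m)) {x} = 0"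
    and lm: "l \<noteq> m"
    and nondegenerate:
      "\<And>g. g \<in> borel_measurable borel \<Longrightarrow> \<not> (AE \<omega> in N. Z m \<omega> = g (Z l \<omega>))"
      "\<And>g. g \<in> borel_measurable borel \<Longrightarrow> \<not> (AE \<omega> in N. Z l \<omega> = g (Z m \<omega>))"
    and C: "has_pair_gauss_copula N Z l m \<rho>"
  shows "has_mutual_info (distr N (borel \<Otimes>\<^sub>M borel) (\<lambda>\<omega>. (Z l \<omega>, Z m \<omega>))) (- (1 / 2) * ln (1 - \<rho>\<^sup>2))"
proof -
  interpret N: prob_space N by fact
  let ?B = "borel \<Otimes>\<^sub>M borel :: (real \<times> real) measure"
  let ?\<Phi> = "cdf std_normal_distribution"
  define R where "R i j = (if i = j then 1 else \<rho>)" for i j :: nat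
  define U V where "U = prob_transform N (Z l)" and "V = prob_transform N (Z m)"
  note U = prob_transform_uniform[OF N assms(2) atomless(1), folded U_def]
    and V = prob_transform_uniform[OF N assms(3) atomless(2), folded V_def]
  note [measurable] = U(1) V(1)
  obtain K where K: "prob_space K" and sets_K: "sets K = sets (\<Pi>\<^sub>M i\<in>{l, m}. borel)"
    and G: "gaussian_vector K {l, m} (\<lambda>i z. z i) (\<lambda>_. 0) R"
    and cop: "\<And>u. (\<forall>i\<in>{l, m}. 0 < u i \<and> u i < 1) \<Longrightarrow>
      measure N {\<omega> \<in> space N. \<forall>i\<in>{l, m}. prob_transform N (Z i) \<omega> \<le> u i} =
      measure K {z \<in> space K. \<forall>i\<in>{l, m}. z i \<le> inv ?\<Phi> (u i)}"
    using C unfolding has_pair_gauss_copula_def has_gauss_copula_def R_def by blast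
  interpret K: prob_space K by fact
  note [measurable_cong] = sets_K
  have zlm[measurable]: "(\<lambda>z. z l) \<in> borel_measurable K" "(\<lambda>z. z m) \<in> borel_measurable K"
    by (auto simp: measurable_cong_sets[OF sets_K refl])
  note [measurable] = cdf_measurable[OF real_dist_normal_dist]
  have std: "distr K borel (\<lambda>z. z i) = std_normal_distribution" if "i \<in> {l, m}" for i
  proof -
    have "has_normal_law K (\<lambda>z. z i) 0 1"
      using gaussian_vector_pair[OF G _ _ _ lm, of 1 0] gaussian_vector_pair[OF G _ _ _ lm, of 0 1] that
      by (auto simp: R_def)
    then show ?thesis by (simp add: has_normal_law_def)
  qed
  have unif: "distr K borel (\<lambda>z. ?\<Phi> (z i)) = uniform01" if i: "i \<in> {l, m}" for i
  proof -
    have [measurable]: "(\<lambda>z. z i) \<in> borel_measurable K" using i by auto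
    have "distr K borel (\<lambda>z. ?\<Phi> (z i)) = distr (distr K borel (\<lambda>z. z i)) borel ?\<Phi>"
      by (subst distr_distr) (auto simp: comp_def)
    then show ?thesis
      by (simp add: std[OF i] distr_cdf_uniform[OF real_dist_normal_dist std_normal_atomless])
  qed
  let ?\<kappa> = "distr K ?B (\<lambda>z. (?\<Phi> (z l), ?\<Phi> (z m)))"
  \<comment> \<open>On thresholds inside the unit square this is the copula hypothesis; on the
    others both laws have uniform marginals.\<close>
  have same: "distr N ?B (\<lambda>\<omega>. (U \<omega>, V \<omega>)) = ?\<kappa>"
  proof (rule plane_law_eqI)
    show "prob_space (distr N ?B (\<lambda>\<omega>. (U \<omega>, V \<omega>)))" by (rule N.prob_space_distr) measurable
    fix a b :: real
    show "emeasure (distr N ?B (\<lambda>\<omega>. (U \<omega>, V \<omega>))) ({..a} \<times> {..b}) = emeasure ?\<kappa> ({..a} \<times> {..b})"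
    proof (cases "0 < a \<and> a < 1 \<and> 0 < b \<and> b < 1")
      case True
      define u where "u i = (if i = l then a else b)" for i
      have ul: "u l = a" "u m = b" using lm by (auto simp: u_def)
      have "emeasure (distr N ?B (\<lambda>\<omega>. (U \<omega>, V \<omega>))) ({..a} \<times> {..b}) =
          emeasure N {\<omega> \<in> space N. U \<omega> \<le> a \<and> V \<omega> \<le> b}"
        by (subst emeasure_distr) (auto intro!: arg_cong2[where f = emeasure])
      also have "{\<omega> \<in> space N. U \<omega> \<le> a \<and> V \<omega> \<le> b} =
          {\<omega> \<in> space N. \<forall>i\<in>{l, m}. prob_transform N (Z i) \<omega> \<le> u i}"
        by (auto simp: ul U_def V_def)
      also have "emeasure N \<dots> = ennreal (measure K {z \<in> space K. \<forall>i\<in>{l, m}. z i \<le> inv ?\<Phi> (u i)})"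
        using cop[of u] True by (simp add: N.emeasure_eq_measure ul)
      also have "{z \<in> space K. \<forall>i\<in>{l, m}. z i \<le> inv ?\<Phi> (u i)} =
          {z \<in> space K. ?\<Phi> (z l) \<le> a \<and> ?\<Phi> (z m) \<le> b}"
        using True by (auto simp: ul cdf_std_normal_le_iff)
      also have "ennreal (measure K \<dots>) = emeasure ?\<kappa> ({..a} \<times> {..b})"
        unfolding K.emeasure_eq_measure[symmetric]
        by (subst emeasure_distr) (auto intro!: arg_cong2[where f = emeasure])
      finally show ?thesis .
    next
      case False
      then show ?thesis
        using uniform_pair_boundary[OF N U(1) V(1) U(2) V(2) False]
          uniform_pair_boundary[OF K _ _ unif unif False, of l m] by simp
    qed
  qed auto
  obtain Q where [measurable]: "Q \<in> borel_measurable borel"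
    and Q: "AE x in std_normal_distribution. Q (?\<Phi> x) = x"
    using cdf_AE_invertible[OF real_dist_normal_dist std_normal_atomless] by blast
  have QK: "AE z in K. Q (?\<Phi> (z i)) = z i" if "i \<in> {l, m}" for i
  proof -
    have [measurable]: "(\<lambda>z. z i) \<in> borel_measurable K" using that by auto
    have "AE x in distr K borel (\<lambda>z. z i). Q (?\<Phi> x) = x" unfolding std[OF that] by (rule Q)
    then show ?thesis by (rule AE_distrD[rotated]) simp
  qed
  \<comment> \<open>Each coordinate of the data is almost surely a Borel function of its transform,
    so that a functional relation between the transforms becomes one between the data.\<close>
  have recover: "\<exists>q\<in>borel_measurable borel. AE \<omega> in N. q (prob_transform N (Z i) \<omega>) = Z i \<omega>"
    if i: "i \<in> {l, m}" for i
  proof -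
    have [measurable]: "Z i \<in> borel_measurable N" using i by auto
    have rd: "real_distribution (distr N borel (Z i))" by (rule N.real_distribution_distr) simp
    have "\<And>x. measure (distr N borel (Z i)) {x} = 0" using i atomless by auto
    from cdf_AE_invertible[OF rd this] obtain q where q: "q \<in> borel_measurable borel"
      "AE x in distr N borel (Z i). q (cdf (distr N borel (Z i)) x) = x" by blast
    have "AE \<omega> in N. q (cdf (distr N borel (Z i)) (Z i \<omega>)) = Z i \<omega>"
      by (rule AE_distrD[OF _ q(2)]) simp
    then show ?thesis using q(1) by (auto simp: prob_transform_def)
  qed
  have "has_mutual_info (distr K ?B (\<lambda>z. (z l, z m))) (- (1 / 2) * ln (1 - (R l m / (sqrt (R l l) * sqrt (R m m)))\<^sup>2))"
  proof (rule gaussian_vector_mutual_info[OF K G])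
    fix g :: "real \<Rightarrow> real" assume [measurable]: "g \<in> borel_measurable borel"
    show "\<not> (AE z in K. z m = g (z l))"
    \<comment> \<open>Such a relation in \<open>K\<close> puts the copula on a graph. By
      \<open>same\<close>, the transforms U and V of the data satisfy it too, and \<open>q\<close>
      turns it into the relation excluded for the data.\<close>
    proof
      assume "AE z in K. z m = g (z l)"
      then have "AE z in K. snd (?\<Phi> (z l), ?\<Phi> (z m)) = ?\<Phi> (g (Q (fst (?\<Phi> (z l), ?\<Phi> (z m)))))"
        using QK[of l, simplified] by eventually_elim simp
      then have "AE w in ?\<kappa>. snd w = ?\<Phi> (g (Q (fst w)))" by (subst AE_distr_iff) auto
      then have copula_graph: "AE \<omega> in N. snd (U \<omega>, V \<omega>) = ?\<Phi> (g (Q (fst (U \<omega>, V \<omega>))))"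
        unfolding same[symmetric] by (rule AE_distrD[rotated]) measurable
      obtain q where [measurable]: "q \<in> borel_measurable borel"
        and q: "AE \<omega> in N. q (V \<omega>) = Z m \<omega>" using recover[of m] by (auto simp: V_def)
      from copula_graph q have "AE \<omega> in N. Z m \<omega> =
          (\<lambda>x. q (?\<Phi> (g (Q (cdf (distr N borel (Z l)) x))))) (Z l \<omega>)"
        by eventually_elim (simp add: U_def prob_transform_def)
      moreover have "real_distribution (distr N borel (Z l))"
        by (rule N.real_distribution_distr) simp
      note [measurable] = cdf_measurable[OF this]
      have "(\<lambda>x. q (?\<Phi> (g (Q (cdf (distr N borel (Z l)) x))))) \<in> borel_measurable borel"
        by measurable
      ultimately show False using nondegenerate(1) by blast
    qed
    show "\<not> (AE z in K. z l = g (z m))"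
    proof
      assume "AE z in K. z l = g (z m)"
      then have "AE z in K. fst (?\<Phi> (z l), ?\<Phi> (z m)) = ?\<Phi> (g (Q (snd (?\<Phi> (z l), ?\<Phi> (z m)))))"
        using QK[of m, simplified] by eventually_elim simp
      then have "AE w in ?\<kappa>. fst w = ?\<Phi> (g (Q (snd w)))" by (subst AE_distr_iff) auto
      then have copula_graph: "AE \<omega> in N. fst (U \<omega>, V \<omega>) = ?\<Phi> (g (Q (snd (U \<omega>, V \<omega>))))"
        unfolding same[symmetric] by (rule AE_distrD[rotated]) measurable
      obtain q where [measurable]: "q \<in> borel_measurable borel"
        and q: "AE \<omega> in N. q (U \<omega>) = Z l \<omega>" using recover[of l] by (auto simp: U_def)
      from copula_graph q have "AE \<omega> in N. Z l \<omega> =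
          (\<lambda>x. q (?\<Phi> (g (Q (cdf (distr N borel (Z m)) x))))) (Z m \<omega>)"
        by eventually_elim (simp add: V_def prob_transform_def)
      moreover have "real_distribution (distr N borel (Z m))"
        by (rule N.real_distribution_distr) simp
      note [measurable] = cdf_measurable[OF this]
      have "(\<lambda>x. q (?\<Phi> (g (Q (cdf (distr N borel (Z m)) x))))) \<in> borel_measurable borel"
        by measurable
      ultimately show False using nondegenerate(2) by blast
    qed
  qed (use lm in auto)
  then have I: "has_mutual_info (distr K ?B (\<lambda>z. (z l, z m))) (- (1 / 2) * ln (1 - \<rho>\<^sup>2))"
    using lm by (simp add: R_def)
  have "has_mutual_info (distr (distr K ?B (\<lambda>z. (z l, z m))) ?B (\<lambda>(x, y). (?\<Phi> x, ?\<Phi> y)))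
      (- (1 / 2) * ln (1 - \<rho>\<^sup>2))"
  proof (rule has_mutual_info_distr[where F' = Q and G' = Q, OF _ _ _ _ _ _ _ _ I])
    show "prob_space (distr K ?B (\<lambda>z. (z l, z m)))" by (rule K.prob_space_distr) measurable
    show "AE x in distr (distr K ?B (\<lambda>z. (z l, z m))) borel fst. Q (?\<Phi> x) = x"
      unfolding distr_Pair_fst[OF zlm] std[of l, simplified] by (rule Q)
    show "AE x in distr (distr K ?B (\<lambda>z. (z l, z m))) borel snd. Q (?\<Phi> x) = x"
      unfolding distr_Pair_snd[OF zlm] std[of m, simplified] by (rule Q)
  qed auto
  also have "distr (distr K ?B (\<lambda>z. (z l, z m))) ?B (\<lambda>(x, y). (?\<Phi> x, ?\<Phi> y)) = distr N ?B (\<lambda>\<omega>. (U \<omega>, V \<omega>))"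
    unfolding same by (rule distr_Pair_map) measurable
  finally show ?thesis
    unfolding U_def V_def by (rule has_mutual_info_of_prob_transform[OF N assms(2,3) atomless])
qed

section \<open>The divergence of a GNB structure\<close>

lemma extended_integral_cong_AE:
  assumes "AE x in N. f x = g x"
  shows "extended_integral N f = extended_integral N g"
proof -
  have "(\<integral>\<^sup>+x. ennreal (f x) \<partial>N) = (\<integral>\<^sup>+x. ennreal (g x) \<partial>N)"
    "(\<integral>\<^sup>+x. ennreal (- f x) \<partial>N) = (\<integral>\<^sup>+x. ennreal (- g x) \<partial>N)"
    using assms by (auto intro!: nn_integral_cong_AE)
  then show ?thesis by (simp add: extended_integral_def)
qed

text \<open>Both parts of \<open>f\<close> may have infinite integral, so linearity is not at hand.
  The parts are compared through the pointwise identity (f - g)^+ + f^- + g^+ = (f - g)^- + f^+ +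
  g^-, in which the integrals of g^+ and g^- are finite.\<close>

lemma extended_integral_diff:
  assumes [measurable]: "f \<in> borel_measurable N" and g: "has_bochner_integral N g r"
  shows "extended_integral N (\<lambda>x. f x - g x) = extended_integral N f + ereal (- r)"
proof -
  have [measurable]: "g \<in> borel_measurable N" and ig: "integrable N g" and r: "integral\<^sup>L N g = r"
    using g by (auto simp: has_bochner_integral_iff)
  define a b c e g1 g2 where
    "a = (\<integral>\<^sup>+x. ennreal (f x) \<partial>N)" and "b = (\<integral>\<^sup>+x. ennreal (- f x) \<partial>N)" and
    "c = (\<integral>\<^sup>+x. ennreal (f x - g x) \<partial>N)" and "e = (\<integral>\<^sup>+x. ennreal (- (f x - g x)) \<partial>N)" and
    "g1 = (\<integral>\<^sup>+x. ennreal (g x) \<partial>N)" and "g2 = (\<integral>\<^sup>+x. ennreal (- g x) \<partial>N)"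
  have gfin: "g1 < \<infinity>" "g2 < \<infinity>" and rg: "r = enn2real g1 - enn2real g2"
    using ig real_lebesgue_integral_def[OF ig] r
    by (auto simp: real_integrable_def g1_def g2_def less_top)
  have pos_part: "ennreal u = ennreal (max 0 u)" for u by (simp add: max_def ennreal_neg)
  have sum: "c + b + g1 = e + a + g2"
  proof -
    have "c + b + g1 = (\<integral>\<^sup>+x. ennreal (f x - g x) + ennreal (- f x) + ennreal (g x) \<partial>N)"
      unfolding c_def b_def g1_def by (simp add: nn_integral_add)
    also have "\<dots> = (\<integral>\<^sup>+x. ennreal (- (f x - g x)) + ennreal (f x) + ennreal (- g x) \<partial>N)"
    proof (rule nn_integral_cong)
      fix x
      show "ennreal (f x - g x) + ennreal (- f x) + ennreal (g x) =
          ennreal (- (f x - g x)) + ennreal (f x) + ennreal (- g x)"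
        unfolding pos_part[of "f x - g x"] pos_part[of "- f x"] pos_part[of "g x"]
          pos_part[of "- (f x - g x)"] pos_part[of "f x"] pos_part[of "- g x"]
        by (simp add: ennreal_plus[symmetric] max_def del: ennreal_plus)
    qed
    also have "\<dots> = e + a + g2"
      unfolding e_def a_def g2_def by (simp add: nn_integral_add)
    finally show ?thesis .
  qed
  have sub: "(\<integral>\<^sup>+x. ennreal (u x) \<partial>N) \<le> (\<integral>\<^sup>+x. ennreal (v x) \<partial>N) + (\<integral>\<^sup>+x. ennreal (k x) \<partial>N)"
    if [measurable]: "v \<in> borel_measurable N" "k \<in> borel_measurable N"
      and le: "\<And>x. u x \<le> v x + k x" for u v k
  proof (subst nn_integral_add[symmetric])
    show "(\<integral>\<^sup>+x. ennreal (u x) \<partial>N) \<le> (\<integral>\<^sup>+x. ennreal (v x) + ennreal (k x) \<partial>N)"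
    proof (rule nn_integral_mono)
      fix x
      have "ennreal (u x) \<le> ennreal (max 0 (v x) + max 0 (k x))"
        using le[of x] by (intro ennreal_leI) linarith
      also have "\<dots> = ennreal (v x) + ennreal (k x)"
        by (subst ennreal_plus) (simp_all flip: pos_part)
      finally show "ennreal (u x) \<le> ennreal (v x) + ennreal (k x)" .
    qed
  qed measurable
  \<comment> \<open>Subtracting an integrable function does not change which of the two parts has
    infinite integral.\<close>
  have le: "c \<le> a + g2" "a \<le> c + g1" "e \<le> b + g1" "b \<le> e + g2"
    unfolding a_def b_def c_def e_def g1_def g2_def by (intro sub; simp)+
  have "enn2ereal c - enn2ereal e = enn2ereal a - enn2ereal b + ereal (- r)"
  proof (cases "a = \<infinity>")
    case True
    \<comment> \<open>Both sides are then \<infinity> whatever the negative parts are, because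
      \<open>\<infinity> - \<infinity> = \<infinity>\<close> in \<open>ereal\<close>.\<close>
    then have "c = \<infinity>" using le(2) gfin by (auto simp: top_unique ennreal_add_eq_top less_top[symmetric])
    then show ?thesis using True
      by simp
  next
    case a: False
    then have c: "c \<noteq> \<infinity>" using le(1) gfin by (auto simp: top_unique less_top[symmetric])
    show ?thesis
    proof (cases "b = \<infinity>")
      case True
      then have "e = \<infinity>" using le(4) gfin by (auto simp: top_unique ennreal_add_eq_top less_top[symmetric])
      then show ?thesis using True a c
        by (cases a; cases c) auto
    next
      case b: False
      then have e: "e \<noteq> \<infinity>" using le(3) gfin by (auto simp: top_unique less_top[symmetric])
      define a' b' c' e' g1' g2' where defs: "a' = enn2real a" "b' = enn2real b" "c' = enn2real c"
        "e' = enn2real e" "g1' = enn2real g1" "g2' = enn2real g2"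
      have fin: "a = ennreal a'" "b = ennreal b'" "c = ennreal c'" "e = ennreal e'"
        "g1 = ennreal g1'" "g2 = ennreal g2'" "0 \<le> a'" "0 \<le> b'" "0 \<le> c'" "0 \<le> e'"
        "0 \<le> g1'" "0 \<le> g2'"
        unfolding defs using a b c e gfin by (simp_all add: less_top)
      have "c' + b' + g1' = e' + a' + g2'"
        using sum fin by (simp add: ennreal_plus[symmetric] del: ennreal_plus)
      moreover have "r = g1' - g2'" using rg fin by simp
      ultimately show ?thesis
        using fin by simp
    qed
  qed
  then show ?thesis
    unfolding extended_integral_def a_def b_def c_def e_def .
qed

text \<open>Identifies the plane with the functions on {l, m}, the form in which marginals of
  \<open>p\<close> take their arguments.\<close>

lemma distr_pair_PiM:
  assumes lm: "l \<noteq> (m::nat)"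
  shows "distr (lborel \<Otimes>\<^sub>M lborel) (\<Pi>\<^sub>M i\<in>{l, m}. lborel :: real measure)
    (\<lambda>z. \<lambda>i\<in>{l, m}. if i = l then fst z else snd z) = (\<Pi>\<^sub>M i\<in>{l, m}. lborel)" (is "distr ?L ?P ?v = _")
proof -
  interpret product_sigma_finite "\<lambda>_::nat. lborel :: real measure" ..
  have [measurable]: "?v \<in> measurable ?L ?P" by measurable
  show ?thesis
  proof (rule PiM_eqI)
    fix A :: "nat \<Rightarrow> real set" assume A: "\<And>i. i \<in> {l, m} \<Longrightarrow> A i \<in> sets lborel"
    then have [measurable]: "A l \<in> sets borel" "A m \<in> sets borel" by auto
    have "Pi\<^sub>E {l, m} A \<in> sets ?P" using A by (intro sets_PiM_I_finite) auto
    then have "emeasure (distr ?L ?P ?v) (Pi\<^sub>E {l, m} A) = emeasure ?L (?v -` Pi\<^sub>E {l, m} A \<inter> space ?L)"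
      by (subst emeasure_distr) auto
    also have "?v -` Pi\<^sub>E {l, m} A \<inter> space ?L = A l \<times> A m"
      using lm by (auto simp: space_pair_measure PiE_iff)
    also have "emeasure ?L (A l \<times> A m) = emeasure lborel (A l) * emeasure lborel (A m)"
      by (rule lborel.emeasure_pair_measure_Times) auto
    also have "\<dots> = (\<Prod>i\<in>{l, m}. emeasure lborel (A i))" using lm by simp
    finally show "emeasure (distr ?L ?P ?v) (Pi\<^sub>E {l, m} A) = (\<Prod>i\<in>{l, m}. emeasure lborel (A i))" .
  qed auto
qed

section \<open>A fixed class: the unnormalised density and its marginals\<close>

locale class_density =
  fixes D :: "nat set" and p :: "(nat \<Rightarrow> real) \<Rightarrow> 'y \<Rightarrow> real" and y :: 'y and Z :: real
  assumes finite_D: "finite D"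
    and nonneg: "\<And>x. 0 \<le> p x y"
    and meas [measurable]: "(\<lambda>x. p x y) \<in> borel_measurable (\<Pi>\<^sub>M i\<in>D. lborel)"
    and total: "(\<integral>\<^sup>+x. ennreal (p x y) \<partial>(\<Pi>\<^sub>M i\<in>D. lborel)) = ennreal Z"
    and Z_pos: "0 < Z"
begin

abbreviation md :: "nat set \<Rightarrow> (nat \<Rightarrow> real) \<Rightarrow> real" where
  "md A x \<equiv> marginal_density D p A x y"

abbreviation L :: "nat set \<Rightarrow> (nat \<Rightarrow> real) measure" where
  "L A \<equiv> \<Pi>\<^sub>M i\<in>A. lborel"

text \<open>The conditional law of the vector given the class, once \<open>Z\<close> is the class
  probability. \<open>p\<close> itself stays unnormalised because the GNB density is built from
  marginals of the joint density.\<close>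

definition law :: "(nat \<Rightarrow> real) measure" where
  "law = density (L D) (\<lambda>x. ennreal (p x y / Z))"

lemma law_prob: "prob_space law"
proof (rule prob_spaceI)
  have "emeasure law (space law) = (\<integral>\<^sup>+x. ennreal (1 / Z) * ennreal (p x y) \<partial>L D)"
    using nonneg Z_pos by (simp add: law_def emeasure_density ennreal_mult[symmetric] cong: nn_integral_cong)
  also have "\<dots> = ennreal (1 / Z) * ennreal Z" by (subst nn_integral_cmult) (auto simp: total)
  finally show "emeasure law (space law) = 1" using Z_pos by (simp add: ennreal_mult[symmetric])
qed

lemma sets_law [measurable_cong]: "sets law = sets (L D)"
  by (simp add: law_def)

lemma merge_measurable:
  assumes "A \<subseteq> D"
  shows "(\<lambda>z. p (merge A (D - A) z) y) \<in> borel_measurable (L A \<Otimes>\<^sub>M L (D - A))"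
proof -
  have "merge A (D - A) \<in> measurable (L A \<Otimes>\<^sub>M L (D - A)) (L (A \<union> (D - A)))" by measurable
  moreover have "A \<union> (D - A) = D" using assms by auto
  ultimately show ?thesis using measurable_compose[OF _ meas] by simp
qed

lemma md_measurable:
  assumes A: "A \<subseteq> D"
  shows "md A \<in> borel_measurable (L A)"
proof -
  interpret product_sigma_finite "\<lambda>_::nat. lborel :: real measure" ..
  have "sigma_finite_measure (L (D - A))" using finite_D by (intro sigma_finite) simp
  then show ?thesis
    unfolding marginal_density_def
    by (rule sigma_finite_measure.borel_measurable_lebesgue_integral)
       (use merge_measurable[OF A] in \<open>simp add: split_beta'\<close>)
qed

lemma md_restrict: "md A (restrict x A) = md A x"
  by (simp add: marginal_density_def)

lemma md_measurable_D:
  assumes A: "A \<subseteq> D"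
  shows "md A \<in> borel_measurable (L D)"
proof -
  have "(\<lambda>x. md A (restrict x A)) \<in> borel_measurable (L D)"
    by (rule measurable_compose[OF measurable_restrict_subset[OF A] md_measurable[OF A]])
  then show ?thesis by (simp add: md_restrict)
qed

lemma md_nonneg: "0 \<le> md A x"
  unfolding marginal_density_def using nonneg by (intro integral_nonneg_AE) auto

text \<open>Fubini with one obstacle: \<open>md A x\<close> is a Bochner integral and would be 0 on
  a slice of infinite mass. As the total mass Z is finite, almost every slice has finite mass, and
  there the two integrals agree.\<close>

lemma nn_integral_marginal:
  assumes A: "A \<subseteq> D" and f: "f \<in> borel_measurable (L A)"
  shows "(\<integral>\<^sup>+x. f (restrict x A) * ennreal (p x y) \<partial>L D) = (\<integral>\<^sup>+x. f x * ennreal (md A x) \<partial>L A)"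
proof -
  interpret product_sigma_finite "\<lambda>_::nat. lborel :: real measure" ..
  have fin: "finite A" "finite (D - A)" using finite_D A finite_subset by auto
  have D: "A \<union> (D - A) = D" using A by auto
  interpret R: sigma_finite_measure "L (D - A)" using fin by (intro sigma_finite)
  note [measurable] = merge_measurable[OF A] f
  have fold: "(\<integral>\<^sup>+x. g x \<partial>L D) = (\<integral>\<^sup>+x. \<integral>\<^sup>+z. g (merge A (D - A) (x, z)) \<partial>L (D - A) \<partial>L A)"
    if "g \<in> borel_measurable (L D)" for g
    using product_nn_integral_fold[of A "D - A" g] that fin unfolding D by simp
  let ?i = "\<lambda>x. \<integral>\<^sup>+z. ennreal (p (merge A (D - A) (x, z)) y) \<partial>L (D - A)"
  have i[measurable]: "?i \<in> borel_measurable (L A)"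
    by (rule R.borel_measurable_nn_integral) (simp add: split_beta')
  have "(\<integral>\<^sup>+x. ?i x \<partial>L A) = ennreal Z" using fold[of "\<lambda>x. ennreal (p x y)"] total by simp
  then have "AE x in L A. ?i x \<noteq> \<infinity>" by (intro nn_integral_PInf_AE i) simp
  then have AE: "AE x in L A. ?i x = ennreal (md A x)"
    using AE_space
  proof eventually_elim
    case (elim x)
    have "(\<lambda>z. p (merge A (D - A) (x, z)) y) \<in> borel_measurable (L (D - A))"
      using measurable_compose[OF measurable_Pair1'[OF elim(2)] merge_measurable[OF A]] by simp
    then have "integrable (L (D - A)) (\<lambda>z. p (merge A (D - A) (x, z)) y)"
      using elim(1) nonneg by (intro integrableI_nonneg) (auto simp: less_top)
    then show ?case
      unfolding marginal_density_def using nonneg by (intro nn_integral_eq_integral) auto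
  qed
  have fr: "(\<lambda>x. f (restrict x A)) \<in> borel_measurable (L D)"
    by (rule measurable_compose[OF measurable_restrict_subset[OF A] f])
  have pm: "(\<lambda>x. ennreal (p x y)) \<in> borel_measurable (L D)"
    by (rule measurable_compose[OF meas measurable_ennreal])
  have "(\<integral>\<^sup>+x. f (restrict x A) * ennreal (p x y) \<partial>L D) =
      (\<integral>\<^sup>+x. \<integral>\<^sup>+z. f (restrict (merge A (D - A) (x, z)) A) * ennreal (p (merge A (D - A) (x, z)) y)
        \<partial>L (D - A) \<partial>L A)"
    by (intro fold borel_measurable_times_ennreal fr pm)
  also have "\<dots> = (\<integral>\<^sup>+x. f x * ?i x \<partial>L A)"
  proof (rule nn_integral_cong)
    fix x assume x: "x \<in> space (L A)"
    then have rx: "restrict x A = x" by (auto simp: space_PiM PiE_iff extensional_restrict)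
    have [measurable]: "(\<lambda>z. p (merge A (D - A) (x, z)) y) \<in> borel_measurable (L (D - A))"
      using measurable_compose[OF measurable_Pair1'[OF x] merge_measurable[OF A]] by simp
    show "(\<integral>\<^sup>+z. f (restrict (merge A (D - A) (x, z)) A) * ennreal (p (merge A (D - A) (x, z)) y)
        \<partial>L (D - A)) = f x * ?i x"
      by (subst nn_integral_cmult[symmetric]) (auto simp: rx)
  qed
  also have "\<dots> = (\<integral>\<^sup>+x. f x * ennreal (md A x) \<partial>L A)"
    using AE by (intro nn_integral_cong_AE) (auto elim!: eventually_mono)
  finally show ?thesis .
qed

text \<open>Test \<open>nn_integral_marginal\<close> with the indicator of the zero set of the
  marginal: \<open>p\<close> puts no mass above that set. This keeps the later logarithms away from
  0 almost everywhere that \<open>p\<close> is positive.\<close>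

lemma AE_marginal_pos:
  assumes A: "A \<subseteq> D"
  shows "AE x in L D. 0 < p x y \<longrightarrow> 0 < md A x"
proof -
  note [measurable] = md_measurable[OF A] md_measurable_D[OF A]
  let ?f = "\<lambda>x. indicator {x. md A x = 0} x :: ennreal"
  have "(\<integral>\<^sup>+x. ?f (restrict x A) * ennreal (p x y) \<partial>L D) = (\<integral>\<^sup>+x. ?f x * ennreal (md A x) \<partial>L A)"
    by (rule nn_integral_marginal[OF A]) measurable
  also have "\<dots> = (\<integral>\<^sup>+x. 0 \<partial>L A)" by (intro nn_integral_cong) (auto simp: indicator_def)
  finally have "(\<integral>\<^sup>+x. indicator {x. md A x = 0} x * ennreal (p x y) \<partial>L D) = 0"
    by (simp add: md_restrict indicator_def)
  then have "AE x in L D. indicator {x. md A x = 0} x * ennreal (p x y) = 0"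
    by (subst (asm) nn_integral_0_iff_AE) auto
  then show ?thesis
    by eventually_elim (auto simp: indicator_def less_le md_nonneg split: if_splits)
qed

lemma component_measurable_law: "l \<in> D \<Longrightarrow> (\<lambda>x. x l) \<in> borel_measurable law"
  by measurable

lemma distr_law_component:
  assumes l: "l \<in> D"
  shows "distr law borel (\<lambda>x. x l) = density lborel (\<lambda>a. ennreal (md {l} (\<lambda>i\<in>{l}. a) / Z))"
proof (rule measure_eqI)
  interpret product_sigma_finite "\<lambda>_::nat. lborel :: real measure" ..
  have A: "{l} \<subseteq> D" using l by simp
  fix X assume "X \<in> sets (distr law borel (\<lambda>x. x l))"
  then have [measurable]: "X \<in> sets borel" by simp
  have f: "(\<lambda>x. ennreal (1 / Z) * indicator X (x l)) \<in> borel_measurable (L {l})" by measurable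
  note [measurable] = md_measurable[OF A] component_measurable_law[OF l]
  have "emeasure (distr law borel (\<lambda>x. x l)) X = (\<integral>\<^sup>+x. indicator X (x l) \<partial>law)"
    by (subst nn_integral_indicator[symmetric], simp, subst nn_integral_distr) auto
  also have "\<dots> = (\<integral>\<^sup>+x. ennreal (p x y / Z) * indicator X (x l) \<partial>L D)"
    unfolding law_def using l by (intro nn_integral_density) measurable
  also have "\<dots> = (\<integral>\<^sup>+x. (ennreal (1 / Z) * indicator X (restrict x {l} l)) * ennreal (p x y) \<partial>L D)"
    using nonneg Z_pos by (intro nn_integral_cong) (simp add: indicator_def ennreal_mult[symmetric])
  also have "\<dots> = (\<integral>\<^sup>+x. (ennreal (1 / Z) * indicator X (x l)) * ennreal (md {l} x) \<partial>L {l})"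
    by (rule nn_integral_marginal[OF A f])
  also have "\<dots> = (\<integral>\<^sup>+x. (ennreal (1 / Z) * indicator X (x l)) * ennreal (md {l} x)
      \<partial>distr lborel (L {l}) (\<lambda>x. \<lambda>i\<in>{l}. x))"
    by (simp only: distr_component)
  also have "\<dots> = (\<integral>\<^sup>+a. (ennreal (1 / Z) * indicator X a) * ennreal (md {l} (\<lambda>i\<in>{l}. a)) \<partial>lborel)"
  proof (subst nn_integral_distr)
    show "(\<lambda>x. (ennreal (1 / Z) * indicator X (x l)) * ennreal (md {l} x)) \<in>
        borel_measurable (distr lborel (L {l}) (\<lambda>x. \<lambda>i\<in>{l}. x))"
      unfolding measurable_distr_eq1
      by (intro borel_measurable_times_ennreal f measurable_compose[OF md_measurable[OF A] measurable_ennreal])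
  qed auto
  also have "\<dots> = (\<integral>\<^sup>+a. ennreal (md {l} (\<lambda>i\<in>{l}. a) / Z) * indicator X a \<partial>lborel)"
    using md_nonneg Z_pos by (intro nn_integral_cong) (simp add: indicator_def ennreal_mult[symmetric])
  also have "\<dots> = emeasure (density lborel (\<lambda>a. ennreal (md {l} (\<lambda>i\<in>{l}. a) / Z))) X"
    by (subst emeasure_density) auto
  finally show "emeasure (distr law borel (\<lambda>x. x l)) X =
    emeasure (density lborel (\<lambda>a. ennreal (md {l} (\<lambda>i\<in>{l}. a) / Z))) X" .
qed simp

lemma distr_law_pair:
  assumes lm: "l \<in> D" "m \<in> D" "l \<noteq> m"
  shows "distr law (borel \<Otimes>\<^sub>M borel) (\<lambda>x. (x l, x m)) = density (lborel \<Otimes>\<^sub>M lborel)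
    (\<lambda>z. ennreal (md {l, m} (\<lambda>i\<in>{l, m}. if i = l then fst z else snd z) / Z))"
    (is "?D = density ?L (\<lambda>z. ennreal (md _ (?v z) / Z))")
proof (rule measure_eqI)
  have A: "{l, m} \<subseteq> D" using lm by simp
  show "sets ?D = sets (density ?L (\<lambda>z. ennreal (md {l, m} (?v z) / Z)))"
    by (auto cong: sets_pair_measure_cong)
  fix X assume "X \<in> sets ?D"
  then have [measurable]: "X \<in> sets (borel \<Otimes>\<^sub>M borel)" by simp
  have f: "(\<lambda>x. ennreal (1 / Z) * indicator X (x l, x m)) \<in> borel_measurable (L {l, m})" by measurable
  have [measurable]: "?v \<in> measurable ?L (L {l, m})" by measurable
  note [measurable] = md_measurable[OF A] component_measurable_law[OF lm(1)] component_measurable_law[OF lm(2)]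
  have "emeasure ?D X = (\<integral>\<^sup>+x. indicator X (x l, x m) \<partial>law)"
    by (subst nn_integral_indicator[symmetric], simp, subst nn_integral_distr) auto
  also have "\<dots> = (\<integral>\<^sup>+x. ennreal (p x y / Z) * indicator X (x l, x m) \<partial>L D)"
    unfolding law_def using lm by (intro nn_integral_density) measurable
  also have "\<dots> = (\<integral>\<^sup>+x. (ennreal (1 / Z) * indicator X (restrict x {l, m} l, restrict x {l, m} m)) *
      ennreal (p x y) \<partial>L D)"
    using nonneg Z_pos by (intro nn_integral_cong) (simp add: indicator_def ennreal_mult[symmetric])
  also have "\<dots> = (\<integral>\<^sup>+x. (ennreal (1 / Z) * indicator X (x l, x m)) * ennreal (md {l, m} x) \<partial>L {l, m})"
    by (rule nn_integral_marginal[OF A f])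
  also have "\<dots> = (\<integral>\<^sup>+x. (ennreal (1 / Z) * indicator X (x l, x m)) * ennreal (md {l, m} x)
      \<partial>distr ?L (L {l, m}) ?v)"
    by (simp only: distr_pair_PiM[OF lm(3)])
  also have "\<dots> = (\<integral>\<^sup>+z. (ennreal (1 / Z) * indicator X (fst z, snd z)) * ennreal (md {l, m} (?v z)) \<partial>?L)"
  proof (subst nn_integral_distr)
    show "(\<lambda>x. (ennreal (1 / Z) * indicator X (x l, x m)) * ennreal (md {l, m} x)) \<in>
        borel_measurable (distr ?L (L {l, m}) ?v)"
      unfolding measurable_distr_eq1
      by (intro borel_measurable_times_ennreal f measurable_compose[OF md_measurable[OF A] measurable_ennreal])
  qed (use lm in auto)
  also have "\<dots> = (\<integral>\<^sup>+z. ennreal (md {l, m} (?v z) / Z) * indicator X z \<partial>?L)"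
    using md_nonneg Z_pos by (intro nn_integral_cong) (simp add: indicator_def ennreal_mult[symmetric])
  also have "\<dots> = emeasure (density ?L (\<lambda>z. ennreal (md {l, m} (?v z) / Z))) X"
    by (subst emeasure_density) (auto cong: sets_pair_measure_cong)
  finally show "emeasure ?D X = emeasure (density ?L (\<lambda>z. ennreal (md {l, m} (?v z) / Z))) X" .
qed

text \<open>The conditional densities are the marginals divided by Z; the three divisions leave one
  factor Z inside the logarithm. Integrating against p instead of p / Z multiplies the information
  by Z.\<close>

lemma has_bochner_integral_log_ratio:
  assumes lm: "l \<in> D" "m \<in> D" "l \<noteq> m"
    and I: "has_mutual_info (distr law (borel \<Otimes>\<^sub>M borel) (\<lambda>x. (x l, x m))) r"
  shows "has_bochner_integral (L D)
    (\<lambda>x. p x y * ln (Z * md {l, m} x / (md {l} x * md {m} x))) (Z * r)"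
proof -
  let ?v = "\<lambda>z. \<lambda>i\<in>{l, m}. if i = l then fst z else snd z"
  let ?k = "\<lambda>z. ln ((md {l, m} (?v z) / Z) /
    ((md {l} (\<lambda>i\<in>{l}. fst z) / Z) * (md {m} (\<lambda>i\<in>{m}. snd z) / Z)))"
  have A: "{l, m} \<subseteq> D" "{l} \<subseteq> D" "{m} \<subseteq> D" using lm by auto
  note [measurable] = md_measurable[OF A(1)] md_measurable[OF A(2)] md_measurable[OF A(3)]
    md_measurable_D[OF A(1)] md_measurable_D[OF A(2)] md_measurable_D[OF A(3)]
    component_measurable_law[OF lm(1)] component_measurable_law[OF lm(2)]
  have "?v \<in> measurable (lborel \<Otimes>\<^sub>M lborel) (L {l, m})" by measurable
  then have [measurable]: "?v \<in> measurable (borel \<Otimes>\<^sub>M borel) (L {l, m})"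
    by (simp cong: measurable_cong_sets sets_pair_measure_cong)
  have [measurable]: "(\<lambda>a. \<lambda>i\<in>{l}. a) \<in> measurable borel (L {l})"
    "(\<lambda>a. \<lambda>i\<in>{m}. a) \<in> measurable borel (L {m})" by measurable
  have densities: "(\<lambda>z. md {l, m} (?v z) / Z) \<in> borel_measurable (borel \<Otimes>\<^sub>M borel)"
    "(\<lambda>a. md {l} (\<lambda>i\<in>{l}. a) / Z) \<in> borel_measurable borel"
    "(\<lambda>a. md {m} (\<lambda>i\<in>{m}. a) / Z) \<in> borel_measurable borel" by measurable
  interpret prob_space law by (rule law_prob)
  have "has_bochner_integral (distr law (borel \<Otimes>\<^sub>M borel) (\<lambda>x. (x l, x m))) ?k r"
  proof (rule has_mutual_info_lborel[OF _ densities _ _ distr_law_pair[OF lm] _ _ I])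
    show "prob_space (distr law (borel \<Otimes>\<^sub>M borel) (\<lambda>x. (x l, x m)))"
      by (rule prob_space_distr) measurable
    show "distr (distr law (borel \<Otimes>\<^sub>M borel) (\<lambda>x. (x l, x m))) borel fst =
        density lborel (\<lambda>a. ennreal (md {l} (\<lambda>i\<in>{l}. a) / Z))"
      by (subst distr_Pair_fst) (auto simp: distr_law_component lm)
    show "distr (distr law (borel \<Otimes>\<^sub>M borel) (\<lambda>x. (x l, x m))) borel snd =
        density lborel (\<lambda>a. ennreal (md {m} (\<lambda>i\<in>{m}. a) / Z))"
      by (subst distr_Pair_snd) (auto simp: distr_law_component lm)
  qed (use md_nonneg Z_pos in \<open>auto intro!: divide_nonneg_pos\<close>)
  then have "has_bochner_integral law (\<lambda>x. ?k (x l, x m)) r"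
    by (simp add: has_bochner_integral_iff integrable_distr_eq integral_distr)
  moreover have "?k (x l, x m) = ln (Z * md {l, m} x / (md {l} x * md {m} x))" for x
  proof -
    have "md {l, m} (?v (x l, x m)) = md {l, m} (restrict x {l, m})"
      by (rule arg_cong[where f = "md {l, m}"]) (auto simp: fun_eq_iff)
    moreover have "md {l} (\<lambda>i\<in>{l}. x l) = md {l} (restrict x {l})" "md {m} (\<lambda>i\<in>{m}. x m) = md {m} (restrict x {m})"
      by (rule arg_cong[where f = "md _"]; auto simp: fun_eq_iff)+
    ultimately show ?thesis using Z_pos by (simp add: md_restrict field_simps)
  qed
  ultimately have "has_bochner_integral law (\<lambda>x. ln (Z * md {l, m} x / (md {l} x * md {m} x))) r"
    by simp
  then have "has_bochner_integral (L D)
      (\<lambda>x. (p x y / Z) *\<^sub>R ln (Z * md {l, m} x / (md {l} x * md {m} x))) r"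
    unfolding law_def using nonneg Z_pos
    by (simp add: has_bochner_integral_iff integrable_density integral_density)
  then have "has_bochner_integral (L D)
      (\<lambda>x. Z * ((p x y / Z) *\<^sub>R ln (Z * md {l, m} x / (md {l} x * md {m} x)))) (Z * r)"
    by (intro has_bochner_integral_mult_right) simp
  then show ?thesis using Z_pos by simp
qed

text \<open>\<open>F\<close> collects all terms that do not depend on the tree; its extended
  integral is the constant \<open>K\<close> and may be infinite. The edge terms are integrable by
  \<open>has_bochner_integral_log_ratio\<close>, hence can be split off by
  \<open>extended_integral_diff\<close>.\<close>

lemma extended_integral_gnb:
  assumes D: "0 \<notin> D" "2 \<le> card D"
    and I: "\<And>l m. l \<in> D \<Longrightarrow> m \<in> D \<Longrightarrow> l \<noteq> m \<Longrightarrow>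
      has_mutual_info (distr law (borel \<Otimes>\<^sub>M borel) (\<lambda>x. (x l, x m))) (r l m)"
  shows "\<exists>K. \<forall>T. spanning_tree D T \<longrightarrow>
    extended_integral (L D) (\<lambda>x. p x y * ln (p x y / gnb_density D p (gnb_of_tree D T) x y)) =
    K + ereal (- (\<Sum>e\<in>T. Z * edge_weight r e))"
proof (intro exI allI impI)
  \<comment> \<open>The summand with ln Z compensates the factor Z inside the logarithm of each of
    the card D - 1 edge terms.\<close>
  define F where "F x = p x y * (ln (p x y) - (\<Sum>s\<in>D. ln (md {s} x)) + (card D - 1) * ln Z)" for x
  fix T assume T: "spanning_tree D T"
  then have sT: "T \<subseteq> complete_edges D" by (auto simp: spanning_tree_def)
  have finT: "finite T" using sT finite_D finite_complete_edges finite_subset by blast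
  define H where "H e x = ln (Z * md e x / (md {Min e} x * md {Max e} x))" for e x
  \<comment> \<open>The endpoints in increasing order, to match the representative chosen by
    \<open>edge_weight\<close>.\<close>
  have e: "e = {Min e, Max e} \<and> Min e \<in> D \<and> Max e \<in> D \<and> Min e \<noteq> Max e" if "e \<in> T" for e
  proof -
    from that sT obtain u v where uv: "e = {u, v}" "u \<in> D" "v \<in> D" "u \<noteq> v"
      by (auto simp: complete_edges_def)
    then show ?thesis by (cases u v rule: linorder_cases) (auto simp: insert_commute)
  qed
  have [measurable]: "md {s} \<in> borel_measurable (L D)" if "s \<in> D" for s
    using md_measurable_D[of "{s}"] that by simp
  have [measurable]: "F \<in> borel_measurable (L D)" unfolding F_def by measurable
  have int: "has_bochner_integral (L D) (\<lambda>x. \<Sum>e\<in>T. p x y * H e x) (\<Sum>e\<in>T. Z * edge_weight r e)"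
  proof (rule has_bochner_integral_sum)
    fix e' assume e': "e' \<in> T"
    show "has_bochner_integral (L D) (\<lambda>x. p x y * H e' x) (Z * edge_weight r e')"
      unfolding H_def edge_weight_def
      using has_bochner_integral_log_ratio[of "Min e'" "Max e'" "r (Min e') (Max e')"] e[OF e'] I by simp
  qed
  have "AE x in L D. \<forall>e\<in>T. 0 < p x y \<longrightarrow> 0 < md e x"
    using sT by (intro AE_finite_allI finT AE_marginal_pos) (auto simp: complete_edges_def)
  moreover have "AE x in L D. \<forall>s\<in>D. 0 < p x y \<longrightarrow> 0 < md {s} x"
    by (intro AE_finite_allI finite_D AE_marginal_pos) auto
  ultimately have "AE x in L D. p x y * ln (p x y / gnb_density D p (gnb_of_tree D T) x y) =
      F x - (\<Sum>e\<in>T. p x y * H e x)"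
  proof eventually_elim
    case (elim x)
    show ?case
    proof (cases "p x y = 0")
      case True
      then show ?thesis by (simp add: F_def)
    next
      case False
      then have p: "0 < p x y" using nonneg[of x] by simp
      have pos: "\<And>e. e \<in> T \<Longrightarrow> 0 < md e x" "\<And>s. s \<in> D \<Longrightarrow> 0 < md {s} x" using elim p by auto
      let ?g = "(\<Prod>e\<in>T. md e x) / (\<Prod>s\<in>D. md {s} x ^ (degree_in T s - 1))"
      have "0 < ?g" using pos by (intro divide_pos_pos prod_pos) auto
      then have "ln (p x y / ?g) = ln (p x y) - ln ?g" using p by (intro ln_divide_pos)
      also have "ln ?g = (\<Sum>s\<in>D. ln (md {s} x)) + (\<Sum>e\<in>T. ln (md e x) - (\<Sum>s\<in>e. ln (md {s} x)))"
        by (rule ln_tree_product[OF finite_D D(2) T pos])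
      also have "(\<Sum>e\<in>T. ln (md e x) - (\<Sum>s\<in>e. ln (md {s} x))) = (\<Sum>e\<in>T. H e x - ln Z)"
      proof (rule sum.cong[OF refl])
        fix e' assume e': "e' \<in> T"
        let ?u = "Min e'" and ?v = "Max e'"
        have "(\<Sum>s\<in>e'. ln (md {s} x)) = (\<Sum>s\<in>{?u, ?v}. ln (md {s} x))"
          using e[OF e'] by simp
        also have "\<dots> = ln (md {?u} x) + ln (md {?v} x)"
          using e[OF e', THEN conjunct2] by simp
        finally show "ln (md e' x) - (\<Sum>s\<in>e'. ln (md {s} x)) = H e' x - ln Z"
          using pos e[OF e'] e' Z_pos by (simp add: H_def ln_divide_pos ln_mult_pos)
      qed
      \<comment> \<open>Here the number of edges of a spanning tree is used: it makes the ln Z terms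
        independent of \<open>T\<close>.\<close>
      also have "\<dots> = (\<Sum>e\<in>T. H e x) - (card D - 1) * ln Z"
        using spanning_tree_gnb(2)[OF finite_D D(2) T] by (simp add: sum_subtractf)
      finally have ln_ratio: "ln (p x y / ?g) = ln (p x y) - ((\<Sum>s\<in>D. ln (md {s} x)) +
        ((\<Sum>e\<in>T. H e x) - (card D - 1) * ln Z))" .
      show ?thesis
        unfolding gnb_density_tree[OF finite_D D(1) T] F_def sum_distrib_left[symmetric] ln_ratio
        by (simp add: algebra_simps)
    qed
  qed
  then show "extended_integral (L D) (\<lambda>x. p x y * ln (p x y / gnb_density D p (gnb_of_tree D T) x y)) =
      extended_integral (L D)
        (\<lambda>x. p x y * (ln (p x y) - (\<Sum>s\<in>D. ln (md {s} x)) + (card D - 1) * ln Z)) +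
      ereal (- (\<Sum>e\<in>T. Z * edge_weight r e))"
    unfolding F_def[symmetric]
    by (subst extended_integral_diff[OF _ int, symmetric]) (auto intro: extended_integral_cong_AE)
qed

end

section \<open>Conditioning on the class\<close>

locale class_model = prob_space M for M :: "'a measure" +
  fixes D :: "nat set" and X :: "nat \<Rightarrow> 'a \<Rightarrow> real" and Y :: "'a \<Rightarrow> 'y" and \<Y> :: "'y set"
    and p :: "(nat \<Rightarrow> real) \<Rightarrow> 'y \<Rightarrow> real"
  assumes finite_D: "finite D" and finite_\<Y>: "finite \<Y>" and nonneg: "\<And>x y. 0 \<le> p x y"
    and joint: "distributed M ((\<Pi>\<^sub>M i\<in>D. lborel) \<Otimes>\<^sub>M count_space \<Y>)
      (\<lambda>\<omega>. (\<lambda>i\<in>D. X i \<omega>, Y \<omega>)) (\<lambda>(x, y). ennreal (p x y))"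
begin

abbreviation base :: "(nat \<Rightarrow> real) measure" where
  "base \<equiv> \<Pi>\<^sub>M i\<in>D. lborel"

lemma joint_measurable: "(\<lambda>\<omega>. (\<lambda>i\<in>D. X i \<omega>, Y \<omega>)) \<in> measurable M (base \<Otimes>\<^sub>M count_space \<Y>)"
  using joint by (simp add: distributed_def)

lemma vector_measurable: "(\<lambda>\<omega>. \<lambda>i\<in>D. X i \<omega>) \<in> measurable M base"
  using measurable_compose[OF joint_measurable measurable_fst] by simp

lemma Y_measurable: "Y \<in> measurable M (count_space \<Y>)"
  using measurable_compose[OF joint_measurable measurable_snd] by simp

lemma X_measurable: "i \<in> D \<Longrightarrow> X i \<in> borel_measurable M"
  using measurable_compose[OF vector_measurable measurable_component_singleton[of i D]] by simp

lemma class_event: "y \<in> \<Y> \<Longrightarrow> Y -` {y} \<inter> space M \<in> sets M"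
  using measurable_sets[OF Y_measurable, of "{y}"] by simp

lemma density_measurable:
  assumes "y \<in> \<Y>"
  shows "(\<lambda>x. p x y) \<in> borel_measurable base"
proof -
  have "(\<lambda>(x, y). ennreal (p x y)) \<in> borel_measurable (base \<Otimes>\<^sub>M count_space \<Y>)"
    using joint by (simp add: distributed_def)
  from measurable_compose[OF measurable_Pair2' this, of y] assms
  have "(\<lambda>x. ennreal (p x y)) \<in> borel_measurable base" by simp
  then have "(\<lambda>x. enn2real (ennreal (p x y))) \<in> borel_measurable base"
    by (rule measurable_compose) simp
  then show ?thesis using nonneg by simp
qed

text \<open>Fubini against the counting measure on the finitely many classes: the inner integral
  reduces to its term at y.\<close>

lemma emeasure_class:
  assumes y: "y \<in> \<Y>" and E[measurable]: "E \<in> sets base"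
  shows "emeasure M {\<omega> \<in> Y -` {y} \<inter> space M. (\<lambda>i\<in>D. X i \<omega>) \<in> E} =
    (\<integral>\<^sup>+x. ennreal (p x y) * indicator E x \<partial>base)"
proof -
  let ?P = "base \<Otimes>\<^sub>M count_space \<Y>" and ?f = "\<lambda>(x, y). ennreal (p x y)"
  interpret C: sigma_finite_measure "count_space \<Y>"
    by (rule sigma_finite_measure_count_space_finite[OF finite_\<Y>])
  have [measurable]: "{y} \<in> sets (count_space \<Y>)" using y by simp
  have f[measurable]: "?f \<in> borel_measurable ?P" using joint by (simp add: distributed_def)
  have "emeasure M {\<omega> \<in> Y -` {y} \<inter> space M. (\<lambda>i\<in>D. X i \<omega>) \<in> E} =
      emeasure (distr M ?P (\<lambda>\<omega>. (\<lambda>i\<in>D. X i \<omega>, Y \<omega>))) (E \<times> {y})"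
    using joint_measurable by (subst emeasure_distr) (auto intro!: arg_cong2[where f = emeasure])
  also have "\<dots> = (\<integral>\<^sup>+z. ?f z * indicator (E \<times> {y}) z \<partial>?P)"
    unfolding distributed_distr_eq_density[OF joint] by (rule emeasure_density) measurable
  also have "\<dots> = (\<integral>\<^sup>+x. \<integral>\<^sup>+y'. ?f (x, y') * indicator (E \<times> {y}) (x, y') \<partial>count_space \<Y> \<partial>base)"
    by (rule C.nn_integral_fst[symmetric]) measurable
  also have "\<dots> = (\<integral>\<^sup>+x. ennreal (p x y) * indicator E x \<partial>base)"
  proof (rule nn_integral_cong)
    fix x
    have "(\<integral>\<^sup>+y'. ?f (x, y') * indicator (E \<times> {y}) (x, y') \<partial>count_space \<Y>) =
        (\<Sum>y'\<in>\<Y>. if y' = y then ennreal (p x y) * indicator E x else 0)"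
      using finite_\<Y> by (subst nn_integral_count_space_finite) (auto simp: indicator_def intro!: sum.cong)
    then show "(\<integral>\<^sup>+y'. ?f (x, y') * indicator (E \<times> {y}) (x, y') \<partial>count_space \<Y>) =
        ennreal (p x y) * indicator E x"
      using finite_\<Y> y by simp
  qed
  finally show ?thesis .
qed

lemma class_total:
  assumes y: "y \<in> \<Y>"
  shows "(\<integral>\<^sup>+x. ennreal (p x y) \<partial>base) = ennreal (class_prob M Y y)"
proof -
  have "{\<omega> \<in> Y -` {y} \<inter> space M. (\<lambda>i\<in>D. X i \<omega>) \<in> space base} = Y -` {y} \<inter> space M"
    using measurable_space[OF vector_measurable] by auto
  then show ?thesis
    using emeasure_class[OF y sets.top] emeasure_eq_measure
    by (simp add: class_prob_def cong: nn_integral_cong)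
qed

end

text \<open>Conditioning needs an event of positive probability; classes of probability 0 are
  treated separately in \<open>class_divergence\<close>.\<close>

locale positive_class = class_model +
  fixes y :: 'y
  assumes y: "y \<in> \<Y>" and pos: "0 < class_prob M Y y"
begin

sublocale class_density D p y "class_prob M Y y"
  using finite_D nonneg density_measurable[OF y] class_total[OF y] pos by unfold_locales auto

abbreviation N :: "'a measure" where
  "N \<equiv> given_class M Y y"

lemma given_class_prob: "prob_space N"
proof -
  have "emeasure M (Y -` {y} \<inter> space M) \<noteq> 0"
    using pos by (simp add: emeasure_eq_measure class_prob_def)
  then show ?thesis unfolding given_class_def by (intro prob_space_uniform_measure) auto
qed

lemma sets_given_class [measurable_cong]: "sets N = sets M"
  by (simp add: given_class_def)

lemma X_measurable_given: "i \<in> D \<Longrightarrow> X i \<in> borel_measurable N"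
  using X_measurable by (simp cong: measurable_cong_sets add: sets_given_class)

text \<open>The bridge between the two forms of conditioning, restricting and rescaling the
  probability measure or rescaling the density p(., y). It lets the statements about
  \<open>law\<close> speak about the variables X.\<close>

lemma distr_given_class: "distr N base (\<lambda>\<omega>. \<lambda>i\<in>D. X i \<omega>) = law"
proof (rule measure_eqI)
  fix E assume "E \<in> sets (distr N base (\<lambda>\<omega>. \<lambda>i\<in>D. X i \<omega>))"
  then have E[measurable]: "E \<in> sets base" by simp
  let ?Z = "class_prob M Y y" and ?A = "Y -` {y} \<inter> space M"
  note [measurable] = class_event[OF y] vector_measurable density_measurable[OF y]
  have v: "(\<lambda>\<omega>. \<lambda>i\<in>D. X i \<omega>) \<in> measurable N base"
    using vector_measurable by (simp cong: measurable_cong_sets add: sets_given_class)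
  let ?S = "(\<lambda>\<omega>. \<lambda>i\<in>D. X i \<omega>) -` E \<inter> space M"
  have S: "?S \<in> sets M" by measurable
  have "emeasure (distr N base (\<lambda>\<omega>. \<lambda>i\<in>D. X i \<omega>)) E = emeasure N ?S"
    using v E by (subst emeasure_distr) (auto simp: given_class_def)
  also have "\<dots> = emeasure M (?A \<inter> ?S) / emeasure M ?A"
    unfolding given_class_def by (rule emeasure_uniform_measure[OF class_event[OF y] S])
  also have "?A \<inter> ?S = {\<omega> \<in> ?A. (\<lambda>i\<in>D. X i \<omega>) \<in> E}" by auto
  also have "emeasure M \<dots> = (\<integral>\<^sup>+x. ennreal (p x y) * indicator E x \<partial>base)"
    by (rule emeasure_class[OF y E])
  also have "\<dots> / emeasure M ?A = (\<integral>\<^sup>+x. ennreal (p x y) * indicator E x / ennreal ?Z \<partial>base)"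
    by (subst nn_integral_divide) (auto simp: class_prob_def emeasure_eq_measure)
  also have "\<dots> = (\<integral>\<^sup>+x. ennreal (p x y / ?Z) * indicator E x \<partial>base)"
    using pos nonneg by (intro nn_integral_cong) (simp add: indicator_def divide_ennreal)
  also have "\<dots> = emeasure law E"
    unfolding law_def by (rule emeasure_density[symmetric]) measurable
  finally show "emeasure (distr N base (\<lambda>\<omega>. \<lambda>i\<in>D. X i \<omega>)) E = emeasure law E" .
qed (simp add: sets_law)

lemma vector_measurable_given: "(\<lambda>\<omega>. \<lambda>i\<in>D. X i \<omega>) \<in> measurable N base"
  using vector_measurable by (simp cong: measurable_cong_sets add: sets_given_class)

lemma distr_given_component:
  assumes l: "l \<in> D"
  shows "distr N borel (X l) = distr law borel (\<lambda>x. x l)"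
  unfolding distr_given_class[symmetric] using l
  by (subst distr_distr[OF _ vector_measurable_given]) (auto simp: comp_def)

lemma distr_given_pair:
  assumes lm: "l \<in> D" "m \<in> D"
  shows "distr N (borel \<Otimes>\<^sub>M borel) (\<lambda>\<omega>. (X l \<omega>, X m \<omega>)) =
    distr law (borel \<Otimes>\<^sub>M borel) (\<lambda>x. (x l, x m))"
  unfolding distr_given_class[symmetric] using lm
  by (subst distr_distr[OF _ vector_measurable_given]) (auto simp: comp_def)

lemma given_atomless:
  assumes l: "l \<in> D"
  shows "measure (distr N borel (X l)) {a} = 0"
proof -
  let ?f = "\<lambda>a. ennreal (md {l} (\<lambda>i\<in>{l}. a) / class_prob M Y y)"
  have "{l} \<subseteq> D" using l by simp
  from measurable_compose[OF _ md_measurable[OF this], of "\<lambda>a. \<lambda>i\<in>{l}. a" borel]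
  have "(\<lambda>a. md {l} (\<lambda>i\<in>{l}. a)) \<in> borel_measurable borel" by measurable
  then have [measurable]: "?f \<in> borel_measurable borel" by measurable
  have "AE x in density lborel ?f. x \<noteq> a"
    by (subst AE_density) (auto intro: AE_mp[OF AE_lborel_singleton])
  then have "emeasure (density lborel ?f) {a} = 0"
    by (subst (asm) AE_iff_measurable[where N = "{a}"]) auto
  then show ?thesis
    unfolding distr_given_component[OF l] distr_law_component[OF l] by (simp add: measure_def)
qed

text \<open>Given the class, the pair has a Lebesgue density on the plane, so its law cannot be
  carried by a graph.\<close>

lemma given_nondegenerate:
  assumes lm: "l \<in> D" "m \<in> D" "l \<noteq> m" and [measurable]: "g \<in> borel_measurable borel"
  shows "\<not> (AE \<omega> in N. X m \<omega> = g (X l \<omega>))" "\<not> (AE \<omega> in N. X l \<omega> = g (X m \<omega>))"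
proof -
  note [measurable] = X_measurable_given[OF lm(1)] X_measurable_given[OF lm(2)]
  let ?v = "\<lambda>z. \<lambda>i\<in>{l, m}. if i = l then fst z else snd z"
  let ?f = "\<lambda>z. ennreal (md {l, m} (?v z) / class_prob M Y y)"
  let ?\<mu> = "distr N (borel \<Otimes>\<^sub>M borel) (\<lambda>\<omega>. (X l \<omega>, X m \<omega>))"
  have A: "{l, m} \<subseteq> D" using lm by simp
  have "?v \<in> measurable (lborel \<Otimes>\<^sub>M lborel) (PiM {l, m} (\<lambda>_. lborel))" by measurable
  then have "?v \<in> measurable (borel \<Otimes>\<^sub>M borel) (PiM {l, m} (\<lambda>_. lborel))"
    by (simp cong: measurable_cong_sets sets_pair_measure_cong)
  from measurable_compose[OF this md_measurable[OF A]]
  have f: "?f \<in> borel_measurable (borel \<Otimes>\<^sub>M borel)" by measurable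
  have \<mu>: "?\<mu> = density (lborel \<Otimes>\<^sub>M lborel) ?f"
    unfolding distr_given_pair[OF lm(1,2)] by (rule distr_law_pair[OF lm])
  have "prob_space ?\<mu>" by (rule prob_space.prob_space_distr[OF given_class_prob]) measurable
  note graph = lborel_density_not_graph[OF this \<mu> f \<open>g \<in> borel_measurable borel\<close>]
  show "\<not> (AE \<omega> in N. X m \<omega> = g (X l \<omega>))"
    using graph(1) by (subst (asm) AE_distr_iff) auto
  show "\<not> (AE \<omega> in N. X l \<omega> = g (X m \<omega>))"
    using graph(2) by (subst (asm) AE_distr_iff) auto
qed

lemma gaussian_class:
  assumes G: "gaussian_vector N D X \<mu> \<Sigma>" and lm: "l \<in> D" "m \<in> D" "l \<noteq> m"
  shows "has_mutual_info (distr N (borel \<Otimes>\<^sub>M borel) (\<lambda>\<omega>. (X l \<omega>, X m \<omega>)))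
    (- (1 / 2) * ln (1 - (correlation N (X l) (X m))\<^sup>2))"
proof -
  have "correlation N (X l) (X m) = \<Sigma> l m / (sqrt (\<Sigma> l l) * sqrt (\<Sigma> m m))"
    by (rule gaussian_vector_correlation[OF given_class_prob G finite_D lm given_nondegenerate[OF lm]])
  then show ?thesis
    by (simp only:) (rule gaussian_vector_mutual_info[OF given_class_prob G finite_D lm
      given_nondegenerate[OF lm]])
qed

lemma gauss_copula_class:
  assumes C: "has_pair_gauss_copula N X l m \<rho>" and lm: "l \<in> D" "m \<in> D" "l \<noteq> m"
  shows "has_mutual_info (distr N (borel \<Otimes>\<^sub>M borel) (\<lambda>\<omega>. (X l \<omega>, X m \<omega>)))
    (- (1 / 2) * ln (1 - \<rho>\<^sup>2))"
  by (rule pair_gauss_copula_mutual_info[OF given_class_prob X_measurable_given[OF lm(1)]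
    X_measurable_given[OF lm(2)] given_atomless[OF lm(1)] given_atomless[OF lm(2)] lm(3)
    given_nondegenerate[OF lm] C])

lemma copula_class:
  assumes C: "copula_density_finite_entropy N (X l) (X m) c" and lm: "l \<in> D" "m \<in> D"
  shows "has_mutual_info (distr N (borel \<Otimes>\<^sub>M borel) (\<lambda>\<omega>. (X l \<omega>, X m \<omega>)))
    (copula_information N (X l) (X m))"
  by (rule copula_information_eq_mutual_info[OF given_class_prob X_measurable_given[OF lm(1)]
    X_measurable_given[OF lm(2)] given_atomless[OF lm(1)] given_atomless[OF lm(2)] C])

end

section \<open>From a single class to the whole divergence\<close>

context class_model
begin

text \<open>For a class of probability 0 the function p(., y) vanishes almost everywhere, so its
  term is 0 for every tree and the constant 0 serves.\<close>

lemma class_divergence: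
  assumes D: "0 \<notin> D" "2 \<le> card D" and y: "y \<in> \<Y>"
    and I: "\<And>l m. 0 < class_prob M Y y \<Longrightarrow> l \<in> D \<Longrightarrow> m \<in> D \<Longrightarrow> l \<noteq> m \<Longrightarrow>
      has_mutual_info (distr (given_class M Y y) (borel \<Otimes>\<^sub>M borel) (\<lambda>\<omega>. (X l \<omega>, X m \<omega>))) (r l m)"
  shows "\<exists>K. \<forall>T. spanning_tree D T \<longrightarrow>
    extended_integral base (\<lambda>x. p x y * ln (p x y / gnb_density D p (gnb_of_tree D T) x y)) =
    K + ereal (- (\<Sum>e\<in>T. class_prob M Y y * edge_weight r e))"
proof (cases "0 < class_prob M Y y")
  case True
  then interpret positive_class M D X Y \<Y> p y using y by unfold_locales
  show ?thesis
    using I[OF True] by (intro extended_integral_gnb[OF D]) (simp add: distr_given_pair)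
next
  case False
  then have 0: "class_prob M Y y = 0" by (simp add: class_prob_def less_le)
  note [measurable] = density_measurable[OF y]
  have "(\<integral>\<^sup>+x. ennreal (p x y) \<partial>base) = 0" using class_total[OF y] 0 by simp
  then have "AE x in base. p x y = 0"
    using nonneg by (subst (asm) nn_integral_0_iff_AE) (auto simp: ennreal_eq_0_iff antisym)
  then have "extended_integral base (\<lambda>x. p x y * ln (p x y / gnb_density D p E x y)) = 0" for E
    by (subst extended_integral_cong_AE[where g = "\<lambda>_. 0"]) (auto simp: extended_integral_def)
  then show ?thesis by (intro exI[of _ 0]) (simp add: 0 zero_ereal_def[symmetric])
qed

text \<open>The constants of the classes add up to K, possibly infinite; addition in
  \<open>ereal\<close> is associative and commutative, so they separate from the finite edge sums.
  Exchanging the sums over classes and edges then produces \<open>w\<close>, with the scale factor c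
  divided out.\<close>

lemma KL_gnb_tree:
  assumes D: "0 \<notin> D" "2 \<le> card D"
    and I: "\<And>y l m. y \<in> \<Y> \<Longrightarrow> 0 < class_prob M Y y \<Longrightarrow> l \<in> D \<Longrightarrow> m \<in> D \<Longrightarrow> l \<noteq> m \<Longrightarrow>
      has_mutual_info (distr (given_class M Y y) (borel \<Otimes>\<^sub>M borel) (\<lambda>\<omega>. (X l \<omega>, X m \<omega>))) (r y l m)"
    and c: "0 < c" and w: "\<And>l m. w l m = c * (\<Sum>y\<in>\<Y>. class_prob M Y y * r y l m)"
  shows "\<exists>K. \<forall>T. spanning_tree D T \<longrightarrow>
    KL_gnb D \<Y> p (gnb_of_tree D T) = K + ereal (- ((\<Sum>e\<in>T. edge_weight w e) / c))"
proof -
  have "\<forall>y\<in>\<Y>. \<exists>K. \<forall>T. spanning_tree D T \<longrightarrow>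
      extended_integral base (\<lambda>x. p x y * ln (p x y / gnb_density D p (gnb_of_tree D T) x y)) =
      K + ereal (- (\<Sum>e\<in>T. class_prob M Y y * edge_weight (r y) e))"
    using class_divergence[OF D] I by blast
  from bchoice[OF this] obtain K where K: "\<forall>y\<in>\<Y>. \<forall>T. spanning_tree D T \<longrightarrow>
      extended_integral base (\<lambda>x. p x y * ln (p x y / gnb_density D p (gnb_of_tree D T) x y)) =
      K y + ereal (- (\<Sum>e\<in>T. class_prob M Y y * edge_weight (r y) e))" ..
  have "KL_gnb D \<Y> p (gnb_of_tree D T) = sum K \<Y> + ereal (- ((\<Sum>e\<in>T. edge_weight w e) / c))"
    if T: "spanning_tree D T" for T
  proof -
    have "KL_gnb D \<Y> p (gnb_of_tree D T) =
        sum K \<Y> + ereal (\<Sum>y\<in>\<Y>. - (\<Sum>e\<in>T. class_prob M Y y * edge_weight (r y) e))"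
      unfolding KL_gnb_def using K T by (simp add: sum.distrib)
    also have "(\<Sum>y\<in>\<Y>. - (\<Sum>e\<in>T. class_prob M Y y * edge_weight (r y) e)) =
        - (\<Sum>e\<in>T. \<Sum>y\<in>\<Y>. class_prob M Y y * edge_weight (r y) e)"
      by (simp only: sum_negf sum.swap[of _ T \<Y>])
    also have "\<dots> = - ((\<Sum>e\<in>T. edge_weight w e) / c)"
      using c by (simp add: edge_weight_def w sum_distrib_left[symmetric])
    finally show ?thesis .
  qed
  then show ?thesis by blast
qed

text \<open>Each competitor comes from a spanning tree by \<open>gnb_structure_tree\<close>, so both
  divergences have the same constant K. Adding K preserves the inequality between the edge sums even
  when K is infinite.\<close>

lemma maximum_spanning_tree_optimal:
  assumes D: "0 \<notin> D" "2 \<le> card D"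
    and I: "\<And>y l m. y \<in> \<Y> \<Longrightarrow> 0 < class_prob M Y y \<Longrightarrow> l \<in> D \<Longrightarrow> m \<in> D \<Longrightarrow> l \<noteq> m \<Longrightarrow>
      has_mutual_info (distr (given_class M Y y) (borel \<Otimes>\<^sub>M borel) (\<lambda>\<omega>. (X l \<omega>, X m \<omega>))) (r y l m)"
    and c: "0 < c" and w: "\<And>l m. w l m = c * (\<Sum>y\<in>\<Y>. class_prob M Y y * r y l m)"
    and T: "maximum_spanning_tree D w T" and E: "gnb_structure D E"
  shows "KL_gnb D \<Y> p (gnb_of_tree D T) \<le> KL_gnb D \<Y> p E"
proof -
  obtain K where K: "\<And>T. spanning_tree D T \<Longrightarrow>
      KL_gnb D \<Y> p (gnb_of_tree D T) = K + ereal (- ((\<Sum>e\<in>T. edge_weight w e) / c))"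
    using KL_gnb_tree[OF D I c w] by blast
  obtain T' where T': "spanning_tree D T'" "E = gnb_of_tree D T'"
    using gnb_structure_tree[OF E] .
  have "(\<Sum>e\<in>T'. edge_weight w e) \<le> (\<Sum>e\<in>T. edge_weight w e)" "spanning_tree D T"
    using T T'(1) by (auto simp: maximum_spanning_tree_def)
  then show ?thesis
    using T' c by (simp add: K divide_right_mono add_left_mono)
qed

end

theorem mainTheorem5:
  fixes M :: "'a measure"
    and d :: nat
    and X :: "nat \<Rightarrow> 'a \<Rightarrow> real"
    and Y :: "'a \<Rightarrow> 'y"
    and \<Y> :: "'y set"
    and p :: "(nat \<Rightarrow> real) \<Rightarrow> 'y \<Rightarrow> real"
    and \<rho>G :: "'y \<Rightarrow> nat \<Rightarrow> nat \<Rightarrow> real"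
    and w :: "nat \<Rightarrow> nat \<Rightarrow> real"
  defines "D \<equiv> {1..d}"
  assumes "prob_space M"
    and "2 \<le> d"
    and "finite \<Y>"
    and "\<And>x y. 0 \<le> p x y"
    and "distributed M ((\<Pi>\<^sub>M i\<in>D. lborel) \<Otimes>\<^sub>M count_space \<Y>)
           (\<lambda>\<omega>. (\<lambda>i\<in>D. X i \<omega>, Y \<omega>)) (\<lambda>(x, y). ennreal (p x y))"
    and weights:
      "(w = (\<lambda>l m. - gaussian_log_sum M X Y \<Y> l m) \<and>
        (\<forall>y\<in>\<Y>. 0 < class_prob M Y y \<longrightarrow>
           (\<exists>\<mu> \<Sigma>. gaussian_vector (given_class M Y y) D X \<mu> \<Sigma>)))
     \<or> (w = (\<lambda>l m. - gauss_copula_log_sum M Y \<Y> \<rho>G l m) \<and>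
        (\<forall>y\<in>\<Y>. 0 < class_prob M Y y \<longrightarrow>
           (\<exists>R. has_gauss_copula (given_class M Y y) D X R) \<and>
           (\<forall>l\<in>D. \<forall>m\<in>D. l \<noteq> m \<longrightarrow>
              has_pair_gauss_copula (given_class M Y y) X l m (\<rho>G y l m))))
     \<or> (w = copula_weight M X Y \<Y> \<and>
        (\<forall>y\<in>\<Y>. 0 < class_prob M Y y \<longrightarrow>
           (\<forall>l\<in>D. \<forall>m\<in>D. l \<noteq> m \<longrightarrow>
              (\<exists>c. copula_density_finite_entropy (given_class M Y y) (X l) (X m) c))))"
  shows "(\<exists>T. prim_output D w T) \<and> (\<exists>T. kruskal_output D w T) \<and>
    (\<forall>T. prim_output D w T \<or> kruskal_output D w T \<longrightarrow>
       maximum_spanning_tree D w T \<and>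
       gnb_structure D (gnb_of_tree D T) \<and>
       clusters (gnb_of_tree D T) = {{l, m, 0} | l m. {l, m} \<in> T} \<and>
       (\<forall>E. gnb_structure D E \<longrightarrow> KL_gnb D \<Y> p (gnb_of_tree D T) \<le> KL_gnb D \<Y> p E))"
proof -
  have D: "finite D" "0 \<notin> D" "2 \<le> card D" "D \<noteq> {}" using \<open>2 \<le> d\<close> by (auto simp: D_def)
  interpret class_model M D X Y \<Y> p
    using assms(2,4-6) D(1) by (intro class_model.intro class_model_axioms.intro)
  have positive: "positive_class M D X Y \<Y> p y" if "y \<in> \<Y>" "0 < class_prob M Y y" for y
    using that by unfold_locales
  have optimal: "KL_gnb D \<Y> p (gnb_of_tree D T) \<le> KL_gnb D \<Y> p E"
    if T: "maximum_spanning_tree D w T" and E: "gnb_structure D E" for T E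
    using weights
  proof (elim disjE conjE)
    assume w: "w = (\<lambda>l m. - gaussian_log_sum M X Y \<Y> l m)"
      and G: "\<forall>y\<in>\<Y>. 0 < class_prob M Y y \<longrightarrow> (\<exists>\<mu> \<Sigma>. gaussian_vector (given_class M Y y) D X \<mu> \<Sigma>)"
    show ?thesis
    \<comment> \<open>The constant is 2 because - ln (1 - \<rho>^2) is twice the mutual information
      of a Gaussian pair.\<close>
    proof (rule maximum_spanning_tree_optimal[OF D(2,3) _ _ _ T E, where c = 2
        and r = "\<lambda>y l m. - (1 / 2) * ln (1 - (correlation (given_class M Y y) (X l) (X m))\<^sup>2)"])
      fix y l m assume y: "y \<in> \<Y>" "0 < class_prob M Y y" and lm: "l \<in> D" "m \<in> D" "l \<noteq> m"
      then obtain \<mu> \<Sigma> where "gaussian_vector (given_class M Y y) D X \<mu> \<Sigma>" using G by blast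
      from positive_class.gaussian_class[OF positive[OF y] this lm]
      show "has_mutual_info (distr (given_class M Y y) (borel \<Otimes>\<^sub>M borel) (\<lambda>\<omega>. (X l \<omega>, X m \<omega>)))
        (- (1 / 2) * ln (1 - (correlation (given_class M Y y) (X l) (X m))\<^sup>2))" .
    qed (simp_all add: w gaussian_log_sum_def sum_distrib_left sum_negf)
  next
    assume w: "w = (\<lambda>l m. - gauss_copula_log_sum M Y \<Y> \<rho>G l m)"
      and C: "\<forall>y\<in>\<Y>. 0 < class_prob M Y y \<longrightarrow>
           (\<exists>R. has_gauss_copula (given_class M Y y) D X R) \<and>
           (\<forall>l\<in>D. \<forall>m\<in>D. l \<noteq> m \<longrightarrow>
              has_pair_gauss_copula (given_class M Y y) X l m (\<rho>G y l m))"
    show ?thesis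
    \<comment> \<open>The same constant 2, with the parameter of the pair copula in place of the
      correlation.\<close>
    proof (rule maximum_spanning_tree_optimal[OF D(2,3) _ _ _ T E, where c = 2
        and r = "\<lambda>y l m. - (1 / 2) * ln (1 - (\<rho>G y l m)\<^sup>2)"])
      fix y l m assume y: "y \<in> \<Y>" "0 < class_prob M Y y" and lm: "l \<in> D" "m \<in> D" "l \<noteq> m"
      then have "has_pair_gauss_copula (given_class M Y y) X l m (\<rho>G y l m)" using C by blast
      from positive_class.gauss_copula_class[OF positive[OF y] this lm]
      show "has_mutual_info (distr (given_class M Y y) (borel \<Otimes>\<^sub>M borel) (\<lambda>\<omega>. (X l \<omega>, X m \<omega>)))
        (- (1 / 2) * ln (1 - (\<rho>G y l m)\<^sup>2))" .
    qed (simp_all add: w gauss_copula_log_sum_def sum_distrib_left sum_negf)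
  next
    assume w: "w = copula_weight M X Y \<Y>"
      and C: "\<forall>y\<in>\<Y>. 0 < class_prob M Y y \<longrightarrow> (\<forall>l\<in>D. \<forall>m\<in>D. l \<noteq> m \<longrightarrow>
              (\<exists>c. copula_density_finite_entropy (given_class M Y y) (X l) (X m) c))"
    show ?thesis
    \<comment> \<open>The copula information is the mutual information itself, whence the constant
      1.\<close>
    proof (rule maximum_spanning_tree_optimal[OF D(2,3) _ _ _ T E, where c = 1
        and r = "\<lambda>y l m. copula_information (given_class M Y y) (X l) (X m)"])
      fix y l m assume y: "y \<in> \<Y>" "0 < class_prob M Y y" and lm: "l \<in> D" "m \<in> D" "l \<noteq> m"
      then obtain c where "copula_density_finite_entropy (given_class M Y y) (X l) (X m) c"
        using C by blast
      from positive_class.copula_class[OF positive[OF y] this lm(1,2)]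
      show "has_mutual_info (distr (given_class M Y y) (borel \<Otimes>\<^sub>M borel) (\<lambda>\<omega>. (X l \<omega>, X m \<omega>)))
        (copula_information (given_class M Y y) (X l) (X m))" .
    qed (simp_all add: w copula_weight_def)
  qed
  have result: "maximum_spanning_tree D w T \<and> gnb_structure D (gnb_of_tree D T) \<and>
      clusters (gnb_of_tree D T) = {{l, m, 0} | l m. {l, m} \<in> T} \<and>
      (\<forall>E. gnb_structure D E \<longrightarrow> KL_gnb D \<Y> p (gnb_of_tree D T) \<le> KL_gnb D \<Y> p E)"
    if out: "prim_output D w T \<or> kruskal_output D w T" for T
  proof -
    have T: "maximum_spanning_tree D w T"
      using out prim_output_maximum[OF D(1)] kruskal_output_maximum[OF D(1)] by blast
    then have sT: "spanning_tree D T" by (simp add: maximum_spanning_tree_def)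
    have "insert 0 ` T = {{l, m, 0} | l m. {l, m} \<in> T}"
    proof (intro set_eqI iffI)
      fix C assume "C \<in> insert 0 ` T"
      then obtain e where e: "e \<in> T" "C = insert 0 e" by blast
      then obtain l m where "e = {l, m}"
        using sT by (auto simp: spanning_tree_def complete_edges_def)
      then have "C = {l, m, 0}" "{l, m} \<in> T" using e by auto
      then show "C \<in> {{l, m, 0} | l m. {l, m} \<in> T}" by blast
    next
      fix C assume "C \<in> {{l, m, 0} | l m. {l, m} \<in> T}"
      then obtain l m where "C = insert 0 {l, m}" "{l, m} \<in> T" by auto
      then show "C \<in> insert 0 ` T" by blast
    qed
    then have "clusters (gnb_of_tree D T) = {{l, m, 0} | l m. {l, m} \<in> T}"
      by (simp only: clusters_gnb_of_tree[OF sT D(2)])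
    then show ?thesis
      using T optimal[OF T] spanning_tree_gnb(1)[OF D(1,3) sT] by (intro conjI allI impI)
  qed
  show ?thesis
    by (intro conjI[OF prim_output_exists[OF D(1,4)] conjI[OF kruskal_output_exists[OF D(1)]]]
      allI impI result)
qed

end
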